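(* Let $p\in\mathbb N$ and let $(Y_1,\boldsymbol X_1),(Y_2,\boldsymbol X_2),\ldots$ be iid random pairs with values in $\mathbb R_{>0}\times\mathbb R^p$ following the Fréchet regression model with true parameter $\boldsymbol\eta_\dagger=(\alpha_\dagger,\boldsymbol\beta_\dagger)\in\mathrm H:=\mathbb R_{>0}\times\mathbb R^p$. Write $\boldsymbol X$ for a random vector distributed as $\boldsymbol X_1$. Assume that (1) $\mathsf P[\boldsymbol a^\top\boldsymbol X=0]<1$ for all $\boldsymbol a\in\mathbb R^p\setminus\{\boldsymbol0\}$; (2) $\mathsf E[\exp(\boldsymbol t^\top\boldsymbol X)]<\infty$ for all $\boldsymbol t$ in a neighborhood of $\boldsymbol 0$ in $\mathbb R^p$. Let $\hat{\boldsymbol\eta}_n$ be the conditional maximum likelihood estimator based on the first $n$ pairs. Let $$\mathcal I_{\boldsymbol\eta_\dagger}=\begin{pmatrix}\dfrac1{\alpha_\dagger^2}\left(\dfrac{\pi^2}{6}+(1-\gamma)^2\right)&(1-\gamma)\,\mathsf E[\boldsymbol X]^\top\\ (1-\gamma)\,\mathsf E[\boldsymbol X]&\alpha_\dagger^2\,\mathsf E[\boldsymbol X\boldsymbol X^\top]\end{pmatrix}$$ denote the Fisher information matrix, where $\gamma$ is the Euler--Mascheroni constant. Then, as $n\to\infty$, $$\sqrt n\,(\hat{\boldsymbol\eta}_n-\boldsymbol\eta_\dagger)\ \text{ converges in distribution to }\ \mathrm N\big(\boldsymbol 0,\mathcal I_{\boldsymbol\eta_\dagger}^{-1}\big).$$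
   Context: Vectors in $\mathbb R^p$ are column vectors. Fréchet regression model with parameter $\boldsymbol\eta=(\alpha,\boldsymbol\beta)\in\mathrm H$: for all $\boldsymbol x\in\mathbb R^p$, the conditional distribution of $Y_i$ given $\boldsymbol X_i=\boldsymbol x$ satisfies $$\mathsf P(Y_i\le y\mid\boldsymbol X_i=\boldsymbol x)=\exp\left[-\left(\frac{y}{\exp(\boldsymbol\beta^\top\boldsymbol x)}\right)^{-\alpha}\right],\qquad y>0 .$$ Objective function: with $g(t)=t-\exp(t)$, $$m(\boldsymbol\eta\mid y,\boldsymbol x)=\ln\alpha+g\big(\alpha(\boldsymbol\beta^\top\boldsymbol x-\ln y)\big),\qquad \boldsymbol\eta=(\alpha,\boldsymbol\beta)\in\mathrm H,$$ the conditional log-density of $Y$ given $\boldsymbol X=\boldsymbol x$ with respect to $y^{-1}dy$. Criterion: $M_n(\boldsymbol\eta)=\frac1n\sum_{i=1}^n m(\boldsymbol\eta\mid Y_i,\boldsymbol X_i)$. Definition of the conditional maximum likelihood estimator (CMLE) $\hat{\boldsymbol\eta}_n$: for every $n\ge p+1$, almost surely the set of maximizers of $M_n$ over $\mathrm H$ is nonempty and of the form $\{\hat\alpha\}\times(\hat{\boldsymbol\beta}+\ker\mathbf X)$ with $\hat\alpha\in\mathbb R_{>0}$, $\hat{\boldsymbol\beta}\in\mathbb R^p$, where $\mathbf X=(\boldsymbol X_1,\ldots,\boldsymbol X_n)^\top\in\mathbb R^{n\times p}$; $\hat{\boldsymbol\eta}_n$ is the unique maximizer when there is exactly one (which is the case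 with probability tending to one), and otherwise the maximizer of minimal Euclidean norm. Its values on a null event or for $n<p+1$ are irrelevant. Matrices in the claim are in block form along $\boldsymbol\eta=(\alpha,\boldsymbol\beta)$, hence of size $(1+p)\times(1+p)$. *)

theory Defs
  imports "HOL-Probability.Probability"
begin

text \<open>
  The conditional distribution function of \<open>Y\<close> given \<open>X\<close> is the library's conditional
  expectation of the indicator of \<open>{Y \<le> y}\<close> given the \<open>\<sigma>\<close>-algebra generated by \<open>X\<close>. As
  usual, it is determined up to a null set of values of \<open>X\<close>, for each \<open>y\<close>.
\<close>

definition frechet_regression ::
  "'a measure \<Rightarrow> ('a \<Rightarrow> real) \<Rightarrow> ('a \<Rightarrow> real ^ 'p) \<Rightarrow> real \<times> (real ^ 'p) \<Rightarrow> bool" where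
  "frechet_regression M Y X = (\<lambda>(\<alpha>, \<beta>).
     \<forall>y>0. AE \<omega> in M.
       real_cond_exp M (vimage_algebra (space M) X borel)
         (indicator {\<omega> \<in> space M. Y \<omega> \<le> y}) \<omega>
       = exp (- ((y / exp (\<beta> \<bullet> X \<omega>)) powr (- \<alpha>))))"

definition param_space :: "(real \<times> (real ^ 'p)) set" where
  "param_space = {0<..} \<times> UNIV"

definition gumbel_g :: "real \<Rightarrow> real" where
  "gumbel_g t = t - exp t"

definition frechet_obj :: "real \<times> (real ^ 'p) \<Rightarrow> real \<Rightarrow> real ^ 'p \<Rightarrow> real" where
  "frechet_obj = (\<lambda>(\<alpha>, \<beta>) y x. ln \<alpha> + gumbel_g (\<alpha> * (\<beta> \<bullet> x - ln y)))"

text \<open>Samples are sequences indexed from \<open>0\<close>; the first \<open>n\<close> observations are those with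
  index \<open>i < n\<close>.\<close>

definition frechet_criterion ::
  "nat \<Rightarrow> (nat \<Rightarrow> real) \<Rightarrow> (nat \<Rightarrow> real ^ 'p) \<Rightarrow> real \<times> (real ^ 'p) \<Rightarrow> real" where
  "frechet_criterion n y x \<eta> = (1 / real n) * (\<Sum>i<n. frechet_obj \<eta> (y i) (x i))"

definition frechet_maximizers ::
  "nat \<Rightarrow> (nat \<Rightarrow> real) \<Rightarrow> (nat \<Rightarrow> real ^ 'p) \<Rightarrow> (real \<times> (real ^ 'p)) set" where
  "frechet_maximizers n y x =
     {\<eta> \<in> param_space. \<forall>\<eta>' \<in> param_space.
        frechet_criterion n y x \<eta>' \<le> frechet_criterion n y x \<eta>}"

text \<open>
  The norm on the product type is the Euclidean one. When the set of maximizers is of the form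
  \<open>{a} \<times> (b + ker)\<close>, its element of minimal norm is unique. The value is unspecified for samples
  without such a maximizer.
\<close>

definition frechet_cmle ::
  "nat \<Rightarrow> (nat \<Rightarrow> real) \<Rightarrow> (nat \<Rightarrow> real ^ 'p) \<Rightarrow> real \<times> (real ^ 'p)" where
  "frechet_cmle n y x =
     (if \<exists>!\<eta>. \<eta> \<in> frechet_maximizers n y x
      then (THE \<eta>. \<eta> \<in> frechet_maximizers n y x)
      else arg_min_on norm (frechet_maximizers n y x))"

text \<open>
  Vectors and matrices of size \<open>1 + p\<close> in block form along \<open>(\<alpha>, \<beta>)\<close> are indexed by
  \<open>'p option\<close>: \<open>None\<close> is the coordinate \<open>\<alpha>\<close>, and \<open>Some j\<close> is the coordinate \<open>\<beta> $ j\<close>.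
\<close>

definition stack :: "real \<times> (real ^ 'p) \<Rightarrow> real ^ 'p option" where
  "stack = (\<lambda>(\<alpha>, \<beta>). \<chi> i. case i of None \<Rightarrow> \<alpha> | Some j \<Rightarrow> \<beta> $ j)"

definition frechet_fisher ::
  "'a measure \<Rightarrow> ('a \<Rightarrow> real ^ 'p) \<Rightarrow> real \<Rightarrow> real ^ 'p option ^ 'p option" where
  "frechet_fisher M X \<alpha> = (\<chi> i j. case (i, j) of
       (None, None) \<Rightarrow> (1 / \<alpha>\<^sup>2) * (pi\<^sup>2 / 6 + (1 - euler_mascheroni)\<^sup>2)
     | (None, Some k) \<Rightarrow> (1 - euler_mascheroni) * (LINT \<omega>|M. X \<omega>) $ k
     | (Some l, None) \<Rightarrow> (1 - euler_mascheroni) * (LINT \<omega>|M. X \<omega>) $ l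
     | (Some l, Some k) \<Rightarrow> \<alpha>\<^sup>2 * (LINT \<omega>|M. X \<omega> $ l * X \<omega> $ k))"

text \<open>The normal distribution with mean \<open>\<mu>\<close> and positive definite covariance matrix \<open>\<Sigma>\<close>; the
  definition is not meaningful for other \<open>\<Sigma>\<close>.\<close>

definition multivariate_normal :: "real ^ 'n \<Rightarrow> real ^ 'n ^ 'n \<Rightarrow> (real ^ 'n) measure" where
  "multivariate_normal \<mu> \<Sigma> = density lborel (\<lambda>z. ennreal
     (1 / sqrt ((2 * pi) ^ CARD('n) * det \<Sigma>) *
      exp (- (1 / 2) * ((z - \<mu>) \<bullet> (matrix_inv \<Sigma> *v (z - \<mu>))))))"

text \<open>The library only has weak convergence for measures on the real line (via distribution
  functions).\<close>

definition weakly_converges ::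
  "(nat \<Rightarrow> 'b::topological_space measure) \<Rightarrow> 'b measure \<Rightarrow> bool" where
  "weakly_converges \<mu> \<nu> \<longleftrightarrow>
     (\<forall>f::'b \<Rightarrow> real. continuous_on UNIV f \<longrightarrow> bounded (range f) \<longrightarrow>
        (\<lambda>n. LINT z|\<mu> n. f z) \<longlonglongrightarrow> (LINT z|\<nu>. f z))"

definition converges_in_distribution ::
  "'a measure \<Rightarrow> (nat \<Rightarrow> 'a \<Rightarrow> 'b::topological_space) \<Rightarrow> 'b measure \<Rightarrow> bool" where
  "converges_in_distribution M Z \<nu> \<longleftrightarrow> weakly_converges (\<lambda>n. distr M borel (Z n)) \<nu>"

end

theory Submission
  imports Defs
begin

text \<open>
  Given \<open>X\<close>, the variable \<open>W = (Y / exp (\<beta> \<bullet> X)) powr (- \<alpha>)\<close> is standard exponential, so all moments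
  of the score reduce to derivatives of the Gamma function. Replacing the parameter \<open>(a, b)\<close> by
  \<open>(a, a (b - \<beta>))\<close> makes the log-likelihood concave, and its third-order Taylor remainder
  is bounded explicitly by a sample mean; hence on a ball of local parameters it is uniformly close to
  a quadratic function whose maximizer is the inverse Fisher information applied to the normalized
  score. By concavity, closeness on a small sphere around that point already forces a global
  maximizer to exist and all of them to lie inside the sphere. It remains to apply a multivariate
  central limit theorem to the normalized score. That theorem follows from the one-dimensional one by
  characteristic functions, because trigonometric polynomials approximate bounded continuous
  functions on compact sets.
\<close>

section \<open>Weak convergence from characteristic functions\<close>

text \<open>Joint concavity fails in \<open>(a, b)\<close> because of the product of
  \<open>a\<close> and \<open>b\<close> inside \<open>gumbel_g\<close>. In terms of \<open>a\<close>
  and \<open>a * (b - \<beta>)\<close> the argument \<open>a * (b \<bullet> x - ln y)\<close> is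
  affine, which leaves \<open>ln a\<close> plus affine terms minus an exponential of an affine
  function. Centring at \<beta> and dividing by \<alpha> makes the derivative of the substitution at
  the true parameter the identity; its second-order error is of order \<open>1 / n\<close> and
  vanishes after scaling by \<open>sqrt n\<close>. The set of maximizers is localized as a whole, so
  the rule that selects one of them matters only through membership; compactness of the set
  guarantees that an element of minimal norm exists. One matrix plays two roles, covariance of the
  score and expected curvature. Both are computed explicitly, and their agreement reduces the
  limiting covariance to the inverse of that matrix. Exponential moments serve the remainder term,
  which contains the exponential of a perturbation uniformly over a ball. Since \<open>W\<close> has
  moments only of order greater than -1, the admissible rate is limited even without
  covariates.\<close>

inductive trig_poly :: "('b::real_inner \<Rightarrow> real) \<Rightarrow> bool" where
  trig_poly_cos: "trig_poly (\<lambda>x. cos (t \<bullet> x + s))"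
| trig_poly_scale: "trig_poly f \<Longrightarrow> trig_poly (\<lambda>x. c * f x)"
| trig_poly_add: "trig_poly f \<Longrightarrow> trig_poly g \<Longrightarrow> trig_poly (\<lambda>x. f x + g x)"

lemma trig_poly_const: "trig_poly (\<lambda>x. c)"
  using trig_poly_scale[OF trig_poly_cos[of 0 0], of c] by simp

text \<open>The product-to-sum formula gives the multiplicative closure that the Stone-Weierstrass
  theorem asks for. The phase \<open>s\<close> in the generators keeps sums and differences of
  frequencies inside the class.\<close>

lemma trig_poly_mult:
  assumes "trig_poly f" "trig_poly g"
  shows "trig_poly (\<lambda>x. f x * g x)"
  using assms
proof (induction arbitrary: g)
  case (trig_poly_cos t s)
  from trig_poly_cos show ?case
  proof induction
    case (trig_poly_cos t' s')
    have eq: "cos (t \<bullet> x + s) * cos (t' \<bullet> x + s') =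
       1/2 * cos ((t - t') \<bullet> x + (s - s')) + 1/2 * cos ((t + t') \<bullet> x + (s + s'))" for x
    proof -
      have 1: "(t - t') \<bullet> x + (s - s') = (t \<bullet> x + s) - (t' \<bullet> x + s')"
        "(t + t') \<bullet> x + (s + s') = (t \<bullet> x + s) + (t' \<bullet> x + s')"
        by (simp_all add: inner_simps)
      show ?thesis unfolding 1 cos_times_cos by (simp add: add_divide_distrib)
    qed
    show ?case unfolding eq
      by (intro trig_poly.intros)
  next
    case (trig_poly_scale f c)
    show ?case using trig_poly.trig_poly_scale[OF trig_poly_scale.IH, of c] by (simp add: mult_ac)
  next
    case (trig_poly_add f g)
    show ?case using trig_poly.trig_poly_add[OF trig_poly_add.IH] by (simp add: distrib_left)
  qed
next
  case (trig_poly_scale f c)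
  show ?case using trig_poly.trig_poly_scale[OF trig_poly_scale.IH[OF trig_poly_scale.prems], of c]
    by (simp add: mult_ac)
next
  case (trig_poly_add f f')
  show ?case using trig_poly.trig_poly_add[OF trig_poly_add.IH(1)[OF trig_poly_add.prems]
      trig_poly_add.IH(2)[OF trig_poly_add.prems]] by (simp add: distrib_right)
qed

lemma trig_poly_continuous: "trig_poly f \<Longrightarrow> continuous_on S f"
  by (induction rule: trig_poly.induct) (auto intro!: continuous_intros)

lemma trig_poly_bounded:
  assumes "trig_poly f"
  shows "\<exists>B. \<forall>x. \<bar>f x\<bar> \<le> B"
  using assms
proof induction
  case (trig_poly_cos t s)
  show ?case by (intro exI[of _ 1]) simp
next
  case (trig_poly_scale f c)
  then obtain B where "\<bar>f x\<bar> \<le> B" for x by blast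
  then show ?case by (intro exI[of _ "\<bar>c\<bar> * B"]) (simp add: abs_mult mult_left_mono)
next
  case (trig_poly_add f g)
  then obtain B C where "\<bar>f x\<bar> \<le> B" "\<bar>g x\<bar> \<le> C" for x by blast
  then show ?case by (intro exI[of _ "B + C"]) (auto intro: order_trans[OF abs_triangle_ineq] add_mono)
qed

text \<open>The frequency along \<open>x - y\<close> is scaled so that the two arguments differ by
  exactly \<open>1\<close>; a phase shift then turns the two values into \<open>cos 1\<close> and
  \<open>cos 0\<close>.\<close>

lemma trig_poly_separates:
  fixes x y :: "'b::real_inner"
  assumes "x \<noteq> y"
  shows "\<exists>f. trig_poly f \<and> f x \<noteq> f y"
proof -
  define t where "t = (1 / ((x - y) \<bullet> (x - y))) *\<^sub>R (x - y)"
  have "t \<bullet> x - t \<bullet> y = t \<bullet> (x - y)" by (simp add: inner_diff_right)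
  also have "\<dots> = 1" using assms by (simp add: t_def)
  finally have *: "t \<bullet> x - t \<bullet> y = 1" .
  have "cos (0::real) > cos 1" by (rule cos_monotone_0_pi) (use pi_gt3 in auto)
  then show ?thesis using *
    by (intro exI[of _ "\<lambda>z. cos (t \<bullet> z + - (t \<bullet> y))"] conjI trig_poly_cos) simp
qed

lemma trig_poly_real_polynomial:
  fixes p :: "real \<Rightarrow> real"
  assumes "real_polynomial_function p" "trig_poly q"
  shows "trig_poly (\<lambda>x. p (q x))"
  using assms(1)
proof induction
  case (linear f)
  have "f (q x) = f 1 * q x" for x
    using linear_cmul[OF bounded_linear.linear[OF linear], of "q x" 1] by simp
  then show ?case using trig_poly_scale[OF assms(2), of "f 1"] by simp
qed (auto intro: trig_poly_const trig_poly_add trig_poly_mult)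

text \<open>Truncating an approximation on the ball by a polynomial keeps it a trigonometric polynomial
  and makes it bounded everywhere.\<close>

lemma trig_poly_approx:
  fixes f :: "'b::euclidean_space \<Rightarrow> real"
  assumes f: "continuous_on UNIV f" "\<And>x. \<bar>f x\<bar> \<le> C" and e: "e > 0"
  shows "\<exists>q. trig_poly q \<and> (\<forall>x\<in>cball 0 R. \<bar>f x - q x\<bar> \<le> e) \<and> (\<forall>x. \<bar>q x\<bar> \<le> C + e)"
proof -
  have "\<exists>g. trig_poly g \<and> (\<forall>x\<in>cball 0 R. \<bar>f x - g x\<bar> < e/2)"
    by (rule Stone_Weierstrass_HOL)
      (use f e trig_poly_separates in \<open>auto intro: trig_poly_const trig_poly_continuous trig_poly_add trig_poly_mult
        continuous_on_subset\<close>)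
  then obtain g where g: "trig_poly g" "\<And>x. x \<in> cball 0 R \<Longrightarrow> \<bar>f x - g x\<bar> < e/2" by blast
  obtain B where B: "\<And>x. \<bar>g x\<bar> \<le> B" using trig_poly_bounded[OF g(1)] by blast
  \<comment> \<open>Clamping to the range of \<open>f\<close> does not increase the distance to
    \<open>f\<close>, so \<open>clamp (g x)\<close> is still within \<open>e/2\<close> of
    \<open>f x\<close> on the ball. Replacing \<open>clamp\<close> by a polynomial \<open>p\<close>
    on the range \<open>{-B..B}\<close> of \<open>g\<close> costs another
    \<open>e/2\<close>.\<close>
  define clamp where "clamp y = max (-C) (min C y)" for y :: real
  have C0: "C \<ge> 0" using f(2)[of 0] by linarith
  obtain p where p: "real_polynomial_function p" "\<And>y. y \<in> {-B..B} \<Longrightarrow> \<bar>clamp y - p y\<bar> < e/2"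
    by (rule Stone_Weierstrass_real_polynomial_function[of "{-B..B}" clamp "e/2"])
      (use e in \<open>auto simp: clamp_def intro!: continuous_intros\<close>)
  have gB: "\<bar>clamp (g x) - p (g x)\<bar> < e/2" for x
    using B[of x] by (intro p(2)) auto
  show ?thesis
  proof (intro exI[of _ "\<lambda>x. p (g x)"] conjI ballI allI)
    show "trig_poly (\<lambda>x. p (g x))" using p(1) g(1) by (rule trig_poly_real_polynomial)
    show "\<bar>p (g x)\<bar> \<le> C + e" for x
      using gB[of x] e C0 unfolding clamp_def by linarith
    show "\<bar>f x - p (g x)\<bar> \<le> e" if "x \<in> cball 0 R" for x
      using gB[of x] g(2)[OF that] f(2)[of x] C0 unfolding clamp_def by linarith
  qed
qed

text \<open>Since \<open>cos (t \<bullet> x + s)\<close> is the real part of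
  \<open>cis s * cis (t \<bullet> x)\<close>, integrals of trigonometric polynomials are linear
  combinations of real parts of rotated values of the characteristic function.\<close>

lemma trig_poly_integral_tendsto:
  fixes \<mu> :: "nat \<Rightarrow> 'b::euclidean_space measure"
  assumes \<mu>: "\<And>n. prob_space (\<mu> n)" "\<And>n. sets (\<mu> n) = sets borel"
    and \<nu>: "prob_space \<nu>" "sets \<nu> = sets borel"
    and cf: "\<And>t. (\<lambda>n. LINT x|\<mu> n. cis (t \<bullet> x)) \<longlonglongrightarrow> (LINT x|\<nu>. cis (t \<bullet> x))"
    and q: "trig_poly q"
  shows "(\<lambda>n. LINT x|\<mu> n. q x) \<longlonglongrightarrow> (LINT x|\<nu>. q x)"
proof -
  have int: "integrable P f" if P: "prob_space P" "sets P = sets borel" and f: "trig_poly f"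
    for P and f :: "'b \<Rightarrow> real"
  proof -
    interpret prob_space P by fact
    have [measurable_cong]: "sets P = sets borel" by fact
    obtain B where "\<And>x. \<bar>f x\<bar> \<le> B" using trig_poly_bounded[OF f] by blast
    moreover have [measurable]: "f \<in> borel_measurable borel"
      by (intro borel_measurable_continuous_onI trig_poly_continuous f)
    ultimately show ?thesis by (intro integrable_const_bound[of _ B]) auto
  qed
  have intc: "integrable P (\<lambda>x. cis (t \<bullet> x))" if "prob_space P" "sets P = sets borel"
    for P :: "'b measure" and t
  proof -
    interpret prob_space P by fact
    have [measurable_cong]: "sets P = sets borel" by fact
    have [measurable]: "(\<lambda>x. cis (t \<bullet> x)) \<in> borel_measurable borel"
      by (intro borel_measurable_continuous_onI continuous_intros)
    show ?thesis
      by (intro integrable_const_bound[of _ 1]) auto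
  qed
  have coseq: "(LINT x|P. cos (t \<bullet> x + s)) = Re (cis s * (LINT x|P. cis (t \<bullet> x)))"
    if P: "prob_space P" "sets P = sets borel" for P :: "'b measure" and t s
  proof -
    have "cos (t \<bullet> x + s) = Re (cis s * cis (t \<bullet> x))" for x
      by (simp add: cis_mult add.commute)
    then have "(LINT x|P. cos (t \<bullet> x + s)) = (LINT x|P. Re (cis s * cis (t \<bullet> x)))" by simp
    also have "\<dots> = Re (LINT x|P. cis s * cis (t \<bullet> x))"
      by (rule integral_Re) (intro integrable_mult_right intc P)
    also have "\<dots> = Re (cis s * (LINT x|P. cis (t \<bullet> x)))" by simp
    finally show ?thesis .
  qed
  show ?thesis using q
  proof induction
    case (trig_poly_cos t s)
    show ?case
      unfolding coseq[OF \<mu>(1,2)] coseq[OF \<nu>] by (intro tendsto_intros cf)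
  next
    case (trig_poly_scale f c)
    then show ?case by (simp add: tendsto_mult_left)
  next
    case (trig_poly_add f g)
    then show ?case
      by (simp add: Bochner_Integration.integral_add int[OF \<mu>(1,2)] int[OF \<nu>] tendsto_add)
  qed
qed

text \<open>The substantial half of Levy's continuity theorem. Tightness is a hypothesis because in
  the application it comes directly from a second-moment bound; it controls the region outside the
  ball on which \<open>f\<close> is approximated, where \<open>f\<close> and its approximation are
  merely bounded.\<close>

theorem weakly_convergesI_cis:
  fixes \<mu> :: "nat \<Rightarrow> 'b::euclidean_space measure"
  assumes \<mu>: "\<And>n. prob_space (\<mu> n)" "\<And>n. sets (\<mu> n) = sets borel"
    and \<nu>: "prob_space \<nu>" "sets \<nu> = sets borel"
    and cf: "\<And>t. (\<lambda>n. LINT x|\<mu> n. cis (t \<bullet> x)) \<longlonglongrightarrow> (LINT x|\<nu>. cis (t \<bullet> x))"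
    and tight: "\<And>\<epsilon>. \<epsilon> > 0 \<Longrightarrow> \<exists>R. \<forall>\<^sub>F n in sequentially. measure (\<mu> n) (- cball 0 R) \<le> \<epsilon>"
  shows "weakly_converges \<mu> \<nu>"
  unfolding weakly_converges_def
proof (intro allI impI)
  fix f :: "'b \<Rightarrow> real"
  assume f: "continuous_on UNIV f" "bounded (range f)"
  obtain C where C: "\<And>x. \<bar>f x\<bar> \<le> C" "C > 0"
    using f(2) unfolding bounded_pos by auto
  have fm[measurable]: "f \<in> borel_measurable borel"
    using f(1) by (rule borel_measurable_continuous_onI)
  have main: "\<bar>(LINT x|P. f x) - (LINT x|P. q x)\<bar> \<le> e + (2 * C + e) * measure P (- cball 0 R)"
    if P: "prob_space P" "sets P = sets borel" and e: "e > 0" and q: "trig_poly q"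
      and qf: "\<And>x. x \<in> cball 0 R \<Longrightarrow> \<bar>f x - q x\<bar> \<le> e" and qC: "\<And>x. \<bar>q x\<bar> \<le> C + e"
    for P q e R
  proof -
    interpret prob_space P by fact
    have [measurable_cong]: "sets P = sets borel" by fact
    have [measurable]: "q \<in> borel_measurable borel"
      by (intro borel_measurable_continuous_onI trig_poly_continuous q)
    have i: "integrable P f" "integrable P q"
      by (intro integrable_const_bound[of _ C] integrable_const_bound[of _ "C + e"]; use C qC in auto)+
    have ii: "integrable P (\<lambda>x. (2 * C + e) * indicator (- cball 0 R) x)"
      by (intro integrable_mult_right integrable_real_indicator) (auto simp: less_top[symmetric])
    have "\<bar>(LINT x|P. f x) - (LINT x|P. q x)\<bar> = \<bar>LINT x|P. f x - q x\<bar>"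
      using i by simp
    also have "\<dots> \<le> (LINT x|P. \<bar>f x - q x\<bar>)" by (rule integral_abs_bound)
    also have "\<dots> \<le> (LINT x|P. e + (2 * C + e) * indicator (- cball 0 R) x)"
    proof (rule integral_mono)
      show "\<bar>f x - q x\<bar> \<le> e + (2 * C + e) * indicator (- cball 0 R) x" for x
      proof (cases "x \<in> cball 0 R")
        case False
        then have 1: "indicator (- cball 0 R) x = (1::real)" by simp
        have "\<bar>f x - q x\<bar> \<le> \<bar>f x\<bar> + \<bar>q x\<bar>" by (rule abs_triangle_ineq4)
        also have "\<dots> \<le> C + (C + e)" using C(1) qC by (intro add_mono)
        also have "\<dots> \<le> e + (2 * C + e) * 1" using e by simp
        finally show ?thesis unfolding 1 .
      qed (use qf in auto)
      show "integrable P (\<lambda>x. \<bar>f x - q x\<bar>)" using i by auto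
      show "integrable P (\<lambda>x. e + (2 * C + e) * indicator (- cball 0 R) x)"
        by (intro Bochner_Integration.integrable_add integrable_const ii)
    qed
    also have "\<dots> = e + (2 * C + e) * measure P (- cball 0 R)"
      by (subst Bochner_Integration.integral_add[OF _ ii])
        (use prob_space in \<open>simp_all add: sets_eq_imp_space_eq[OF P(2)]\<close>)
    finally show ?thesis .
  qed
  show "(\<lambda>n. LINT x|\<mu> n. f x) \<longlonglongrightarrow> (LINT x|\<nu>. f x)"
  proof (rule tendstoI)
    fix \<epsilon> :: real assume \<epsilon>: "\<epsilon> > 0"
    \<comment> \<open>Error budget: \<open>2 * e\<close> for replacing \<open>f\<close> by
      \<open>q\<close> under \<nu>, the same under \<open>\<mu> n\<close>, and \<open>e\<close> for
      the convergence of the integrals of \<open>q\<close>, in total less than \<open>6 * e\<close>.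
      The bound \<open>e \<le> 1\<close> lets \<delta> be fixed with \<open>2 * C + 1\<close> in
      place of \<open>2 * C + e\<close>.\<close>
    define e where "e = min 1 (\<epsilon> / 6)"
    have e: "e > 0" "e \<le> 1" "6 * e \<le> \<epsilon>" using \<epsilon> by (auto simp: e_def)
    define \<delta> where "\<delta> = e / (2 * C + 1)"
    have \<delta>: "\<delta> > 0" using e C by (simp add: \<delta>_def)
    obtain R1 where R1: "\<forall>\<^sub>F n in sequentially. measure (\<mu> n) (- cball 0 R1) \<le> \<delta>"
      using tight[OF \<delta>] by blast
    have "\<exists>R2. measure \<nu> (- cball 0 R2) \<le> \<delta>"
    proof -
      interpret \<nu>: prob_space \<nu> by fact
      have "(\<lambda>k. measure \<nu> (- cball 0 (real k))) \<longlonglongrightarrow> measure \<nu> (\<Inter>k. - cball 0 (real k))"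
        by (rule \<nu>.finite_Lim_measure_decseq) (auto simp: \<nu>(2) decseq_def)
      moreover have "(\<Inter>k. - cball (0::'b) (real k)) = {}"
      proof -
        have "\<exists>k. x \<in> cball 0 (real k)" for x :: 'b
          using real_arch_simple[of "norm x"] by simp
        then show ?thesis by blast
      qed
      ultimately have "(\<lambda>k. measure \<nu> (- cball 0 (real k))) \<longlonglongrightarrow> 0" by simp
      then have "\<forall>\<^sub>F k in sequentially. measure \<nu> (- cball 0 (real k)) < \<delta>"
        using \<delta> by (rule order_tendstoD)
      then show ?thesis by (auto simp: eventually_sequentially intro: less_imp_le)
    qed
    then obtain R2 where R2: "measure \<nu> (- cball 0 R2) \<le> \<delta>" by blast
    define R where "R = max R1 R2"
    have mono: "measure P (- cball 0 R) \<le> measure P (- cball 0 r)"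
      if "prob_space P" "sets P = sets borel" "r \<le> R" for P :: "'b measure" and r
    proof -
      interpret prob_space P by fact
      show ?thesis using that by (intro finite_measure_mono) auto
    qed
    obtain q where q: "trig_poly q" "\<And>x. x \<in> cball 0 R \<Longrightarrow> \<bar>f x - q x\<bar> \<le> e" "\<And>x. \<bar>q x\<bar> \<le> C + e"
      using trig_poly_approx[OF f(1) C(1) e(1), of R] by blast
    have small: "e + (2 * C + e) * m \<le> 2 * e" if "m \<le> \<delta>" "m \<ge> 0" for m
    proof -
      have "(2 * C + e) * m \<le> (2 * C + 1) * \<delta>" using that e C by (intro mult_mono) auto
      also have "\<dots> = e" using C by (simp add: \<delta>_def)
      finally show ?thesis by simp
    qed
    have \<nu>q: "\<bar>(LINT x|\<nu>. f x) - (LINT x|\<nu>. q x)\<bar> \<le> 2 * e"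
      by (rule order_trans[OF main[OF \<nu> e(1) q(1), of R] small]; (rule q order_trans[OF mono[OF \<nu>] R2])?)
        (auto simp: R_def)
    have "\<forall>\<^sub>F n in sequentially. dist (LINT x|\<mu> n. q x) (LINT x|\<nu>. q x) < e"
      using trig_poly_integral_tendsto[OF \<mu> \<nu> cf q(1)] e(1) by (rule tendstoD)
    then show "\<forall>\<^sub>F n in sequentially. dist (LINT x|\<mu> n. f x) (LINT x|\<nu>. f x) < \<epsilon>"
      using R1
    proof eventually_elim
      case (elim n)
      have "\<bar>(LINT x|\<mu> n. f x) - (LINT x|\<mu> n. q x)\<bar> \<le> 2 * e"
        by (rule order_trans[OF main[OF \<mu>(1,2) e(1) q(1), of R] small];
            (rule q order_trans[OF mono[OF \<mu>(1,2)] elim(2)])?) (auto simp: R_def)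
      then show ?case using \<nu>q elim(1) e unfolding dist_real_def by linarith
    qed
  qed
qed

section \<open>The multivariate normal distribution\<close>

text \<open>By Fubini with the \<open>b\<close>-coordinate innermost: when the other coordinates are
  fixed, the shear translates the \<open>b\<close>-coordinate by the constant
  \<open>x \<bullet> c\<close>, because \<open>c\<close> differs from \<open>b\<close>.\<close>

lemma nn_integral_lborel_shear:
  fixes f :: "'b::euclidean_space \<Rightarrow> ennreal"
  assumes [measurable]: "f \<in> borel_measurable borel" and b: "b \<in> Basis" "c \<in> Basis" "b \<noteq> c"
  shows "(\<integral>\<^sup>+x. f (x + (x \<bullet> c) *\<^sub>R b) \<partial>lborel) = (\<integral>\<^sup>+x. f x \<partial>lborel)"
proof -
  interpret L: product_sigma_finite "\<lambda>_::'b. lborel :: real measure"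
    by standard
  let ?I = "Basis - {b}"
  have ins: "Basis = insert b ?I" using b by auto
  have split: "(\<integral>\<^sup>+x. g x \<partial>lborel) =
      (\<integral>\<^sup>+x. (\<integral>\<^sup>+y. g (\<Sum>i\<in>Basis. (x(b := y)) i *\<^sub>R i) \<partial>lborel) \<partial>(Pi\<^sub>M ?I (\<lambda>_. lborel)))"
    if [measurable]: "g \<in> borel_measurable borel" for g :: "'b \<Rightarrow> ennreal"
  proof -
    have "(\<integral>\<^sup>+x. g x \<partial>lborel) = (\<integral>\<^sup>+x. g (\<Sum>i\<in>Basis. x i *\<^sub>R i) \<partial>(Pi\<^sub>M Basis (\<lambda>_. lborel)))"
      by (subst lborel_eq) (simp add: nn_integral_distr)
    also have "\<dots> = (\<integral>\<^sup>+x. g (\<Sum>i\<in>Basis. x i *\<^sub>R i) \<partial>(Pi\<^sub>M (insert b ?I) (\<lambda>_. lborel)))"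
      using ins by simp
    also have "\<dots> = (\<integral>\<^sup>+x. (\<integral>\<^sup>+y. g (\<Sum>i\<in>Basis. (x(b := y)) i *\<^sub>R i) \<partial>lborel) \<partial>(Pi\<^sub>M ?I (\<lambda>_. lborel)))"
      by (rule L.product_nn_integral_insert) (use ins[symmetric] in auto)
    finally show ?thesis .
  qed
  have sh: "(\<Sum>i\<in>Basis. (x(b := y)) i *\<^sub>R i) + ((\<Sum>i\<in>Basis. (x(b := y)) i *\<^sub>R i) \<bullet> c) *\<^sub>R b
      = (\<Sum>i\<in>Basis. (x(b := x c + y)) i *\<^sub>R i)" for x :: "'b \<Rightarrow> real" and y
  proof -
    have "(\<Sum>i\<in>Basis. (x(b := z)) i *\<^sub>R i) = z *\<^sub>R b + (\<Sum>i\<in>?I. x i *\<^sub>R i)" for z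
      using b by (simp add: sum.remove[of Basis b])
    moreover have "(\<Sum>i\<in>Basis. (x(b := y)) i *\<^sub>R i) \<bullet> c = x c"
      using b by (subst inner_sum_left_Basis) auto
    ultimately show ?thesis by (simp add: algebra_simps)
  qed
  have "(\<integral>\<^sup>+x. f (x + (x \<bullet> c) *\<^sub>R b) \<partial>lborel) =
      (\<integral>\<^sup>+x. (\<integral>\<^sup>+y. f (\<Sum>i\<in>Basis. (x(b := x c + y)) i *\<^sub>R i) \<partial>lborel) \<partial>(Pi\<^sub>M ?I (\<lambda>_. lborel)))"
    unfolding sh[symmetric] by (rule split) measurable
  also have "\<dots> = (\<integral>\<^sup>+x. (\<integral>\<^sup>+y. f (\<Sum>i\<in>Basis. (x(b := y)) i *\<^sub>R i) \<partial>lborel) \<partial>(Pi\<^sub>M ?I (\<lambda>_. lborel)))"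
  proof (rule nn_integral_cong)
    fix x :: "'b \<Rightarrow> real"
    have *: "(\<Sum>i\<in>Basis. (x(b := z)) i *\<^sub>R i) = z *\<^sub>R b + (\<Sum>i\<in>?I. x i *\<^sub>R i)" for z
      using b by (simp add: sum.remove[of Basis b])
    show "(\<integral>\<^sup>+y. f (\<Sum>i\<in>Basis. (x(b := x c + y)) i *\<^sub>R i) \<partial>lborel) =
        (\<integral>\<^sup>+y. f (\<Sum>i\<in>Basis. (x(b := y)) i *\<^sub>R i) \<partial>lborel)"
      unfolding * using nn_integral_real_affine[of "\<lambda>z. f (z *\<^sub>R b + (\<Sum>i\<in>?I. x i *\<^sub>R i))" 1 "x c"]
      by simp
  qed
  also have "\<dots> = (\<integral>\<^sup>+x. f x \<partial>lborel)" by (subst split) simp_all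
  finally show ?thesis .
qed

text \<open>The preimage of a box is the box with permuted sides, and the product of the side
  lengths does not depend on their order.\<close>

lemma lborel_distr_swap:
  fixes m n :: "'n::finite"
  shows "distr lborel borel (\<lambda>x::real^'n. \<chi> i. x $ Transposition.transpose m n i) = lborel" (is "distr _ _ ?h = _")
proof (rule lborel_eqI[symmetric])
  let ?\<tau> = "Transposition.transpose m n"
  have hm[measurable]: "?h \<in> borel_measurable borel"
    by (intro borel_measurable_continuous_onI continuous_intros)
  have inv: "?\<tau> (?\<tau> i) = i" for i by simp
  fix l u :: "real^'n"
  assume le: "\<And>b. b \<in> Basis \<Longrightarrow> l \<bullet> b \<le> u \<bullet> b"
  have pre: "?h -` box l u = box (?h l) (?h u)"
    by (auto simp: mem_box_cart) (metis inv)+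
  have axis: "?h x \<bullet> axis i 1 = x $ ?\<tau> i" for x i by (simp add: inner_axis)
  have "emeasure (distr lborel borel ?h) (box l u) = emeasure lborel (box (?h l) (?h u))"
    by (subst emeasure_distr) (simp_all add: pre)
  also have "\<dots> = (\<Prod>b\<in>Basis. (?h u - ?h l) \<bullet> b)"
  proof (rule emeasure_lborel_box)
    fix b :: "real^'n" assume "b \<in> Basis"
    then obtain i where b: "b = axis i 1" by (auto simp: Basis_vec_def)
    show "?h l \<bullet> b \<le> ?h u \<bullet> b"
      using le[of "axis (?\<tau> i) 1"] by (simp add: b inner_axis axis_in_Basis_iff)
  qed
  also have "(\<Prod>b\<in>Basis. (?h u - ?h l) \<bullet> b) = (\<Prod>i\<in>UNIV. u $ ?\<tau> i - l $ ?\<tau> i)"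
    unfolding Basis_vec_def
    by (subst prod.reindex_cong[of "\<lambda>i. axis i 1" UNIV]) (auto simp: inj_on_def axis_eq_axis inner_diff_left inner_axis)
  also have "\<dots> = (\<Prod>i\<in>UNIV. u $ i - l $ i)"
    by (rule prod.reindex_bij_betw[of ?\<tau>]) simp
  also have "\<dots> = (\<Prod>b\<in>Basis. (u - l) \<bullet> b)"
    unfolding Basis_vec_def
    by (subst prod.reindex_cong[of "\<lambda>i. axis i 1" UNIV]) (auto simp: inj_on_def axis_eq_axis inner_diff_left inner_axis)
  finally show "emeasure (distr lborel borel ?h) (box l u) = (\<Prod>b\<in>Basis. (u - l) \<bullet> b)" .
qed simp

text \<open>The library's linear change of variables needs a well-ordered index type, which \<open>'p option\<close>
  is not.\<close>

lemma nn_integral_lborel_matrix_vector_mult: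
  fixes A :: "real^'n^'n"
  assumes "f \<in> borel_measurable borel" and "det A \<noteq> 0"
  shows "(\<integral>\<^sup>+x. f x \<partial>lborel) = ennreal \<bar>det A\<bar> * (\<integral>\<^sup>+x. f (A *v x) \<partial>lborel)"
proof -
  have mm[measurable]: "(*v) B \<in> borel_measurable borel" for B :: "real^'n^'n"
    by (intro borel_measurable_continuous_onI linear_continuous_on matrix_vector_mul_bounded_linear)
  \<comment> \<open>The function is quantified inside the induction because the product case applies
    the second hypothesis to \<open>\<lambda>x. f (A *v x)\<close>. The determinant condition is
    inside as well: among the elementary factors are singular ones, for which the claim becomes
    vacuous.\<close>
  have "\<forall>f\<in>borel_measurable borel. det A \<noteq> 0 \<longrightarrow>
    (\<integral>\<^sup>+x. f x \<partial>lborel) = ennreal \<bar>det A\<bar> * (\<integral>\<^sup>+x. f (A *v x) \<partial>lborel)" (is "?P A")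
  proof (rule induct_matrix_elementary_alt, goal_cases mult zero_row diagonal swap1 idplus)
    case (mult A B)
    show ?case
    proof (intro ballI impI)
      fix f :: "real^'n \<Rightarrow> ennreal"
      assume f[measurable]: "f \<in> borel_measurable borel" and d: "det (A ** B) \<noteq> 0"
      have "(\<integral>\<^sup>+x. f x \<partial>lborel) = ennreal \<bar>det A\<bar> * (\<integral>\<^sup>+x. f (A *v x) \<partial>lborel)"
        using mult(1)[rule_format, OF f] d by (simp add: det_mul)
      also have "(\<integral>\<^sup>+x. f (A *v x) \<partial>lborel) = ennreal \<bar>det B\<bar> * (\<integral>\<^sup>+x. f (A *v (B *v x)) \<partial>lborel)"
        using mult(2)[rule_format, of "\<lambda>x. f (A *v x)"] d by (simp add: det_mul)
      finally show "(\<integral>\<^sup>+x. f x \<partial>lborel) = ennreal \<bar>det (A ** B)\<bar> * (\<integral>\<^sup>+x. f (A ** B *v x) \<partial>lborel)"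
        by (simp add: det_mul abs_mult ennreal_mult matrix_vector_mul_assoc mult.assoc)
    qed
  next
    case (zero_row A i)
    then show ?case by (simp add: det_zero_row)
  next
    case (diagonal A)
    show ?case
    proof (intro ballI impI)
      fix f :: "real^'n \<Rightarrow> ennreal"
      assume f[measurable]: "f \<in> borel_measurable borel" and d: "det A \<noteq> 0"
      have detA: "det A = (\<Prod>i\<in>UNIV. A $ i $ i)" using diagonal by (intro det_diagonal) auto
      then have nz: "A $ i $ i \<noteq> 0" for i using d by simp
      \<comment> \<open>\<open>c\<close> is the diagonal of \<open>A\<close>, indexed by basis
        vectors instead of coordinates, as the coordinatewise affine substitution expects
        it.\<close>
      define c where "c j = (A *v j) \<bullet> j" for j :: "real^'n"
      have cax: "c (axis i 1) = A $ i $ i" for i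
        by (simp add: c_def inner_axis matrix_vector_mul_component)
      have Av: "A *v x = 0 + (\<Sum>j\<in>Basis. (c j * (x \<bullet> j)) *\<^sub>R j)" for x
      proof -
        have "(A *v x) $ i = A $ i $ i * x $ i" for i
        proof -
          have "(A *v x) $ i = (\<Sum>j\<in>UNIV. if j = i then A $ i $ i * x $ i else 0)"
            unfolding matrix_vector_mult_def vec_lambda_beta
            by (intro sum.cong) (use diagonal in auto)
          then show ?thesis by simp
        qed
        moreover have "(\<Sum>j\<in>Basis. (c j * (x \<bullet> j)) *\<^sub>R j) $ i = A $ i $ i * x $ i" for i
        proof -
          have "(\<Sum>j\<in>Basis. (c j * (x \<bullet> j)) *\<^sub>R j) $ i = (\<Sum>j\<in>Basis. (c j * (x \<bullet> j)) *\<^sub>R j) \<bullet> axis i 1"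
            by (simp add: inner_axis)
          also have "\<dots> = c (axis i 1) * (x \<bullet> axis i 1)"
            by (rule inner_sum_left_Basis) (simp add: axis_in_Basis_iff)
          finally show ?thesis by (simp add: cax inner_axis)
        qed
        ultimately show ?thesis by (simp add: vec_eq_iff)
      qed
      have cp: "(\<Prod>j\<in>Basis. \<bar>c j\<bar>) = \<bar>det A\<bar>"
        unfolding detA abs_prod Basis_vec_def
        by (subst prod.reindex_cong[of "\<lambda>i. axis i 1" UNIV]) (auto simp: inj_on_def axis_eq_axis cax)
      have "(\<integral>\<^sup>+x. f x \<partial>lborel) =
          (\<integral>\<^sup>+x. f x \<partial>density (distr lborel borel (\<lambda>x. 0 + (\<Sum>j\<in>Basis. (c j * (x \<bullet> j)) *\<^sub>R j)))
            (\<lambda>_. ennreal (\<Prod>j\<in>Basis. \<bar>c j\<bar>)))"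
        by (subst lborel_affine_euclidean[of c 0]) (use cax nz in \<open>auto simp: Basis_vec_def\<close>)
      also have "\<dots> = (\<integral>\<^sup>+x. f x \<partial>density (distr lborel borel ((*v) A)) (\<lambda>_. ennreal \<bar>det A\<bar>))"
        unfolding Av[symmetric] cp ..
      also have "\<dots> = ennreal \<bar>det A\<bar> * (\<integral>\<^sup>+x. f (A *v x) \<partial>lborel)"
        by (subst nn_integral_density) (auto simp: nn_integral_distr nn_integral_cmult)
      finally show "(\<integral>\<^sup>+x. f x \<partial>lborel) = ennreal \<bar>det A\<bar> * (\<integral>\<^sup>+x. f (A *v x) \<partial>lborel)" .
    qed
  next
    case (swap1 m n)
    let ?A = "(\<chi> i j. mat 1 $ i $ Transposition.transpose m n j) :: real^'n^'n"
    have Av: "?A *v x = (\<chi> i. x $ Transposition.transpose m n i)" for x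
    proof -
      have "(?A *v x) $ i = x $ Transposition.transpose m n i" for i
      proof -
        have "(?A *v x) $ i = (\<Sum>j\<in>UNIV. if j = Transposition.transpose m n i then x $ j else 0)"
          unfolding matrix_vector_mult_def vec_lambda_beta
          by (intro sum.cong refl) (auto simp: mat_def transpose_eq_iff)
        then show ?thesis by simp
      qed
      then show ?thesis by (simp add: vec_eq_iff)
    qed
    have dA: "\<bar>det ?A\<bar> = 1"
    proof -
      have "det ?A = of_int (sign (Transposition.transpose m n)) * det (mat 1 :: real^'n^'n)"
        by (rule det_permute_columns) (simp add: permutes_swap_id)
      then show ?thesis by (simp add: sign_swap_id swap1)
    qed
    show ?case
    proof (intro ballI impI)
      fix f :: "real^'n \<Rightarrow> ennreal"
      assume f[measurable]: "f \<in> borel_measurable borel"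
      have "(\<lambda>x::real^'n. \<chi> i. x $ Transposition.transpose m n i) \<in> borel_measurable borel"
        by (intro borel_measurable_continuous_onI continuous_intros)
      then have "(\<integral>\<^sup>+x. f (?A *v x) \<partial>lborel) = (\<integral>\<^sup>+x. f x \<partial>lborel)"
        unfolding Av by (subst (2) lborel_distr_swap[of m n, symmetric]) (simp add: nn_integral_distr)
      then show "(\<integral>\<^sup>+x. f x \<partial>lborel) = ennreal \<bar>det ?A\<bar> * (\<integral>\<^sup>+x. f (?A *v x) \<partial>lborel)"
        by (simp add: dA)
    qed
  next
    case (idplus m n)
    \<comment> \<open>The identity with an extra unit entry in row \<open>m\<close> and column
      \<open>n\<close>: a shear along the axis \<open>m\<close>, which preserves volume.\<close>
    let ?A = "(\<chi> i j. of_bool (i = m \<and> j = n \<or> i = j)) :: real^'n^'n"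
    have Av: "?A *v x = x + (x \<bullet> axis n 1) *\<^sub>R axis m 1" for x
    proof -
      have "(?A *v x) $ i = (x + (x \<bullet> axis n 1) *\<^sub>R axis m 1) $ i" for i
      proof -
        have "(?A *v x) $ i = (\<Sum>j\<in>UNIV. (if j = i then x $ i else 0) + (if j = n then of_bool (i = m) * x $ n else 0))"
          unfolding matrix_vector_mult_def vec_lambda_beta
          by (intro sum.cong refl) (use idplus in auto)
        then show ?thesis by (simp add: sum.distrib inner_axis) (simp add: axis_def)
      qed
      then show ?thesis by (simp add: vec_eq_iff)
    qed
    have dA: "det ?A = 1"
    proof -
      have "?A = (\<chi> k. if k = m then row m (mat 1) + 1 *s row n (mat 1) else row k (mat 1))"
        using idplus by (auto simp: vec_eq_iff row_def mat_def)
      then show ?thesis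
        using det_row_operation[OF idplus, of "mat 1" 1] by simp
    qed
    show ?case
      unfolding dA Av using idplus
      by (auto simp: nn_integral_lborel_shear axis_in_Basis_iff axis_eq_axis)
  qed
  then show ?thesis using assms by blast
qed

section \<open>Positive definite matrices and their inverses\<close>

lemma matrix_inv_unique:
  fixes A B :: "real^'n^'n"
  assumes "A ** B = mat 1" "B ** A = mat 1"
  shows "matrix_inv A = B"
proof -
  have "A ** matrix_inv A = mat 1 \<and> matrix_inv A ** A = mat 1"
    unfolding matrix_inv_def by (rule someI[of _ B]) (use assms in simp)
  then have "matrix_inv A ** (A ** B) = B"
    by (simp add: matrix_mul_assoc)
  then show ?thesis using assms by simp
qed

lemma inner_matrix_vector_mult:
  fixes B :: "real^'n^'n"
  shows "x \<bullet> (B *v y) = (transpose B *v x) \<bullet> y"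
  by (simp add: dot_lmul_matrix)

text \<open>Gram-Schmidt for the inner product \<open>x \<bullet> (A *v y)\<close>. As long as
  \<open>k\<close> is below the dimension, some vector lies outside the span; it is made orthogonal
  to the family and normalized.\<close>

lemma positive_definite_orthonormal_family:
  fixes A :: "real^'n^'n"
  assumes sym: "transpose A = A" and pos: "\<And>x. x \<noteq> 0 \<Longrightarrow> x \<bullet> (A *v x) > 0"
    and "k \<le> CARD('n)"
  shows "\<exists>S. finite S \<and> card S = k \<and> (\<forall>x\<in>S. \<forall>y\<in>S. x \<bullet> (A *v y) = of_bool (x = y))"
  using assms(3)
proof (induction k)
  case 0
  then show ?case by (intro exI[of _ "{}"]) auto
next
  case (Suc k)
  then obtain S where S: "finite S" "card S = k"
    "\<And>x y. x \<in> S \<Longrightarrow> y \<in> S \<Longrightarrow> x \<bullet> (A *v y) = of_bool (x = y)" by auto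
  have comm: "x \<bullet> (A *v y) = y \<bullet> (A *v x)" for x y
    by (simp add: inner_matrix_vector_mult[of x] sym inner_commute del: transpose_matrix_vector)
  have "dim (span S) < DIM(real^'n)"
    using dim_le_card'[OF S(1)] S(2) Suc.prems by simp
  then obtain x where x: "x \<notin> span S" using dim_eq_full[of S] by (metis UNIV_I dim_UNIV dim_span less_irrefl subsetI subset_antisym top_greatest)
  define y where "y = x - (\<Sum>s\<in>S. (s \<bullet> (A *v x)) *\<^sub>R s)"
  have sp: "(\<Sum>s\<in>S. (s \<bullet> (A *v x)) *\<^sub>R s) \<in> span S"
    by (intro span_sum span_scale span_base)
  have y: "y \<notin> span S"
  proof
    assume "y \<in> span S"
    from span_add[OF this sp] show False using x by (simp add: y_def)
  qed
  then have y0: "y \<noteq> 0" using span_zero by blast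
  have orth: "t \<bullet> (A *v y) = 0" if "t \<in> S" for t
  proof -
    have "t \<bullet> (A *v y) = t \<bullet> (A *v x) - (\<Sum>s\<in>S. (s \<bullet> (A *v x)) * (t \<bullet> (A *v s)))"
      by (simp add: y_def matrix_vector_mult_diff_distrib linear_sum[OF matrix_vector_mul_linear]
          matrix_vector_mult_scaleR inner_diff_right inner_sum_right)
    also have "(\<Sum>s\<in>S. (s \<bullet> (A *v x)) * (t \<bullet> (A *v s))) = (\<Sum>s\<in>S. if s = t then t \<bullet> (A *v x) else 0)"
      by (intro sum.cong refl) (use S(3) that in auto)
    finally show ?thesis using that S(1) by simp
  qed
  define q where "q = y \<bullet> (A *v y)"
  have q: "q > 0" using pos[OF y0] by (simp add: q_def)
  define z where "z = (1 / sqrt q) *\<^sub>R y"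
  have zz: "z \<bullet> (A *v z) = 1"
    using q by (simp add: z_def matrix_vector_mult_scaleR q_def[symmetric])
  have zt: "t \<bullet> (A *v z) = 0" if "t \<in> S" for t
    using orth[OF that] by (simp add: z_def matrix_vector_mult_scaleR)
  have "z \<notin> S" using zt zz by force
  then show ?case
    using S zz zt comm by (intro exI[of _ "insert z S"]) auto
qed

text \<open>The columns of \<open>P\<close> are an orthonormal basis for the inner product of
  \<open>A\<close>. Thus \<open>P\<close> serves as a square root of the inverse of
  \<open>A\<close>: it maps the standard normal law to the normal law whose precision matrix is
  \<open>A\<close>.\<close>

lemma positive_definite_factorization:
  fixes A :: "real^'n^'n"
  assumes sym: "transpose A = A" and pos: "\<And>x. x \<noteq> 0 \<Longrightarrow> x \<bullet> (A *v x) > 0"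
  obtains P :: "real^'n^'n" where "transpose P ** A ** P = mat 1" "matrix_inv A = P ** transpose P"
    "A ** (P ** transpose P) = mat 1" "(P ** transpose P) ** A = mat 1"
proof -
  obtain S :: "(real^'n) set" where S: "finite S" "card S = CARD('n)"
    "\<And>x y. x \<in> S \<Longrightarrow> y \<in> S \<Longrightarrow> x \<bullet> (A *v y) = of_bool (x = y)"
    using positive_definite_orthonormal_family[OF assms order_refl] by blast
  then obtain f :: "'n \<Rightarrow> real^'n" where f: "bij_betw f UNIV S"
    using finite_same_card_bij[of "UNIV :: 'n set" S] by auto
  define P :: "real^'n^'n" where "P = (\<chi> i j. f j $ i)"
  have "(transpose P ** A ** P) $ i $ j = mat 1 $ i $ j" for i j
  proof -
    have "(transpose P ** (A ** P)) $ i $ j = f i \<bullet> (A *v f j)"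
      by (simp add: matrix_matrix_mult_def matrix_vector_mult_def inner_vec_def P_def transpose_def)
    also have "\<dots> = of_bool (i = j)"
      using f by (subst S(3)) (auto simp: bij_betw_def inj_on_def)
    finally show ?thesis by (simp add: mat_def matrix_mul_assoc)
  qed
  then have P: "transpose P ** A ** P = mat 1" by (simp add: vec_eq_iff)
  then have "transpose P ** (A ** P) = mat 1" by (simp add: matrix_mul_assoc)
  then have "A ** P ** transpose P = mat 1" by (simp add: matrix_left_right_inverse)
  then have AP: "A ** (P ** transpose P) = mat 1" by (simp add: matrix_mul_assoc)
  then have PA: "(P ** transpose P) ** A = mat 1" by (simp add: matrix_left_right_inverse)
  show thesis using P matrix_inv_unique[OF AP PA] AP PA by (rule that)
qed

text \<open>For \<open>x = A *v y\<close>, the form of the inverse at \<open>x\<close> equals the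
  form of \<open>A\<close> at \<open>y\<close>.\<close>

lemma positive_definite_inverse:
  fixes A :: "real^'n^'n"
  assumes A: "transpose A = A" "\<And>x. x \<noteq> 0 \<Longrightarrow> x \<bullet> (A *v x) > 0"
  shows "A ** matrix_inv A = mat 1" "transpose (matrix_inv A) = matrix_inv A"
    and "x \<noteq> 0 \<Longrightarrow> x \<bullet> (matrix_inv A *v x) > 0"
proof -
  obtain P :: "real^'n^'n" where P: "matrix_inv A = P ** transpose P" "A ** (P ** transpose P) = mat 1"
    by (rule positive_definite_factorization[OF A])
  show inv: "A ** matrix_inv A = mat 1" using P by simp
  show "transpose (matrix_inv A) = matrix_inv A"
    by (simp add: P(1) matrix_transpose_mul)
  assume x: "x \<noteq> 0"
  define y where "y = matrix_inv A *v x"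
  have Ay: "A *v y = x" by (simp add: y_def matrix_vector_mul_assoc inv)
  then have "y \<noteq> 0" using x by auto
  from A(2)[OF this] show "x \<bullet> (matrix_inv A *v x) > 0"
    by (simp add: Ay y_def[symmetric] inner_commute)
qed

section \<open>Total mass and characteristic function of the normal law\<close>

lemma integral_cis_std_normal:
  "(LINT x|lborel. std_normal_density x *\<^sub>R cis (t * x)) = of_real (exp (- (t\<^sup>2) / 2))"
  using fun_cong[OF char_std_normal_distribution, of t]
  by (simp add: char_def integral_density cis_conv_exp)

lemma integral_lborel_prod:
  fixes f :: "'b::euclidean_space \<Rightarrow> real \<Rightarrow> complex"
  assumes "\<And>b. b \<in> Basis \<Longrightarrow> integrable lborel (f b)"
  shows "(LINT x|lborel. (\<Prod>b\<in>Basis. f b (x \<bullet> b))) = (\<Prod>b\<in>Basis. LINT x|lborel. f b x)"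
proof -
  interpret L: product_sigma_finite "\<lambda>_::'b. lborel :: real measure"
    by standard
  have [measurable]: "b \<in> Basis \<Longrightarrow> f b \<in> borel_measurable borel" for b
    using borel_measurable_integrable[OF assms] by simp
  have "(LINT x|lborel. (\<Prod>b\<in>Basis. f b (x \<bullet> b)))
      = (LINT x|Pi\<^sub>M Basis (\<lambda>_. lborel). (\<Prod>b\<in>Basis. f b ((\<Sum>i\<in>Basis. x i *\<^sub>R i) \<bullet> b)))"
    by (subst lborel_eq) (simp add: integral_distr)
  also have "\<dots> = (LINT x|Pi\<^sub>M Basis (\<lambda>_. lborel). (\<Prod>b\<in>Basis. f b (x b)))"
    by (intro Bochner_Integration.integral_cong prod.cong refl) simp
  also have "\<dots> = (\<Prod>b\<in>Basis. LINT x|lborel. f b x)"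
    by (rule L.product_integral_prod) (use assms in auto)
  finally show ?thesis .
qed

text \<open>The law is the image under \<open>P\<close> of the standard product density
  \<open>g\<close>, so both claims factor over the coordinates; the frequency becomes
  \<open>transpose P *v t\<close>, whose squared norm is
  \<open>t \<bullet> (matrix_inv A *v t)\<close>. The statement starts from the precision matrix
  \<open>A\<close> because the density contains the inverse of the covariance, that is, a double
  inverse.\<close>

lemma
  fixes A :: "real^'n^'n"
  assumes sym: "transpose A = A" and pos: "\<And>x. x \<noteq> 0 \<Longrightarrow> x \<bullet> (A *v x) > 0"
  defines "\<nu> \<equiv> multivariate_normal 0 (matrix_inv A)"
  shows prob_space_multivariate_normal: "prob_space \<nu>"
    and integral_cis_multivariate_normal:
      "(LINT z|\<nu>. cis (t \<bullet> z)) = of_real (exp (- (t \<bullet> (matrix_inv A *v t)) / 2))"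
proof -
  obtain P :: "real^'n^'n" where P: "transpose P ** A ** P = mat 1" and S: "matrix_inv A = P ** transpose P"
    and AP: "A ** (P ** transpose P) = mat 1" and PA: "(P ** transpose P) ** A = mat 1"
    by (rule positive_definite_factorization[OF assms(1,2)])
  have SA: "matrix_inv (matrix_inv A) = A"
    unfolding S using PA AP by (rule matrix_inv_unique)
  have detS: "det (matrix_inv A) = (det P)\<^sup>2"
    by (simp add: S det_mul power2_eq_square)
  have dP: "det P \<noteq> 0"
  proof
    assume "det P = 0"
    then have "det (mat 1 :: real^'n^'n) = 0" unfolding P[symmetric] by (simp add: det_mul)
    then show False by simp
  qed
  have mm[measurable]: "(*v) B \<in> borel_measurable borel" for B :: "real^'n^'n"
    by (intro borel_measurable_continuous_onI linear_continuous_on matrix_vector_mul_bounded_linear)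
  define d where "d z = 1 / sqrt ((2 * pi) ^ CARD('n) * det (matrix_inv A)) * exp (- (1 / 2) * (z \<bullet> (A *v z)))"
    for z :: "real^'n"
  have \<nu>: "\<nu> = density lborel (\<lambda>z. ennreal (d z))"
    by (simp add: \<nu>_def multivariate_normal_def SA d_def)
  have [measurable]: "d \<in> borel_measurable borel"
    unfolding d_def by measurable
  define g where "g w = (\<Prod>b\<in>Basis. std_normal_density (w \<bullet> b))" for w :: "real^'n"
  have [measurable]: "g \<in> borel_measurable borel"
    unfolding g_def by measurable
  have g0: "g w \<ge> 0" for w by (simp add: g_def prod_nonneg)
  have quad: "(P *v w) \<bullet> (A *v (P *v w)) = w \<bullet> w" for w
  proof -
    have "(P *v w) \<bullet> v = w \<bullet> (transpose P *v v)" for v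
      using inner_matrix_vector_mult[of v P w] by (simp only: inner_commute)
    then have "(P *v w) \<bullet> (A *v (P *v w)) = w \<bullet> ((transpose P ** A ** P) *v w)"
      by (simp only: matrix_vector_mul_assoc matrix_mul_assoc)
    then show ?thesis by (simp add: P)
  qed
  \<comment> \<open>The covariance has determinant \<open>(det P)^2\<close>, so the Jacobian
    \<open>\<bar>det P\<bar>\<close> cancels exactly against the normalizing constant of
    \<open>d\<close>.\<close>
  have g_eq: "g w = \<bar>det P\<bar> * d (P *v w)" for w
  proof -
    have "g w = (\<Prod>b\<in>(Basis :: (real^'n) set). 1 / sqrt (2 * pi)) * (\<Prod>b\<in>Basis. exp (- (w \<bullet> b)\<^sup>2 / 2))"
      unfolding g_def std_normal_density_def by (rule prod.distrib)
    also have "(\<Prod>b\<in>Basis. exp (- (w \<bullet> b)\<^sup>2 / 2)) = exp (\<Sum>b\<in>Basis. - (w \<bullet> b)\<^sup>2 / 2)"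
      by (simp add: exp_sum)
    also have "(\<Sum>b\<in>Basis. - (w \<bullet> b)\<^sup>2 / 2) = - (1/2) * (w \<bullet> w)"
      by (subst euclidean_inner[of w w]) (simp add: power2_eq_square sum_distrib_left sum_negf sum_divide_distrib)
    also have "(\<Prod>b\<in>(Basis :: (real^'n) set). 1 / sqrt (2 * pi)) = \<bar>det P\<bar> * (1 / sqrt ((2 * pi) ^ CARD('n) * det (matrix_inv A)))"
    proof -
      have "sqrt ((2 * pi) ^ CARD('n) * (det P)\<^sup>2) = sqrt (2 * pi) ^ CARD('n) * \<bar>det P\<bar>"
        by (simp only: real_sqrt_mult[of "(2 * pi) ^ CARD('n)"] real_sqrt_power[of "2 * pi"] real_sqrt_abs)
      then show ?thesis using dP by (simp add: detS power_one_over del: real_sqrt_mult)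
    qed
    finally show ?thesis by (simp add: d_def quad)
  qed
  have \<nu>_distr: "\<nu> = distr (density lborel (\<lambda>w. ennreal (g w))) borel ((*v) P)"
  proof (rule measure_eqI)
    fix B assume "B \<in> sets \<nu>"
    then have B[measurable]: "B \<in> sets borel" by (simp add: \<nu>)
    have "emeasure \<nu> B = (\<integral>\<^sup>+z. ennreal (d z) * indicator B z \<partial>lborel)"
      unfolding \<nu> by (subst emeasure_density) auto
    also have "\<dots> = ennreal \<bar>det P\<bar> * (\<integral>\<^sup>+w. ennreal (d (P *v w)) * indicator B (P *v w) \<partial>lborel)"
      by (rule nn_integral_lborel_matrix_vector_mult) (use dP in auto)
    also have "\<dots> = (\<integral>\<^sup>+w. ennreal (g w) * indicator ((*v) P -` B) w \<partial>lborel)"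
      by (subst nn_integral_cmult[symmetric])
        (auto simp: g_eq ennreal_mult' mult.assoc indicator_def intro!: nn_integral_cong)
    also have "\<dots> = emeasure (distr (density lborel (\<lambda>w. ennreal (g w))) borel ((*v) P)) B"
      using measurable_sets[OF mm B, of P]
      by (simp add: emeasure_distr emeasure_density)
    finally show "emeasure \<nu> B = emeasure (distr (density lborel (\<lambda>w. ennreal (g w))) borel ((*v) P)) B" .
  qed (simp add: \<nu>)
  have "(\<integral>\<^sup>+w. ennreal (g w) \<partial>lborel) = (\<integral>\<^sup>+w. (\<Prod>b\<in>Basis. ennreal (std_normal_density (w \<bullet> b))) \<partial>(lborel :: (real^'n) measure))"
    by (simp add: g_def prod_ennreal)
  also have "\<dots> = (\<Prod>b\<in>(Basis :: (real^'n) set). (\<integral>\<^sup>+x. ennreal (std_normal_density x) \<partial>lborel))"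
    by (rule nn_integral_lborel_prod) auto
  also have "\<dots> = 1"
    by (simp add: nn_integral_eq_integral[OF integrable_normal_density])
  finally have "(\<integral>\<^sup>+w. ennreal (g w) \<partial>lborel) = 1" .
  then have prob_g: "prob_space (density lborel (\<lambda>w. ennreal (g w)))"
    by (intro prob_spaceI) (simp add: emeasure_density)
  show "prob_space \<nu>"
    unfolding \<nu>_distr by (rule prob_space.prob_space_distr[OF prob_g]) simp
  have cis_m: "(\<lambda>z. cis (s \<bullet> z)) \<in> borel_measurable borel" for s :: "real^'n"
    by (intro borel_measurable_continuous_onI continuous_intros)
  have cis_P: "(\<lambda>w. cis (t \<bullet> (P *v w))) \<in> borel_measurable lborel"
    using measurable_comp[OF mm[of P] cis_m[of t]] by (simp add: comp_def)
  define s where "s = transpose P *v t"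
  have "(LINT z|\<nu>. cis (t \<bullet> z)) = (LINT w|density lborel (\<lambda>w. ennreal (g w)). cis (t \<bullet> (P *v w)))"
    unfolding \<nu>_distr by (rule integral_distr) (use mm cis_m in simp_all)
  also have "\<dots> = (LINT w|lborel. g w *\<^sub>R cis (t \<bullet> (P *v w)))"
    by (rule integral_density) (use g0 cis_P in simp_all)
  also have "\<dots> = (LINT w|lborel. (\<Prod>b\<in>Basis. std_normal_density (w \<bullet> b) *\<^sub>R cis ((s \<bullet> b) * (w \<bullet> b))))"
  proof (rule Bochner_Integration.integral_cong)
    fix w :: "real^'n"
    have "t \<bullet> (P *v w) = s \<bullet> w"
      by (simp add: s_def inner_matrix_vector_mult del: transpose_matrix_vector)
    also have "\<dots> = (\<Sum>b\<in>Basis. (s \<bullet> b) * (w \<bullet> b))" by (rule euclidean_inner)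
    finally have "cis (t \<bullet> (P *v w)) = (\<Prod>b\<in>Basis. cis ((s \<bullet> b) * (w \<bullet> b)))"
      by (simp add: cis_conv_exp sum_distrib_left exp_sum)
    then show "g w *\<^sub>R cis (t \<bullet> (P *v w)) = (\<Prod>b\<in>Basis. std_normal_density (w \<bullet> b) *\<^sub>R cis ((s \<bullet> b) * (w \<bullet> b)))"
      by (simp add: g_def scaleR_conv_of_real prod.distrib)
  qed simp
  also have "\<dots> = (\<Prod>b\<in>Basis. LINT x|lborel. std_normal_density x *\<^sub>R cis ((s \<bullet> b) * x))"
  proof (rule integral_lborel_prod)
    fix b :: "real^'n"
    have "(\<lambda>x. cis ((s \<bullet> b) * x)) \<in> borel_measurable borel"
      by (intro borel_measurable_continuous_onI continuous_intros)
    then have [measurable]: "(\<lambda>x. cis ((s \<bullet> b) * x)) \<in> borel_measurable lborel"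
      by simp
    show "integrable lborel (\<lambda>x. std_normal_density x *\<^sub>R cis ((s \<bullet> b) * x))"
      by (rule Bochner_Integration.integrable_bound[OF integrable_normal_density[of 1 0]]) auto
  qed
  also have "\<dots> = of_real (\<Prod>b\<in>Basis. exp (- ((s \<bullet> b)\<^sup>2) / 2))"
    unfolding integral_cis_std_normal by (rule of_real_prod[symmetric])
  also have "(\<Prod>b\<in>Basis. exp (- ((s \<bullet> b)\<^sup>2) / 2)) = exp (\<Sum>b\<in>Basis. - ((s \<bullet> b)\<^sup>2) / 2)"
    by (simp add: exp_sum)
  also have "(\<Sum>b\<in>Basis. - ((s \<bullet> b)\<^sup>2) / 2) = - (s \<bullet> s) / 2"
    by (subst euclidean_inner[of s s]) (simp add: power2_eq_square sum_negf sum_divide_distrib)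
  also have "s \<bullet> s = t \<bullet> (matrix_inv A *v t)"
    unfolding S s_def matrix_vector_mul_assoc[symmetric]
    by (rule inner_matrix_vector_mult[symmetric])
  finally show "(LINT z|\<nu>. cis (t \<bullet> z)) = of_real (exp (- (t \<bullet> (matrix_inv A *v t)) / 2))" .
qed

section \<open>Limit theorems for independent identically distributed vectors\<close>

lemma integrable_of_abs_le:
  fixes f g :: "'a \<Rightarrow> real"
  assumes "integrable M g" "f \<in> borel_measurable M" "\<And>\<omega>. \<omega> \<in> space M \<Longrightarrow> \<bar>f \<omega>\<bar> \<le> g \<omega>"
  shows "integrable M f"
  by (rule Bochner_Integration.integrable_bound[OF assms(1,2)])
    (use assms(3) in \<open>auto intro!: AE_I2 order_trans[OF _ abs_ge_self]\<close>)

lemma (in prob_space) identically_distributed_integral: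
  fixes g :: "'b \<Rightarrow> 'c::{banach, second_countable_topology}"
  assumes "X \<in> measurable M N" "X' \<in> measurable M N" "distr M N X = distr M N X'"
    and [measurable]: "g \<in> borel_measurable N"
  shows "integrable M (\<lambda>\<omega>. g (X \<omega>)) \<longleftrightarrow> integrable M (\<lambda>\<omega>. g (X' \<omega>))"
    and "(LINT \<omega>|M. g (X \<omega>)) = (LINT \<omega>|M. g (X' \<omega>))"
  using integrable_distr_eq[OF assms(1,4)] integrable_distr_eq[OF assms(2,4)]
    integral_distr[OF assms(1,4)] integral_distr[OF assms(2,4)] assms(3) by auto

text \<open>Only the diagonal of the double sum survives: distinct summands are independent with
  mean zero, so their products have expectation zero.\<close>

lemma (in prob_space)
  fixes Z :: "nat \<Rightarrow> 'a \<Rightarrow> real"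
  assumes indep: "indep_vars (\<lambda>_. borel) Z UNIV"
    and int: "\<And>i. integrable M (\<lambda>\<omega>. (Z i \<omega>)\<^sup>2)" and zero: "\<And>i. expectation (Z i) = 0"
  shows integrable_sum_indep_square: "integrable M (\<lambda>\<omega>. (\<Sum>i<n. Z i \<omega>)\<^sup>2)"
    and expectation_sum_indep_square:
      "expectation (\<lambda>\<omega>. (\<Sum>i<n. Z i \<omega>)\<^sup>2) = (\<Sum>i<n. expectation (\<lambda>\<omega>. (Z i \<omega>)\<^sup>2))"
proof -
  have rv[measurable]: "Z i \<in> borel_measurable M" for i
    using indep by (simp add: indep_vars_def)
  have Zi: "integrable M (Z i)" for i
    by (rule square_integrable_imp_integrable[OF rv int])
  have prod: "integrable M (\<lambda>\<omega>. Z i \<omega> * Z j \<omega>) \<and> expectation (\<lambda>\<omega>. Z i \<omega> * Z j \<omega>) =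
      (if i = j then expectation (\<lambda>\<omega>. (Z i \<omega>)\<^sup>2) else 0)" for i j
  proof (cases "i = j")
    case True
    then show ?thesis using int[of i] by (simp add: power2_eq_square)
  next
    case False
    have ij: "indep_vars (\<lambda>_. borel) Z {i, j}"
      using indep by (rule indep_vars_subset) simp
    have "integrable M (\<lambda>\<omega>. \<Prod>k\<in>{i, j}. Z k \<omega>)"
      by (rule indep_vars_integrable[OF _ ij]) (use Zi in auto)
    moreover have "expectation (\<lambda>\<omega>. \<Prod>k\<in>{i, j}. Z k \<omega>) = (\<Prod>k\<in>{i, j}. expectation (Z k))"
      by (rule indep_vars_lebesgue_integral[OF _ ij]) (use Zi in auto)
    ultimately show ?thesis using False zero by simp
  qed
  have sq: "(\<Sum>i<n. Z i \<omega>)\<^sup>2 = (\<Sum>i<n. \<Sum>j<n. Z i \<omega> * Z j \<omega>)" for \<omega>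
    by (simp add: power2_eq_square sum_product)
  show "integrable M (\<lambda>\<omega>. (\<Sum>i<n. Z i \<omega>)\<^sup>2)"
    unfolding sq using prod by (intro Bochner_Integration.integrable_sum) auto
  have "expectation (\<lambda>\<omega>. (\<Sum>i<n. Z i \<omega>)\<^sup>2) = (\<Sum>i<n. \<Sum>j<n. expectation (\<lambda>\<omega>. Z i \<omega> * Z j \<omega>))"
    unfolding sq using prod
    by (subst Bochner_Integration.integral_sum, force intro: Bochner_Integration.integrable_sum)
      (intro sum.cong refl Bochner_Integration.integral_sum, blast)
  also have "\<dots> = (\<Sum>i<n. expectation (\<lambda>\<omega>. (Z i \<omega>)\<^sup>2))"
    using prod by simp
  finally show "expectation (\<lambda>\<omega>. (\<Sum>i<n. Z i \<omega>)\<^sup>2) = (\<Sum>i<n. expectation (\<lambda>\<omega>. (Z i \<omega>)\<^sup>2))" .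
qed

text \<open>Chebyshev's inequality for the centred sum, with the bound
  \<open>v / \<epsilon>^2 / n\<close>. It is applied to the entries of the empirical information and
  to the average that bounds the cubic remainder.\<close>

lemma (in prob_space) weak_law_of_large_numbers:
  fixes Z :: "nat \<Rightarrow> 'a \<Rightarrow> real"
  assumes indep: "indep_vars (\<lambda>_. borel) Z UNIV"
    and ident: "\<And>i. distr M borel (Z i) = distr M borel (Z 0)"
    and int: "integrable M (\<lambda>\<omega>. (Z 0 \<omega>)\<^sup>2)" and \<epsilon>: "\<epsilon> > 0"
  shows "(\<lambda>n. prob {\<omega> \<in> space M. \<bar>(\<Sum>i<n. Z i \<omega>) / real n - expectation (Z 0)\<bar> \<ge> \<epsilon>}) \<longlonglongrightarrow> 0"
proof -
  have rv[measurable]: "Z i \<in> borel_measurable M" for i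
    using indep by (simp add: indep_vars_def)
  define m where "m = expectation (Z 0)"
  define Z' where "Z' i \<omega> = Z i \<omega> - m" for i \<omega>
  have Z0: "integrable M (Z 0)"
    by (rule square_integrable_imp_integrable[OF rv int])
  have int': "integrable M (\<lambda>\<omega>. (Z i \<omega>)\<^sup>2)" "integrable M (Z i)" "expectation (Z i) = m"
    "expectation (\<lambda>\<omega>. (Z' i \<omega>)\<^sup>2) = expectation (\<lambda>\<omega>. (Z' 0 \<omega>)\<^sup>2)" for i
    using identically_distributed_integral[OF rv rv ident, of "\<lambda>x. x\<^sup>2" i]
      identically_distributed_integral[OF rv rv ident, of "\<lambda>x. x" i]
      identically_distributed_integral(2)[OF rv rv ident, of "\<lambda>x. (x - m)\<^sup>2" i] int Z0
    by (simp_all add: m_def Z'_def)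
  have sq': "integrable M (\<lambda>\<omega>. (Z' i \<omega>)\<^sup>2)" for i
    unfolding Z'_def power2_diff using int'[of i] by simp
  have mean': "expectation (Z' i) = 0" for i
    unfolding Z'_def using int'[of i] by (simp add: prob_space)
  have indep': "indep_vars (\<lambda>_. borel) Z' UNIV"
    unfolding Z'_def by (rule indep_vars_compose2[OF indep]) auto
  define v where "v = expectation (\<lambda>\<omega>. (Z' 0 \<omega>)\<^sup>2)"
  have v: "expectation (\<lambda>\<omega>. (Z' i \<omega>)\<^sup>2) = v" for i
    unfolding v_def by (rule int'(4))
  have bound: "prob {\<omega> \<in> space M. \<bar>(\<Sum>i<n. Z i \<omega>) / real n - m\<bar> \<ge> \<epsilon>} \<le> v / \<epsilon>\<^sup>2 * (1 / real n)"
    if n: "n > 0" for n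
  proof -
    have "{\<omega> \<in> space M. \<bar>(\<Sum>i<n. Z i \<omega>) / real n - m\<bar> \<ge> \<epsilon>} \<subseteq>
        {\<omega> \<in> space M. (\<Sum>i<n. Z' i \<omega>)\<^sup>2 \<ge> (real n * \<epsilon>)\<^sup>2}"
    proof safe
      fix \<omega> assume "\<epsilon> \<le> \<bar>(\<Sum>i<n. Z i \<omega>) / real n - m\<bar>"
      also have "(\<Sum>i<n. Z i \<omega>) / real n - m = (\<Sum>i<n. Z' i \<omega>) / real n"
        using n by (simp add: Z'_def sum_subtractf field_simps)
      finally have "real n * \<epsilon> \<le> \<bar>\<Sum>i<n. Z' i \<omega>\<bar>"
        using n by (simp add: field_simps)
      then have "(real n * \<epsilon>)\<^sup>2 \<le> \<bar>\<Sum>i<n. Z' i \<omega>\<bar>\<^sup>2"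
        using \<epsilon> by (intro power_mono) auto
      then show "(real n * \<epsilon>)\<^sup>2 \<le> (\<Sum>i<n. Z' i \<omega>)\<^sup>2" by simp
    qed
    then have "prob {\<omega> \<in> space M. \<bar>(\<Sum>i<n. Z i \<omega>) / real n - m\<bar> \<ge> \<epsilon>} \<le>
        prob {\<omega> \<in> space M. (\<Sum>i<n. Z' i \<omega>)\<^sup>2 \<ge> (real n * \<epsilon>)\<^sup>2}"
      by (intro finite_measure_mono) (simp_all add: Z'_def)
    also have "\<dots> \<le> expectation (\<lambda>\<omega>. (\<Sum>i<n. Z' i \<omega>)\<^sup>2) / (real n * \<epsilon>)\<^sup>2"
      by (rule integral_Markov_inequality_measure[where A = "space M"])
        (use n \<epsilon> integrable_sum_indep_square[OF indep' sq' mean'] in auto)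
    also have "expectation (\<lambda>\<omega>. (\<Sum>i<n. Z' i \<omega>)\<^sup>2) = real n * v"
      unfolding expectation_sum_indep_square[OF indep' sq' mean'] v by simp
    finally show ?thesis using n by (simp add: power2_eq_square field_simps)
  qed
  show ?thesis
    unfolding m_def[symmetric]
  proof (rule tendsto_sandwich[OF _ _ tendsto_const])
    show "\<forall>\<^sub>F n in sequentially. prob {\<omega> \<in> space M. \<bar>(\<Sum>i<n. Z i \<omega>) / real n - m\<bar> \<ge> \<epsilon>} \<le> v / \<epsilon>\<^sup>2 * (1 / real n)"
      using eventually_gt_at_top[of 0] by eventually_elim (rule bound)
    show "(\<lambda>n. v / \<epsilon>\<^sup>2 * (1 / real n)) \<longlonglongrightarrow> 0"
      by (rule tendsto_mult_right_zero) (rule lim_1_over_n)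
  qed simp
qed

lemma (in prob_space) central_limit_theorem_cis:
  fixes Z :: "nat \<Rightarrow> 'a \<Rightarrow> real"
  assumes indep: "indep_vars (\<lambda>_. borel) Z UNIV"
    and ident: "\<And>i. distr M borel (Z i) = distr M borel (Z 0)"
    and int: "integrable M (\<lambda>\<omega>. (Z 0 \<omega>)\<^sup>2)" and zero: "expectation (Z 0) = 0"
    and v: "expectation (\<lambda>\<omega>. (Z 0 \<omega>)\<^sup>2) = v" "v > 0"
  shows "(\<lambda>n. LINT \<omega>|M. cis ((\<Sum>i<n. Z i \<omega>) / sqrt (real n))) \<longlonglongrightarrow> of_real (exp (- v / 2))"
proof -
  have rv[measurable]: "Z i \<in> borel_measurable M" for i
    using indep by (simp add: indep_vars_def)
  have int': "integrable M (\<lambda>\<omega>. (Z i \<omega>)\<^sup>2)" "expectation (Z i) = 0"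
    "expectation (\<lambda>\<omega>. (Z i \<omega>)\<^sup>2) = v" for i
    using identically_distributed_integral[OF rv rv ident, of "\<lambda>x. x\<^sup>2" i]
      identically_distributed_integral[OF rv rv ident, of "\<lambda>x. x" i] int zero v
    by simp_all
  define S where "S n \<omega> = (\<Sum>i<n. Z i \<omega>) / sqrt (real n * (sqrt v)\<^sup>2)" for n \<omega>
  have [measurable]: "S n \<in> borel_measurable M" for n unfolding S_def by simp
  have "weak_conv_m (\<lambda>n. distr M borel (S n)) std_normal_distribution"
    unfolding S_def
    by (rule central_limit_theorem_zero_mean[OF indep _ _ _ _ ident]) (use int' v in auto)
  \<comment> \<open>The sum \<open>S n\<close> is divided by the standard deviation; evaluating its
    characteristic function at \<open>sqrt v\<close> undoes this.\<close>
  then have "(\<lambda>n. char (distr M borel (S n)) (sqrt v)) \<longlonglongrightarrow> char std_normal_distribution (sqrt v)"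
    by (intro levy_continuity1 real_dist_normal_dist) (auto intro!: real_distribution_distr)
  moreover have "char (distr M borel (S n)) (sqrt v) = (LINT \<omega>|M. cis ((\<Sum>i<n. Z i \<omega>) / sqrt (real n)))" for n
  proof -
    have "sqrt v * S n \<omega> = (\<Sum>i<n. Z i \<omega>) / sqrt (real n)" for \<omega>
      using v by (simp add: S_def real_sqrt_mult)
    moreover have "char (distr M borel (S n)) (sqrt v) = (LINT \<omega>|M. cis (sqrt v * S n \<omega>))"
      unfolding char_def by (subst integral_distr) (simp_all add: cis_conv_exp)
    ultimately show ?thesis by simp
  qed
  ultimately show ?thesis using v by (simp add: char_std_normal_distribution)
qed

section \<open>Multivariate central limit theorem\<close>

lemma norm_cis_diff_le: "norm (cis a - cis b) \<le> \<bar>a - b\<bar>"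
proof -
  have "cis a - cis b = cis b * (cis (a - b) - 1)"
    by (simp add: cis_mult right_diff_distrib)
  also have "norm \<dots> = norm (cis (a - b) - 1)" by (simp add: norm_mult)
  also have "\<dots> \<le> \<bar>a - b\<bar>"
    using iexp_approx1[of "a - b" 0] by (simp add: cis_conv_exp)
  finally show ?thesis .
qed

lemma integrable_inner_square:
  fixes X :: "'a \<Rightarrow> 'b::euclidean_space"
  assumes [measurable]: "X \<in> borel_measurable M" and "integrable M (\<lambda>\<omega>. (norm (X \<omega>))\<^sup>2)"
  shows "integrable M (\<lambda>\<omega>. (t \<bullet> X \<omega>)\<^sup>2)"
proof (rule integrable_of_abs_le)
  show "integrable M (\<lambda>\<omega>. (norm t)\<^sup>2 * (norm (X \<omega>))\<^sup>2)" using assms(2) by simp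
  fix \<omega>
  have "\<bar>t \<bullet> X \<omega>\<bar>\<^sup>2 \<le> (norm t * norm (X \<omega>))\<^sup>2"
    by (intro power_mono Cauchy_Schwarz_ineq2) simp
  then show "\<bar>(t \<bullet> X \<omega>)\<^sup>2\<bar> \<le> (norm t)\<^sup>2 * (norm (X \<omega>))\<^sup>2"
    by (simp add: power_mult_distrib)
qed simp

text \<open>The squared norm is the sum of the squared coordinates, and each coordinate of a
  normalized sum keeps the variance of one summand. The expectation is therefore the same for all
  positive \<open>n\<close>, which makes the normalized sums tight.\<close>

lemma (in prob_space)
  fixes V :: "nat \<Rightarrow> 'a \<Rightarrow> 'b::euclidean_space"
  assumes indep: "indep_vars (\<lambda>_. borel) V UNIV"
    and ident: "\<And>i. distr M borel (V i) = distr M borel (V 0)"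
    and int: "integrable M (\<lambda>\<omega>. (norm (V 0 \<omega>))\<^sup>2)"
    and zero: "\<And>t. expectation (\<lambda>\<omega>. t \<bullet> V 0 \<omega>) = 0"
  shows integrable_norm_normalized_sum:
      "integrable M (\<lambda>\<omega>. (norm ((1 / sqrt (real n)) *\<^sub>R (\<Sum>i<n. V i \<omega>)))\<^sup>2)"
    and expectation_norm_normalized_sum:
      "n > 0 \<Longrightarrow> expectation (\<lambda>\<omega>. (norm ((1 / sqrt (real n)) *\<^sub>R (\<Sum>i<n. V i \<omega>)))\<^sup>2) =
        expectation (\<lambda>\<omega>. (norm (V 0 \<omega>))\<^sup>2)"
proof -
  have rv[measurable]: "V i \<in> borel_measurable M" for i
    using indep by (simp add: indep_vars_def)
  have indep_t: "indep_vars (\<lambda>_. borel) (\<lambda>i \<omega>. t \<bullet> V i \<omega>) UNIV" for t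
    by (rule indep_vars_compose2[OF indep]) simp
  have sq_t: "integrable M (\<lambda>\<omega>. (t \<bullet> V i \<omega>)\<^sup>2)" "expectation (\<lambda>\<omega>. t \<bullet> V i \<omega>) = 0"
    "expectation (\<lambda>\<omega>. (t \<bullet> V i \<omega>)\<^sup>2) = expectation (\<lambda>\<omega>. (t \<bullet> V 0 \<omega>)\<^sup>2)" for t i
  proof -
    show "integrable M (\<lambda>\<omega>. (t \<bullet> V i \<omega>)\<^sup>2)"
      using identically_distributed_integral(1)[OF rv rv ident, of "\<lambda>x. (t \<bullet> x)\<^sup>2" i]
        integrable_inner_square[OF rv int] by simp
    show "expectation (\<lambda>\<omega>. t \<bullet> V i \<omega>) = 0"
      "expectation (\<lambda>\<omega>. (t \<bullet> V i \<omega>)\<^sup>2) = expectation (\<lambda>\<omega>. (t \<bullet> V 0 \<omega>)\<^sup>2)"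
      using identically_distributed_integral(2)[OF rv rv ident, of "\<lambda>x. (t \<bullet> x)\<^sup>2" i]
        identically_distributed_integral(2)[OF rv rv ident, of "\<lambda>x. t \<bullet> x" i] zero
      by simp_all
  qed
  have norm_sq: "(norm x)\<^sup>2 = (\<Sum>b\<in>Basis. (b \<bullet> x)\<^sup>2)" for x :: 'b
    unfolding power2_norm_eq_inner
    by (subst euclidean_inner) (simp add: power2_eq_square inner_commute)
  have nU: "(norm ((1 / sqrt (real n)) *\<^sub>R (\<Sum>i<n. V i \<omega>)))\<^sup>2 =
      (\<Sum>b\<in>Basis. (\<Sum>i<n. b \<bullet> V i \<omega>)\<^sup>2 / real n)" for \<omega>
    unfolding norm_sq by (simp add: inner_sum_right power_divide)
  have i: "integrable M (\<lambda>\<omega>. (\<Sum>i<n. b \<bullet> V i \<omega>)\<^sup>2 / real n)" for b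
    using integrable_sum_indep_square[OF indep_t sq_t(1,2)] by simp
  show "integrable M (\<lambda>\<omega>. (norm ((1 / sqrt (real n)) *\<^sub>R (\<Sum>i<n. V i \<omega>)))\<^sup>2)"
    unfolding nU by (intro Bochner_Integration.integrable_sum i)
  assume n: "n > 0"
  have "expectation (\<lambda>\<omega>. (\<Sum>i<n. b \<bullet> V i \<omega>)\<^sup>2 / real n) = expectation (\<lambda>\<omega>. (b \<bullet> V 0 \<omega>)\<^sup>2)" for b
  proof -
    have "expectation (\<lambda>\<omega>. (\<Sum>i<n. b \<bullet> V i \<omega>)\<^sup>2 / real n) =
        (\<Sum>i<n. expectation (\<lambda>\<omega>. (b \<bullet> V i \<omega>)\<^sup>2)) / real n"
      using expectation_sum_indep_square[OF indep_t sq_t(1,2)] by simp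
    also have "(\<Sum>i<n. expectation (\<lambda>\<omega>. (b \<bullet> V i \<omega>)\<^sup>2)) = (\<Sum>i<n. expectation (\<lambda>\<omega>. (b \<bullet> V 0 \<omega>)\<^sup>2))"
      by (rule sum.cong[OF refl sq_t(3)])
    finally show ?thesis using n by simp
  qed
  then show "expectation (\<lambda>\<omega>. (norm ((1 / sqrt (real n)) *\<^sub>R (\<Sum>i<n. V i \<omega>)))\<^sup>2) =
      expectation (\<lambda>\<omega>. (norm (V 0 \<omega>))\<^sup>2)"
    unfolding nU norm_sq[of "V 0 _"] using i integrable_inner_square[OF rv int]
    by (subst (1 2) Bochner_Integration.integral_sum) auto
qed

lemma (in prob_space) prob_norm_normalized_sum_gt:
  fixes V :: "nat \<Rightarrow> 'a \<Rightarrow> 'b::euclidean_space"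
  assumes indep: "indep_vars (\<lambda>_. borel) V UNIV"
    and "\<And>i. distr M borel (V i) = distr M borel (V 0)" "integrable M (\<lambda>\<omega>. (norm (V 0 \<omega>))\<^sup>2)"
    and "\<And>t. expectation (\<lambda>\<omega>. t \<bullet> V 0 \<omega>) = 0" and \<epsilon>: "\<epsilon> > 0"
  obtains R where "R > 0"
    "\<And>n. n > 0 \<Longrightarrow> prob {\<omega> \<in> space M. norm ((1 / sqrt (real n)) *\<^sub>R (\<Sum>i<n. V i \<omega>)) > R} \<le> \<epsilon>"
proof -
  define U where "U n \<omega> = (1 / sqrt (real n)) *\<^sub>R (\<Sum>i<n. V i \<omega>)" for n \<omega>
  define C where "C = expectation (\<lambda>\<omega>. (norm (V 0 \<omega>))\<^sup>2)"
  have "V i \<in> borel_measurable M" for i using indep by (simp add: indep_vars_def)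
  then have [measurable]: "U n \<in> borel_measurable M" for n unfolding U_def by simp
  note U2 = integrable_norm_normalized_sum[OF assms(1-4), folded U_def]
    expectation_norm_normalized_sum[OF assms(1-4), folded U_def C_def]
  have C0: "C \<ge> 0" unfolding C_def by simp
  \<comment> \<open>Markov's inequality gives the bound \<open>C / R^2\<close>; the added
    \<open>1\<close> keeps \<open>R\<close> positive when \<open>C = 0\<close>.\<close>
  define R where "R = sqrt ((C + 1) / \<epsilon>)"
  have R: "R > 0" "R\<^sup>2 = (C + 1) / \<epsilon>" using C0 \<epsilon> by (auto simp: R_def)
  have "prob {\<omega> \<in> space M. norm (U n \<omega>) > R} \<le> \<epsilon>" if "n > 0" for n
  proof -
    have "prob {\<omega> \<in> space M. norm (U n \<omega>) > R} \<le> prob {\<omega> \<in> space M. (norm (U n \<omega>))\<^sup>2 \<ge> R\<^sup>2}"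
      using R(1) by (intro finite_measure_mono) (auto intro!: power_mono)
    also have "\<dots> \<le> expectation (\<lambda>\<omega>. (norm (U n \<omega>))\<^sup>2) / R\<^sup>2"
      by (rule integral_Markov_inequality_measure[where A = "space M"])
        (use U2(1) zero_less_power[OF R(1), of 2] in auto)
    also have "\<dots> = C / R\<^sup>2" using U2(2)[OF that] by simp
    also have "\<dots> \<le> \<epsilon>" unfolding R(2) using C0 \<epsilon> by (simp add: field_simps)
    finally show ?thesis .
  qed
  then show thesis using R(1) that[of R] by (simp add: U_def)
qed

text \<open>The Cramer-Wold device and Slutsky's theorem in one step, both at the level of
  characteristic functions: \<open>cis\<close> is bounded by one and 1-Lipschitz, so replacing
  \<open>T n\<close> by the normalized sum changes the characteristic function at \<open>t\<close>
  by at most \<open>norm t * \<delta>\<close> plus twice the probability of a deviation beyond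
  \<delta>.\<close>

theorem (in prob_space) multivariate_clt_slutsky:
  fixes V :: "nat \<Rightarrow> 'a \<Rightarrow> real^'n" and T :: "nat \<Rightarrow> 'a \<Rightarrow> real^'n" and A :: "real^'n^'n"
  assumes indep: "indep_vars (\<lambda>_. borel) V UNIV"
    and ident: "\<And>i. distr M borel (V i) = distr M borel (V 0)"
    and int: "integrable M (\<lambda>\<omega>. (norm (V 0 \<omega>))\<^sup>2)"
    and zero: "\<And>t. expectation (\<lambda>\<omega>. t \<bullet> V 0 \<omega>) = 0"
    and cov: "\<And>t. expectation (\<lambda>\<omega>. (t \<bullet> V 0 \<omega>)\<^sup>2) = t \<bullet> (matrix_inv A *v t)"
    and A: "transpose A = A" "\<And>x. x \<noteq> 0 \<Longrightarrow> x \<bullet> (A *v x) > 0"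
    and T[measurable]: "\<And>n. T n \<in> borel_measurable M"
    and close: "\<And>\<delta>. \<delta> > 0 \<Longrightarrow>
      (\<lambda>n. prob {\<omega> \<in> space M. norm (T n \<omega> - (1 / sqrt (real n)) *\<^sub>R (\<Sum>i<n. V i \<omega>)) > \<delta>}) \<longlonglongrightarrow> 0"
  shows "converges_in_distribution M T (multivariate_normal 0 (matrix_inv A))"
proof -
  have rv[measurable]: "V i \<in> borel_measurable M" for i
    using indep by (simp add: indep_vars_def)
  define U where "U n \<omega> = (1 / sqrt (real n)) *\<^sub>R (\<Sum>i<n. V i \<omega>)" for n \<omega>
  have U[measurable]: "U n \<in> borel_measurable M" for n unfolding U_def by simp
  define q where "q t = t \<bullet> (matrix_inv A *v t)" for t
  have indep_t: "indep_vars (\<lambda>_. borel) (\<lambda>i \<omega>. t \<bullet> V i \<omega>) UNIV" for t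
    by (rule indep_vars_compose2[OF indep]) simp
  have sq_t: "integrable M (\<lambda>\<omega>. (t \<bullet> V i \<omega>)\<^sup>2)" "expectation (\<lambda>\<omega>. (t \<bullet> V i \<omega>)\<^sup>2) = q t"
    "expectation (\<lambda>\<omega>. t \<bullet> V i \<omega>) = 0" for t i
  proof -
    have "integrable M (\<lambda>\<omega>. (t \<bullet> V 0 \<omega>)\<^sup>2)"
      by (rule integrable_inner_square[OF rv int])
    then show "integrable M (\<lambda>\<omega>. (t \<bullet> V i \<omega>)\<^sup>2)"
      using identically_distributed_integral(1)[OF rv rv ident, of "\<lambda>x. (t \<bullet> x)\<^sup>2" i] by simp
    show "expectation (\<lambda>\<omega>. (t \<bullet> V i \<omega>)\<^sup>2) = q t" "expectation (\<lambda>\<omega>. t \<bullet> V i \<omega>) = 0"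
      using identically_distributed_integral(2)[OF rv rv ident, of "\<lambda>x. (t \<bullet> x)\<^sup>2" i]
        identically_distributed_integral(2)[OF rv rv ident, of "\<lambda>x. t \<bullet> x" i] zero cov
      by (simp_all add: q_def)
  qed
  have tU: "t \<bullet> U n \<omega> = (\<Sum>i<n. t \<bullet> V i \<omega>) / sqrt (real n)" for t n \<omega>
    by (simp add: U_def inner_sum_right)
  define N where "N = multivariate_normal 0 (matrix_inv A)"
  have N: "prob_space N" "sets N = sets borel"
    unfolding N_def by (rule prob_space_multivariate_normal[OF A]) (auto simp: multivariate_normal_def)
  have cisN: "(LINT z|N. cis (t \<bullet> z)) = of_real (exp (- q t / 2))" for t
    unfolding N_def q_def by (rule integral_cis_multivariate_normal[OF A])
  have cis_m: "(\<lambda>z. cis (t \<bullet> z)) \<in> borel_measurable borel" for t :: "real^'n"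
    by (intro borel_measurable_continuous_onI continuous_intros)
  have cis_c[measurable]: "(\<lambda>\<omega>. cis (t \<bullet> X \<omega>)) \<in> borel_measurable M" if "X \<in> borel_measurable M"
    for t and X :: "'a \<Rightarrow> real^'n"
    using measurable_comp[OF that cis_m] by (simp add: comp_def)
  have cis_i: "integrable M (\<lambda>\<omega>. cis (t \<bullet> X \<omega>))" if "X \<in> borel_measurable M" for t and X :: "'a \<Rightarrow> real^'n"
    by (rule integrable_const_bound[of _ 1]) (use cis_c[OF that] in auto)
  have q_pos: "q t > 0" if "t \<noteq> 0" for t
    unfolding q_def by (rule positive_definite_inverse(3)[OF A that])
  \<comment> \<open>At \<open>t = 0\<close> the projected variance vanishes, which the
    one-dimensional theorem excludes; there both sides equal one.\<close>
  have cisU: "(\<lambda>n. LINT \<omega>|M. cis (t \<bullet> U n \<omega>)) \<longlonglongrightarrow> of_real (exp (- q t / 2))" for t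
  proof (cases "t = 0")
    case True
    then show ?thesis by (simp add: q_def prob_space)
  next
    case False
    have "distr M borel (\<lambda>\<omega>. t \<bullet> V i \<omega>) = distr M borel (\<lambda>\<omega>. t \<bullet> V 0 \<omega>)" for i
    proof -
      have "distr M borel (\<lambda>\<omega>. t \<bullet> V j \<omega>) = distr (distr M borel (V j)) borel (\<lambda>x. t \<bullet> x)" for j
        by (subst distr_distr) (simp_all add: comp_def)
      then show ?thesis using ident[of i] by simp
    qed
    then show ?thesis
      unfolding tU by (intro central_limit_theorem_cis[OF indep_t _ sq_t(1,3,2) q_pos[OF False]])
  qed
  have cisT: "(\<lambda>n. LINT \<omega>|M. cis (t \<bullet> T n \<omega>)) \<longlonglongrightarrow> of_real (exp (- q t / 2))" for t
  proof -
    have bound: "norm ((LINT \<omega>|M. cis (t \<bullet> T n \<omega>)) - (LINT \<omega>|M. cis (t \<bullet> U n \<omega>))) \<le>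
        norm t * \<delta> + 2 * prob {\<omega> \<in> space M. norm (T n \<omega> - U n \<omega>) > \<delta>}" if \<delta>: "\<delta> > 0" for n \<delta>
    proof -
      let ?B = "{\<omega> \<in> space M. norm (T n \<omega> - U n \<omega>) > \<delta>}"
      have B: "?B \<in> events" by measurable
      have "norm ((LINT \<omega>|M. cis (t \<bullet> T n \<omega>)) - (LINT \<omega>|M. cis (t \<bullet> U n \<omega>))) =
          norm (LINT \<omega>|M. cis (t \<bullet> T n \<omega>) - cis (t \<bullet> U n \<omega>))"
        by (subst Bochner_Integration.integral_diff) (auto intro: cis_i)
      also have "\<dots> \<le> (LINT \<omega>|M. norm (cis (t \<bullet> T n \<omega>) - cis (t \<bullet> U n \<omega>)))"
        by (rule integral_norm_bound)
      also have "\<dots> \<le> (LINT \<omega>|M. norm t * \<delta> + 2 * indicator ?B \<omega>)"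
      proof (rule integral_mono)
        show "integrable M (\<lambda>\<omega>. norm (cis (t \<bullet> T n \<omega>) - cis (t \<bullet> U n \<omega>)))"
          by (intro integrable_norm Bochner_Integration.integrable_diff cis_i T U)
        show "integrable M (\<lambda>\<omega>. norm t * \<delta> + 2 * indicator ?B \<omega>)"
          using B by (intro Bochner_Integration.integrable_add integrable_const integrable_mult_right
            integrable_real_indicator) (auto simp: less_top[symmetric])
        fix \<omega> assume \<omega>: "\<omega> \<in> space M"
        show "norm (cis (t \<bullet> T n \<omega>) - cis (t \<bullet> U n \<omega>)) \<le> norm t * \<delta> + 2 * indicator ?B \<omega>"
        proof (cases "\<omega> \<in> ?B")
          case True
          have "norm (cis (t \<bullet> T n \<omega>) - cis (t \<bullet> U n \<omega>)) \<le> 1 + 1"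
            by (rule order_trans[OF norm_triangle_ineq4]) simp
          moreover have "norm t * \<delta> \<ge> 0" using \<delta> by simp
          ultimately show ?thesis unfolding indicator_simps(1)[OF True] by linarith
        next
          case False
          then have "norm (T n \<omega> - U n \<omega>) \<le> \<delta>" using \<omega> by simp
          then have "norm t * norm (T n \<omega> - U n \<omega>) \<le> norm t * \<delta>" by (intro mult_left_mono) auto
          moreover have "norm (cis (t \<bullet> T n \<omega>) - cis (t \<bullet> U n \<omega>)) \<le> \<bar>t \<bullet> (T n \<omega> - U n \<omega>)\<bar>"
            using norm_cis_diff_le[of "t \<bullet> T n \<omega>" "t \<bullet> U n \<omega>"] by (simp add: inner_diff_right)
          moreover have "\<bar>t \<bullet> (T n \<omega> - U n \<omega>)\<bar> \<le> norm t * norm (T n \<omega> - U n \<omega>)"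
            by (rule Cauchy_Schwarz_ineq2)
          ultimately show ?thesis unfolding indicator_simps(2)[OF False] by linarith
        qed
      qed
      also have "\<dots> = norm t * \<delta> + 2 * prob ?B"
        using B by (subst Bochner_Integration.integral_add) (auto simp: prob_space less_top[symmetric])
      finally show ?thesis .
    qed
    have "(\<lambda>n. (LINT \<omega>|M. cis (t \<bullet> T n \<omega>)) - (LINT \<omega>|M. cis (t \<bullet> U n \<omega>))) \<longlonglongrightarrow> 0"
    proof (rule tendstoI)
      fix e :: real assume e: "e > 0"
      \<comment> \<open>Half of \<open>e\<close> is left for the Lipschitz term and half for twice a
        probability below \<open>e / 4\<close>. The added \<open>1\<close> in the denominator covers
        \<open>t = 0\<close>.\<close>
      define \<delta> where "\<delta> = e / 2 / (norm t + 1)"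
      have \<delta>: "\<delta> > 0" using e by (simp add: \<delta>_def add_nonneg_pos)
      have nt: "norm t + 1 \<noteq> 0" using norm_ge_zero[of t] by linarith
      have "norm t * \<delta> \<le> (norm t + 1) * \<delta>" using \<delta> by (intro mult_right_mono) auto
      also have "\<dots> = e / 2" 
        unfolding \<delta>_def times_divide_eq_right[of "norm t + 1" "e / 2"]
        by (rule nonzero_mult_div_cancel_left[OF nt])
      finally have t\<delta>: "norm t * \<delta> \<le> e / 2" .
      have "\<forall>\<^sub>F n in sequentially. prob {\<omega> \<in> space M. norm (T n \<omega> - U n \<omega>) > \<delta>} < e / 4"
        using close[OF \<delta>, folded U_def] by (rule order_tendstoD) (use e in simp)
      then show "\<forall>\<^sub>F n in sequentially. dist ((LINT \<omega>|M. cis (t \<bullet> T n \<omega>)) - (LINT \<omega>|M. cis (t \<bullet> U n \<omega>))) 0 < e"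
      proof eventually_elim
        case (elim n)
        show ?case using bound[OF \<delta>, of n] elim t\<delta> by simp
      qed
    qed
    from tendsto_add[OF this cisU[of t]] show ?thesis by simp
  qed
  have tight: "\<exists>R. \<forall>\<^sub>F n in sequentially. measure (distr M borel (T n)) (- cball 0 R) \<le> \<epsilon>"
    if \<epsilon>: "\<epsilon> > 0" for \<epsilon>
  proof -
    obtain R where R: "R > 0" "\<And>n. n > 0 \<Longrightarrow> prob {\<omega> \<in> space M. norm (U n \<omega>) > R} \<le> \<epsilon> / 2"
      using prob_norm_normalized_sum_gt[OF indep ident int zero, of "\<epsilon> / 2"] \<epsilon> unfolding U_def by auto
    have "\<forall>\<^sub>F n in sequentially. prob {\<omega> \<in> space M. norm (T n \<omega> - U n \<omega>) > 1} < \<epsilon> / 2"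
      using close[of 1, folded U_def] by (rule order_tendstoD(2)) (use \<epsilon> in auto)
    then have "\<forall>\<^sub>F n in sequentially. measure (distr M borel (T n)) (- cball 0 (R + 1)) \<le> \<epsilon>"
      using eventually_gt_at_top[of 0]
    proof eventually_elim
      case (elim n)
      let ?A = "{\<omega> \<in> space M. norm (T n \<omega> - U n \<omega>) > 1}" and ?B = "{\<omega> \<in> space M. norm (U n \<omega>) > R}"
      have "measure (distr M borel (T n)) (- cball 0 (R + 1)) = prob {\<omega> \<in> space M. norm (T n \<omega>) > R + 1}"
        by (subst measure_distr) (auto simp: vimage_def Int_def not_le intro!: arg_cong[where f = prob])
      also have "\<dots> \<le> prob (?A \<union> ?B)"
      proof (intro finite_measure_mono subsetI)
        fix \<omega> assume *: "\<omega> \<in> {\<omega> \<in> space M. norm (T n \<omega>) > R + 1}"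
        then show "\<omega> \<in> ?A \<union> ?B"
          using norm_triangle_sub[of "T n \<omega>" "U n \<omega>"] by auto
      qed measurable
      also have "\<dots> \<le> prob ?A + prob ?B"
        by (rule measure_Un_le) measurable
      finally show ?case using elim(1) R(2)[OF elim(2)] by linarith
    qed
    then show ?thesis by blast
  qed
  show ?thesis
    unfolding converges_in_distribution_def N_def[symmetric]
  proof (rule weakly_convergesI_cis)
    show "(\<lambda>n. LINT x|distr M borel (T n). cis (t \<bullet> x)) \<longlonglongrightarrow> (LINT x|N. cis (t \<bullet> x))" for t
      using cisT[of t] by (simp add: cisN integral_distr[OF T cis_m])
  qed (use N tight in \<open>auto intro: prob_space_distr\<close>)
qed

section \<open>The local log-likelihood\<close>

text \<open>The segment from the centre to a point \<open>v\<close> on or beyond the sphere meets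
  the sphere. If \<open>f v\<close> were at least \<open>f w\<close>, concavity would make the value
  at the crossing at least \<open>f w\<close>, against the assumption. Hence every point that far
  away is strictly worse than the centre, and the maximum over the ball is global.\<close>

lemma concave_maximizers_in_ball:
  fixes f :: "'b::euclidean_space \<Rightarrow> real"
  assumes conc: "concave_on D f" and \<delta>: "\<delta> > 0" and D: "cball w \<delta> \<subseteq> D"
    and cont: "continuous_on (cball w \<delta>) f"
    and sphere: "\<And>b. dist w b = \<delta> \<Longrightarrow> f b < f w"
  defines "S \<equiv> {u \<in> D. \<forall>v\<in>D. f v \<le> f u}"
  shows "S \<noteq> {}" "compact S" "S \<subseteq> cball w \<delta>"
proof -
  have out: "f v < f w" if v: "v \<in> D" "dist w v \<ge> \<delta>" for v
  proof (rule ccontr)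
    assume "\<not> f v < f w"
    then have fv: "f v \<ge> f w" by simp
    have pos: "dist w v > 0" using v \<delta> by linarith
    \<comment> \<open>The fraction of the segment from \<open>w\<close> to \<open>v\<close> at which
      it crosses the sphere.\<close>
    define l where "l = \<delta> / dist w v"
    have l: "0 \<le> l" "l \<le> 1" using v \<delta> pos by (auto simp: l_def)
    define b where "b = (1 - l) *\<^sub>R w + l *\<^sub>R v"
    have "w - b = l *\<^sub>R (w - v)" by (simp add: b_def algebra_simps)
    then have "dist w b = l * dist w v" using l by (simp add: dist_norm)
    also have "\<dots> = \<delta>" using pos by (simp add: l_def)
    finally have "f b < f w" by (rule sphere)
    moreover have "f b \<ge> (1 - l) * f w + l * f v"
      using conc v(1) D \<delta> l unfolding b_def concave_on_iff by (auto simp: subset_iff)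
    moreover have "(1 - l) * f w + l * f v \<ge> f w"
      using mult_left_mono[OF fv l(1)] by (simp add: algebra_simps)
    ultimately show False by simp
  qed
  obtain u where u: "u \<in> cball w \<delta>" "\<And>v. v \<in> cball w \<delta> \<Longrightarrow> f v \<le> f u"
    using continuous_attains_sup[OF compact_cball _ cont] \<delta> by (metis cball_eq_empty not_le less_imp_le)
  have wu: "f w \<le> f u" using \<delta> by (intro u) simp
  have glob: "f v \<le> f u" if "v \<in> D" for v
    using u(2)[of v] out[OF that] wu by (cases "dist w v \<ge> \<delta>") auto
  have uS: "u \<in> S" using u(1) D glob by (auto simp: S_def)
  show "S \<noteq> {}" using uS by blast
  show sub: "S \<subseteq> cball w \<delta>"
  proof
    fix x assume x: "x \<in> S"
    have "w \<in> D" using D \<delta> by auto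
    then have "x \<in> D" "f w \<le> f x" using x by (auto simp: S_def)
    then have "\<not> dist w x \<ge> \<delta>" using out[of x] by linarith
    then show "x \<in> cball w \<delta>" by simp
  qed
  \<comment> \<open>The set of maximizers is a level set of \<open>f\<close> in the closed ball,
    hence closed and bounded.\<close>
  have "S = cball w \<delta> \<inter> f -` {f u}"
  proof (intro equalityI subsetI)
    fix x assume x: "x \<in> S"
    then have "f x = f u" using uS by (auto simp: S_def intro: antisym)
    then show "x \<in> cball w \<delta> \<inter> f -` {f u}" using x sub by blast
  next
    fix x assume "x \<in> cball w \<delta> \<inter> f -` {f u}"
    then show "x \<in> S" using D glob by (auto simp: S_def)
  qed
  moreover have "closed (cball w \<delta> \<inter> f -` {f u})"
    using continuous_on_closed_vimage[of "cball w \<delta>" f] cont by (simp add: Int_commute)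
  ultimately show "compact S"
    by (metis bounded_cball bounded_subset compact_eq_bounded_closed inf_le1)
qed

section \<open>Taylor remainders of the exponential and the logarithm\<close>

text \<open>The mean value inequality on the symmetric interval of radius
  \<open>\<bar>x\<bar>\<close>, which handles both signs of \<open>x\<close> at once. Its repeated
  use raises the order of a Taylor remainder by one each time.\<close>

lemma remainder_bound_from_derivative:
  fixes h h' :: "real \<Rightarrow> real"
  assumes "\<And>y. \<bar>y\<bar> \<le> \<bar>x\<bar> \<Longrightarrow> (h has_real_derivative h' y) (at y)"
    and "\<And>y. \<bar>y\<bar> \<le> \<bar>x\<bar> \<Longrightarrow> \<bar>h' y\<bar> \<le> B" and "h 0 = 0"
  shows "\<bar>h x\<bar> \<le> B * \<bar>x\<bar>"
proof -
  have "norm (h x - h 0) \<le> B * norm (x - 0)"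
  proof (rule field_differentiable_bound[of "{-\<bar>x\<bar>..\<bar>x\<bar>}" h h'])
    fix y assume "y \<in> {-\<bar>x\<bar>..\<bar>x\<bar>}"
    then have y: "\<bar>y\<bar> \<le> \<bar>x\<bar>" by auto
    show "(h has_field_derivative h' y) (at y within {- \<bar>x\<bar>..\<bar>x\<bar>})"
      using assms(1)[OF y] by (rule has_field_derivative_at_within)
    show "norm (h' y) \<le> B" using assms(2)[OF y] by simp
  qed auto
  then show ?thesis using assms(3) by simp
qed

lemma abs_exp_minus_1_le: "\<bar>exp x - 1\<bar> \<le> \<bar>x\<bar> * exp \<bar>x\<bar>" for x :: real
proof -
  have "\<bar>exp x - 1\<bar> \<le> exp \<bar>x\<bar> * \<bar>x\<bar>"
    by (rule remainder_bound_from_derivative[of x "\<lambda>x. exp x - 1" exp])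
      (auto intro!: derivative_eq_intros)
  then show ?thesis by (simp add: mult.commute)
qed

text \<open>Each remainder is the derivative of the next one, so three applications of the mean
  value bound contribute one factor \<open>\<bar>x\<bar>\<close> each. The factor 1/6 of the sharp
  estimate is given away.\<close>

lemma exp_remainder_bound: "\<bar>exp x - 1 - x - x\<^sup>2 / 2\<bar> \<le> \<bar>x\<bar> ^ 3 * exp \<bar>x\<bar>" for x :: real
proof -
  have 1: "\<bar>exp x - 1\<bar> \<le> exp \<bar>x\<bar> * \<bar>x\<bar>" for x :: real
    using abs_exp_minus_1_le[of x] by (simp add: mult.commute)
  have 2: "\<bar>exp x - 1 - x\<bar> \<le> exp \<bar>x\<bar> * \<bar>x\<bar> * \<bar>x\<bar>" for x :: real
    by (rule remainder_bound_from_derivative[of x "\<lambda>x. exp x - 1 - x" "\<lambda>x. exp x - 1"])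
      (auto intro!: derivative_eq_intros order_trans[OF 1] mult_mono)
  have "\<bar>exp x - 1 - x - x\<^sup>2 / 2\<bar> \<le> exp \<bar>x\<bar> * \<bar>x\<bar> * \<bar>x\<bar> * \<bar>x\<bar>"
    by (rule remainder_bound_from_derivative[of x "\<lambda>x. exp x - 1 - x - x\<^sup>2 / 2" "\<lambda>x. exp x - 1 - x"])
      (auto intro!: derivative_eq_intros order_trans[OF 2] mult_mono)
  then show ?thesis by (simp add: power3_eq_cube mult_ac)
qed

text \<open>The derivative of the remainder is \<open>y^2 / (1 + y)\<close>; the restriction on
  \<open>x\<close> keeps the denominator at least \<open>1 / 2\<close>, which yields the constant
  \<open>2\<close>.\<close>

lemma ln_remainder_bound:
  fixes x :: real
  assumes "\<bar>x\<bar> \<le> 1 / 2"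
  shows "\<bar>ln (1 + x) - x + x\<^sup>2 / 2\<bar> \<le> 2 * \<bar>x\<bar> ^ 3"
proof -
  have "\<bar>ln (1 + x) - x + x\<^sup>2 / 2\<bar> \<le> (2 * x\<^sup>2) * \<bar>x\<bar>"
  proof (rule remainder_bound_from_derivative[of x _ "\<lambda>y. y\<^sup>2 / (1 + y)"])
    fix y :: real assume y: "\<bar>y\<bar> \<le> \<bar>x\<bar>"
    then have y1: "1 + y \<ge> 1 / 2" using assms by linarith
    show "((\<lambda>x. ln (1 + x) - x + x\<^sup>2 / 2) has_real_derivative y\<^sup>2 / (1 + y)) (at y)"
      using y1 by (auto intro!: derivative_eq_intros simp: field_simps power2_eq_square)
    have "y\<^sup>2 \<le> x\<^sup>2" using y by (simp add: abs_le_square_iff)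
    moreover have "y\<^sup>2 / (1 + y) \<le> y\<^sup>2 / (1 / 2)" using y1 by (intro divide_left_mono) auto
    ultimately show "\<bar>y\<^sup>2 / (1 + y)\<bar> \<le> 2 * x\<^sup>2" using y1 by simp
  qed simp
  then show ?thesis by (simp add: power3_eq_cube power2_eq_square mult_ac)
qed

lemma power_le_const_exp:
  fixes c :: real
  assumes "c > 0"
  shows "\<exists>C>0. \<forall>x\<ge>0. x ^ k \<le> C * exp (c * x)"
proof (cases "k = 0")
  case True
  then show ?thesis using assms by (intro exI[of _ 1]) auto
next
  case False
  show ?thesis
  \<comment> \<open>The constant results from raising \<open>z \<le> exp z\<close> at
    \<open>z = c * x / k\<close> to the power \<open>k\<close>.\<close>
  proof (intro exI[of _ "(real k / c) ^ k"] conjI allI impI)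
    show "(real k / c) ^ k > 0" using False assms by simp
    fix x :: real assume x: "x \<ge> 0"
    have "c * x / real k \<le> exp (c * x / real k)"
      using exp_ge_add_one_self[of "c * x / real k"] by linarith
    then have "(c * x / real k) ^ k \<le> exp (c * x / real k) ^ k"
      using x assms by (intro power_mono) auto
    also have "\<dots> = exp (c * x)" using False by (simp add: exp_of_nat_mult[symmetric])
    finally have "(real k / c) ^ k * (c * x / real k) ^ k \<le> (real k / c) ^ k * exp (c * x)"
      using assms by (intro mult_left_mono) auto
    moreover have "(real k / c) ^ k * (c * x / real k) ^ k = x ^ k"
      using False assms by (simp add: power_mult_distrib[symmetric])
    ultimately show "x ^ k \<le> (real k / c) ^ k * exp (c * x)" by simp
  qed
qed

text \<open>For \<open>W = (Y / exp (\<beta> \<bullet> X)) powr (- \<alpha>)\<close>, \<open>\<xi> = (ln W / \<alpha>, \<alpha> X)\<close> and \<open>e = (1 / \<alpha>, 0)\<close>, with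
  \<open>(\<alpha>, \<beta>)\<close> the true parameter, this is the log-likelihood ratio of the sample between the local
  parameter \<open>u\<close> and the true one.\<close>

definition local_loglik :: "'b::real_inner \<Rightarrow> nat \<Rightarrow> (nat \<Rightarrow> real) \<Rightarrow> (nat \<Rightarrow> 'b) \<Rightarrow> 'b \<Rightarrow> real" where
  "local_loglik e n W \<xi> u = real n * ln (1 + e \<bullet> u / sqrt (real n)) +
     (\<Sum>i<n. \<xi> i \<bullet> u / sqrt (real n) - W i * (exp (\<xi> i \<bullet> u / sqrt (real n)) - 1))"

text \<open>With \<open>e = stack (1 / \<alpha>, 0)\<close> the condition says that the shape
  parameter, \<alpha> times the displayed expression, is positive.\<close>

definition local_params :: "'b::real_inner \<Rightarrow> nat \<Rightarrow> 'b set" where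
  "local_params e n = {u. 1 + e \<bullet> u / sqrt (real n) > 0}"

text \<open>Logarithm of an affine function, plus affine functions, minus exponentials of affine
  functions with weights \<open>W i\<close>; nonnegativity of the weights gives the right
  curvature.\<close>

lemma concave_on_local_loglik:
  assumes "\<And>i. W i \<ge> 0"
  shows "concave_on (local_params e n) (local_loglik e n W \<xi>)"
proof -
  let ?s = "sqrt (real n)"
  have aff: "c + a \<bullet> (p *\<^sub>R x + q *\<^sub>R y) / ?s = p * (c + a \<bullet> x / ?s) + q * (c + a \<bullet> y / ?s)"
    if "p + q = 1" for a x y :: 'a and c p q
  proof -
    have "c = p * c + q * c" using that by (metis distrib_right mult_1)
    then show ?thesis by (simp add: inner_simps add_divide_distrib algebra_simps)
  qed
  show ?thesis
    unfolding concave_on_iff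
  proof (intro conjI ballI allI impI)
    show "convex (local_params e n)"
      unfolding convex_def local_params_def
    proof (intro ballI allI impI CollectI)
      fix x y p q assume *: "x \<in> {u. 0 < 1 + e \<bullet> u / ?s}" "y \<in> {u. 0 < 1 + e \<bullet> u / ?s}"
        "0 \<le> p" "0 \<le> q" "p + q = (1::real)"
      \<comment> \<open>One of the weights is positive, which keeps the inequality strict for the
        convex combination.\<close>
      have "p > 0 \<or> q > 0" using * by linarith
      then show "0 < 1 + e \<bullet> (p *\<^sub>R x + q *\<^sub>R y) / ?s"
        unfolding aff[OF *(5)] using * by (auto intro: add_pos_nonneg add_nonneg_pos)
    qed
    fix x y p q assume x: "x \<in> local_params e n" and y: "y \<in> local_params e n"
      and pq: "0 \<le> p" "0 \<le> q" "p + q = (1::real)"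
    have R: "N * (p * a + q * b) = p * (N * a) + q * (N * b)" for N a b :: real
      by (simp add: algebra_simps)
    define z where "z = p *\<^sub>R x + q *\<^sub>R y"
    have "ln (1 + e \<bullet> z / ?s) \<ge> p * ln (1 + e \<bullet> x / ?s) + q * ln (1 + e \<bullet> y / ?s)"
      using ln_concave x y pq unfolding z_def aff[OF pq(3)] concave_on_iff local_params_def by auto
    then have "real n * ln (1 + e \<bullet> z / ?s) \<ge> real n * (p * ln (1 + e \<bullet> x / ?s) + q * ln (1 + e \<bullet> y / ?s))"
      by (intro mult_left_mono) auto
    moreover have "(\<Sum>i<n. \<xi> i \<bullet> z / ?s - W i * (exp (\<xi> i \<bullet> z / ?s) - 1)) \<ge>
      (\<Sum>i<n. p * (\<xi> i \<bullet> x / ?s - W i * (exp (\<xi> i \<bullet> x / ?s) - 1)) +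
             q * (\<xi> i \<bullet> y / ?s - W i * (exp (\<xi> i \<bullet> y / ?s) - 1)))"
    proof (rule sum_mono)
      fix i
      have zi: "\<xi> i \<bullet> z / ?s = p * (\<xi> i \<bullet> x / ?s) + q * (\<xi> i \<bullet> y / ?s)"
        using aff[OF pq(3), of 0 "\<xi> i" x y] by (simp add: z_def)
      have "exp (\<xi> i \<bullet> z / ?s) \<le> p * exp (\<xi> i \<bullet> x / ?s) + q * exp (\<xi> i \<bullet> y / ?s)"
        using exp_convex pq unfolding zi convex_on_def real_scaleR_def by blast
      then have "W i * exp (\<xi> i \<bullet> z / ?s) \<le> W i * (p * exp (\<xi> i \<bullet> x / ?s) + q * exp (\<xi> i \<bullet> y / ?s))"
        using assms by (intro mult_left_mono)
      moreover have "W i = p * W i + q * W i" using pq by (metis distrib_right mult_1)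
      ultimately show "p * (\<xi> i \<bullet> x / ?s - W i * (exp (\<xi> i \<bullet> x / ?s) - 1)) +
             q * (\<xi> i \<bullet> y / ?s - W i * (exp (\<xi> i \<bullet> y / ?s) - 1))
          \<le> \<xi> i \<bullet> z / ?s - W i * (exp (\<xi> i \<bullet> z / ?s) - 1)"
        unfolding zi by (simp add: algebra_simps)
    qed
    ultimately show "p * local_loglik e n W \<xi> x + q * local_loglik e n W \<xi> y \<le> local_loglik e n W \<xi> (p *\<^sub>R x + q *\<^sub>R y)"
      unfolding local_loglik_def z_def[symmetric] sum.distrib sum_distrib_left[symmetric] R
      unfolding distrib_left by linarith
  qed
qed

lemma continuous_on_local_loglik:
  "n > 0 \<Longrightarrow> continuous_on (local_params e n) (local_loglik e n W \<xi>)"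
  unfolding local_loglik_def local_params_def by (intro continuous_intros) auto

text \<open>The linear terms add up to the normalized score, the quadratic ones to half the
  empirical information, and \<open>n\<close> cubic remainders of size \<open>n powr (-3/2)\<close>
  leave the factor \<open>1 / sqrt n\<close>. The hypothesis \<open>eK\<close> keeps the argument of
  the logarithm in the range of its remainder bound; \<open>dK\<close> bounds the exponent by
  \<open>d * norm (\<xi> i)\<close>, so that the resulting average depends on neither
  \<open>u\<close> nor \<open>K\<close>.\<close>

lemma local_loglik_quadratic_approx:
  fixes e :: "'b::real_inner" and \<xi> :: "nat \<Rightarrow> 'b"
  assumes n: "n > 0" and W: "\<And>i. W i \<ge> 0" and u: "norm u \<le> K"
    and eK: "norm e * K \<le> sqrt (real n) / 2" and dK: "K \<le> d * sqrt (real n)"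
  shows "\<bar>local_loglik e n W \<xi> u - (((1 / sqrt (real n)) *\<^sub>R (\<Sum>i<n. e + (1 - W i) *\<^sub>R \<xi> i)) \<bullet> u
      - ((e \<bullet> u)\<^sup>2 + (\<Sum>i<n. W i * (\<xi> i \<bullet> u)\<^sup>2) / real n) / 2)\<bar>
    \<le> (2 * (norm e * K) ^ 3 + K ^ 3 * ((\<Sum>i<n. W i * norm (\<xi> i) ^ 3 * exp (d * norm (\<xi> i))) / real n)) / sqrt (real n)"
proof -
  define s where "s = sqrt (real n)"
  have s: "s > 0" "s * s = real n" using n by (auto simp: s_def)
  have K: "K \<ge> 0" using u norm_ge_zero order_trans by blast
  define x where "x = e \<bullet> u / s"
  define r where "r y = exp y - 1 - y - y\<^sup>2 / 2" for y :: real
  define y where "y i = \<xi> i \<bullet> u / s" for i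
  have eu: "\<bar>e \<bullet> u\<bar> \<le> norm e * K"
    using Cauchy_Schwarz_ineq2[of e u] mult_left_mono[OF u norm_ge_zero[of e]] by linarith
  have x: "\<bar>x\<bar> \<le> 1 / 2" using eu eK s by (simp add: x_def s_def[symmetric] field_simps)
  have xp: "\<bar>x\<bar> \<le> norm e * K / s" using eu s by (simp add: x_def divide_right_mono)
  have split: "local_loglik e n W \<xi> u - (((1 / s) *\<^sub>R (\<Sum>i<n. e + (1 - W i) *\<^sub>R \<xi> i)) \<bullet> u
      - ((e \<bullet> u)\<^sup>2 + (\<Sum>i<n. W i * (\<xi> i \<bullet> u)\<^sup>2) / real n) / 2) =
      real n * (ln (1 + x) - x + x\<^sup>2 / 2) - (\<Sum>i<n. W i * r (y i))"
  proof -
    have 1: "((1 / s) *\<^sub>R (\<Sum>i<n. e + (1 - W i) *\<^sub>R \<xi> i)) \<bullet> u = real n * x + (\<Sum>i<n. (1 - W i) * y i)"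
      by (simp add: inner_simps inner_sum_left x_def y_def sum.distrib sum_divide_distrib add_divide_distrib)
    have 2: "(e \<bullet> u)\<^sup>2 = real n * x\<^sup>2"
      using s n by (simp add: x_def power_divide power2_eq_square[of s])
    have 3: "(\<Sum>i<n. W i * (\<xi> i \<bullet> u)\<^sup>2) / real n = (\<Sum>i<n. W i * (y i)\<^sup>2)"
      using s n by (simp add: y_def power_divide power2_eq_square[of s] sum_divide_distrib)
    have 4: "(\<Sum>i<n. y i - W i * (exp (y i) - 1)) =
        (\<Sum>i<n. (1 - W i) * y i) - (\<Sum>i<n. W i * (y i)\<^sup>2) / 2 - (\<Sum>i<n. W i * r (y i))"
      unfolding sum_divide_distrib sum_subtractf[symmetric]
      by (rule sum.cong) (auto simp: r_def algebra_simps)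
    show ?thesis
      unfolding 1 2 3 local_loglik_def s_def[symmetric] x_def[symmetric] y_def[symmetric] 4
      by (simp add: algebra_simps)
  qed
  have b1: "\<bar>real n * (ln (1 + x) - x + x\<^sup>2 / 2)\<bar> \<le> 2 * (norm e * K) ^ 3 / s"
  proof -
    have "\<bar>real n * (ln (1 + x) - x + x\<^sup>2 / 2)\<bar> \<le> real n * (2 * \<bar>x\<bar> ^ 3)"
      unfolding abs_mult using ln_remainder_bound[OF x] by (intro mult_mono) auto
    also have "\<dots> \<le> real n * (2 * (norm e * K / s) ^ 3)"
      using xp by (intro mult_left_mono power_mono) auto
    also have "\<dots> = 2 * (norm e * K) ^ 3 / s"
      using s(1) unfolding s(2)[symmetric] by (simp add: power_divide power3_eq_cube)
    finally show ?thesis .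
  qed
  have b2: "\<bar>\<Sum>i<n. W i * r (y i)\<bar> \<le> K ^ 3 * ((\<Sum>i<n. W i * norm (\<xi> i) ^ 3 * exp (d * norm (\<xi> i))) / real n) / s"
  proof -
    have "\<bar>\<Sum>i<n. W i * r (y i)\<bar> \<le> (\<Sum>i<n. \<bar>W i * r (y i)\<bar>)" by (rule sum_abs)
    also have "\<dots> \<le> (\<Sum>i<n. K ^ 3 * (W i * norm (\<xi> i) ^ 3 * exp (d * norm (\<xi> i))) / (s * s * s))"
    proof (rule sum_mono)
      fix i
      have "\<bar>y i\<bar> \<le> norm (\<xi> i) * K / s"
        using Cauchy_Schwarz_ineq2[of "\<xi> i" u] mult_left_mono[OF u norm_ge_zero[of "\<xi> i"]] s
        by (simp add: y_def divide_right_mono)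
      moreover have "norm (\<xi> i) * K / s \<le> d * norm (\<xi> i)"
        using mult_left_mono[OF dK norm_ge_zero[of "\<xi> i"]] s by (simp add: s_def[symmetric] field_simps)
      ultimately have y: "\<bar>y i\<bar> \<le> norm (\<xi> i) * K / s" "\<bar>y i\<bar> \<le> d * norm (\<xi> i)" by auto
      have "\<bar>W i * r (y i)\<bar> \<le> W i * (\<bar>y i\<bar> ^ 3 * exp \<bar>y i\<bar>)"
        unfolding abs_mult r_def using W[of i] exp_remainder_bound[of "y i"] by (intro mult_mono) auto
      also have "\<dots> \<le> W i * ((norm (\<xi> i) * K / s) ^ 3 * exp (d * norm (\<xi> i)))"
        using W[of i] y K s by (intro mult_left_mono mult_mono power_mono) auto
      also have "\<dots> = K ^ 3 * (W i * norm (\<xi> i) ^ 3 * exp (d * norm (\<xi> i))) / (s * s * s)"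
        by (simp add: power_divide power_mult_distrib power3_eq_cube)
      finally show "\<bar>W i * r (y i)\<bar> \<le> K ^ 3 * (W i * norm (\<xi> i) ^ 3 * exp (d * norm (\<xi> i))) / (s * s * s)" .
    qed
    also have "\<dots> = K ^ 3 * ((\<Sum>i<n. W i * norm (\<xi> i) ^ 3 * exp (d * norm (\<xi> i))) / real n) / s"
      unfolding s(2)[symmetric] by (simp add: sum_distrib_left sum_divide_distrib)
    finally show ?thesis .
  qed
  show ?thesis
    unfolding s_def[symmetric] split unfolding add_divide_distrib using b1 b2 by linarith
qed

section \<open>Maximizers of the local log-likelihood of a random sample\<close>

text \<open>The constant is the minimum of the form on the unit sphere, and homogeneity extends the
  bound to all vectors.\<close>

lemma positive_definite_lower_bound:
  fixes J :: "real^'n^'n"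
  assumes pos: "\<And>x. x \<noteq> 0 \<Longrightarrow> x \<bullet> (J *v x) > 0"
  obtains l where "l > 0" "\<And>x. x \<bullet> (J *v x) \<ge> l * (norm x)\<^sup>2"
proof -
  have "continuous_on (sphere 0 1) (\<lambda>x. x \<bullet> (J *v x))"
    by (intro continuous_intros linear_continuous_on matrix_vector_mul_bounded_linear)
  moreover have "sphere (0::real^'n) 1 \<noteq> {}" by simp
  ultimately obtain x0 where x0: "x0 \<in> sphere 0 1" "\<And>x. x \<in> sphere 0 1 \<Longrightarrow> x0 \<bullet> (J *v x0) \<le> x \<bullet> (J *v x)"
    using continuous_attains_inf[OF compact_sphere] by blast
  show thesis
  proof (rule that)
    have "x0 \<noteq> 0" using x0(1) by auto
    then show "x0 \<bullet> (J *v x0) > 0" by (rule pos)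
    fix x :: "real^'n"
    show "x \<bullet> (J *v x) \<ge> (x0 \<bullet> (J *v x0)) * (norm x)\<^sup>2"
    proof (cases "x = 0")
      case False
      define y where "y = (1 / norm x) *\<^sub>R x"
      have "y \<in> sphere 0 1" using False by (simp add: y_def)
      then have "x0 \<bullet> (J *v x0) \<le> y \<bullet> (J *v y)" by (rule x0)
      also have "y \<bullet> (J *v y) = x \<bullet> (J *v x) / (norm x)\<^sup>2"
        by (simp add: y_def matrix_vector_mult_scaleR power2_eq_square)
      finally show ?thesis using False by (simp add: field_simps)
    qed simp
  qed
qed

text \<open>In the application, \<open>W\<close> is standard exponential and \<open>\<xi>\<close> is a function of \<open>W\<close> and the
  covariates, which are independent of \<open>W\<close>. Only the information identities \<open>score\<close>, \<open>cov\<close> and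
  \<open>hess\<close> are needed.\<close>

locale exponential_local_model = prob_space M for M :: "'a measure" +
  fixes W :: "nat \<Rightarrow> 'a \<Rightarrow> real" and \<xi> :: "nat \<Rightarrow> 'a \<Rightarrow> real^'n"
    and e :: "real^'n" and J :: "real^'n^'n" and d :: real
  assumes indep: "indep_vars (\<lambda>_. borel) (\<lambda>i \<omega>. (W i \<omega>, \<xi> i \<omega>)) UNIV"
    and ident: "\<And>i. distr M borel (\<lambda>\<omega>. (W i \<omega>, \<xi> i \<omega>)) = distr M borel (\<lambda>\<omega>. (W 0 \<omega>, \<xi> 0 \<omega>))"
    and W_nonneg: "\<And>i \<omega>. \<omega> \<in> space M \<Longrightarrow> W i \<omega> \<ge> 0"
    and d: "d > 0"
    and int: "integrable M (\<lambda>\<omega>. (1 + (W 0 \<omega>)\<^sup>2) * exp (d * norm (\<xi> 0 \<omega>)))"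
    and score: "\<And>t. expectation (\<lambda>\<omega>. (1 - W 0 \<omega>) * (t \<bullet> \<xi> 0 \<omega>)) = - (t \<bullet> e)"
    and cov: "\<And>t. expectation (\<lambda>\<omega>. (t \<bullet> (e + (1 - W 0 \<omega>) *\<^sub>R \<xi> 0 \<omega>))\<^sup>2) = t \<bullet> (J *v t)"
    and hess: "\<And>t. (t \<bullet> e)\<^sup>2 + expectation (\<lambda>\<omega>. W 0 \<omega> * (t \<bullet> \<xi> 0 \<omega>)\<^sup>2) = t \<bullet> (J *v t)"
    and J: "transpose J = J" "\<And>x. x \<noteq> 0 \<Longrightarrow> x \<bullet> (J *v x) > 0"
begin

lemma rv_pair: "(\<lambda>\<omega>. (W i \<omega>, \<xi> i \<omega>)) \<in> borel_measurable M"
  using indep by (simp add: indep_vars_def)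

lemma rv_W[measurable]: "W i \<in> borel_measurable M"
  using measurable_compose[OF rv_pair borel_measurable_continuous_onI[of fst]] by (simp add: continuous_intros)

lemma rv_\<xi>[measurable]: "\<xi> i \<in> borel_measurable M"
  using measurable_compose[OF rv_pair borel_measurable_continuous_onI[of snd]] by (simp add: continuous_intros)

lemma indep_fun:
  assumes "f \<in> borel_measurable borel"
  shows "indep_vars (\<lambda>_. borel) (\<lambda>i \<omega>. f (W i \<omega>, \<xi> i \<omega>)) UNIV"
  by (rule indep_vars_compose2[OF indep]) (use assms in auto)

lemma ident_fun:
  assumes f: "f \<in> borel_measurable borel"
  shows "distr M borel (\<lambda>\<omega>. f (W i \<omega>, \<xi> i \<omega>)) = distr M borel (\<lambda>\<omega>. f (W 0 \<omega>, \<xi> 0 \<omega>))"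
proof -
  have "distr M borel (\<lambda>\<omega>. f (W j \<omega>, \<xi> j \<omega>)) = distr (distr M borel (\<lambda>\<omega>. (W j \<omega>, \<xi> j \<omega>))) borel f" for j
    by (subst distr_distr[OF f rv_pair]) (simp add: comp_def)
  then show ?thesis using ident[of i] by simp
qed

section \<open>Moments of the score and of the remainder\<close>

text \<open>A common dominating function. Half of the available rate \<open>d\<close> pays for the
  power of the norm; the other half stays for the exponential factor of the squared
  remainder.\<close>

definition envelope where
  "envelope k \<omega> = (1 + (W 0 \<omega>)\<^sup>2) * norm (\<xi> 0 \<omega>) ^ k * exp (d / 2 * norm (\<xi> 0 \<omega>))"

lemma integrable_envelope: "integrable M (envelope k)"
proof -
  obtain C where C: "C > 0" "\<And>x. x \<ge> 0 \<Longrightarrow> x ^ k \<le> C * exp (d / 2 * x)"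
    using power_le_const_exp[of "d / 2" k] d by auto
  show ?thesis
  proof (rule integrable_of_abs_le)
    show "integrable M (\<lambda>\<omega>. C * ((1 + (W 0 \<omega>)\<^sup>2) * exp (d * norm (\<xi> 0 \<omega>))))"
      using int by simp
    show "envelope k \<in> borel_measurable M" unfolding envelope_def by measurable
    fix \<omega>
    have "norm (\<xi> 0 \<omega>) ^ k * exp (d / 2 * norm (\<xi> 0 \<omega>)) \<le>
        C * exp (d / 2 * norm (\<xi> 0 \<omega>)) * exp (d / 2 * norm (\<xi> 0 \<omega>))"
      using C by (intro mult_right_mono) auto
    also have "\<dots> = C * exp (d * norm (\<xi> 0 \<omega>))"
      by (simp add: exp_add[symmetric])
    finally have "(1 + (W 0 \<omega>)\<^sup>2) * (norm (\<xi> 0 \<omega>) ^ k * exp (d / 2 * norm (\<xi> 0 \<omega>))) \<le>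
        (1 + (W 0 \<omega>)\<^sup>2) * (C * exp (d * norm (\<xi> 0 \<omega>)))"
      by (intro mult_left_mono) auto
    then show "\<bar>envelope k \<omega>\<bar> \<le> C * ((1 + (W 0 \<omega>)\<^sup>2) * exp (d * norm (\<xi> 0 \<omega>)))"
      by (simp add: envelope_def abs_mult mult_ac)
  qed
qed

lemma envelope_ge: "(1 + (W 0 \<omega>)\<^sup>2) * norm (\<xi> 0 \<omega>) ^ k \<le> envelope k \<omega>"
  using mult_left_mono[of 1 "exp (d / 2 * norm (\<xi> 0 \<omega>))" "(1 + (W 0 \<omega>)\<^sup>2) * norm (\<xi> 0 \<omega>) ^ k"] d
  by (simp add: envelope_def)

text \<open>The contribution of one observation to the gradient of \<open>local_loglik\<close> at
  zero, up to the factor \<open>1 / sqrt n\<close>.\<close>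

definition score_vec where "score_vec i \<omega> = e + (1 - W i \<omega>) *\<^sub>R \<xi> i \<omega>"

definition influence where "influence i \<omega> = matrix_inv J *v score_vec i \<omega>"

text \<open>The maximizer of the quadratic approximation. It depends on the true parameter and
  serves as the point of comparison for the actual maximizers.\<close>

definition estimator where
  "estimator n \<omega> = (1 / sqrt (real n)) *\<^sub>R (\<Sum>i<n. influence i \<omega>)"

lemma mv_measurable[measurable]: "(*v) B \<in> borel_measurable borel" for B :: "real^'n^'n"
  by (intro borel_measurable_continuous_onI linear_continuous_on matrix_vector_mul_bounded_linear)

lemma score_vec_measurable[measurable]: "score_vec i \<in> borel_measurable M"
  unfolding score_vec_def by measurable

lemma influence_fun_measurable:
  "(\<lambda>p. matrix_inv J *v (e + (1 - fst p) *\<^sub>R snd p)) \<in> borel_measurable borel"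
  by (intro borel_measurable_continuous_onI continuous_intros
    bounded_linear.continuous_on[OF matrix_vector_mul_bounded_linear])

lemma influence_measurable[measurable]: "influence i \<in> borel_measurable M"
  unfolding influence_def by measurable

lemma influence_indep: "indep_vars (\<lambda>_. borel) influence UNIV"
  using indep_fun[OF influence_fun_measurable] unfolding influence_def score_vec_def by simp

lemma influence_ident: "distr M borel (influence i) = distr M borel (influence 0)"
  using ident_fun[OF influence_fun_measurable] unfolding influence_def score_vec_def by simp

text \<open>The constants come from using \<open>(a + b)^2 \<le> 2 * a^2 + 2 * b^2\<close> twice,
  for the sum defining the score and for \<open>1 - W 0 \<omega>\<close>.\<close>

lemma norm_score_vec_square: "(norm (score_vec 0 \<omega>))\<^sup>2 \<le> 2 * (norm e)\<^sup>2 + 4 * envelope 2 \<omega>"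
proof -
  have sq: "(a + b)\<^sup>2 \<le> 2 * a\<^sup>2 + 2 * b\<^sup>2" for a b :: real
    using zero_le_power2[of "a - b"] by (simp add: power2_sum power2_diff)
  have "norm (score_vec 0 \<omega>) \<le> norm e + \<bar>1 - W 0 \<omega>\<bar> * norm (\<xi> 0 \<omega>)"
    unfolding score_vec_def by (rule order_trans[OF norm_triangle_ineq]) simp
  then have "(norm (score_vec 0 \<omega>))\<^sup>2 \<le> (norm e + \<bar>1 - W 0 \<omega>\<bar> * norm (\<xi> 0 \<omega>))\<^sup>2"
    by (intro power_mono) auto
  also have "\<dots> \<le> 2 * (norm e)\<^sup>2 + 2 * ((1 - W 0 \<omega>)\<^sup>2 * (norm (\<xi> 0 \<omega>))\<^sup>2)"
    using sq[of "norm e" "\<bar>1 - W 0 \<omega>\<bar> * norm (\<xi> 0 \<omega>)"] by (simp add: power_mult_distrib)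
  also have "(1 - W 0 \<omega>)\<^sup>2 * (norm (\<xi> 0 \<omega>))\<^sup>2 \<le> (2 * (1 + (W 0 \<omega>)\<^sup>2)) * (norm (\<xi> 0 \<omega>))\<^sup>2"
    using sq[of 1 "- W 0 \<omega>"] by (intro mult_right_mono) auto
  also have "\<dots> \<le> 2 * envelope 2 \<omega>"
    using envelope_ge[of \<omega> 2] by (simp only: mult.assoc)
  finally show ?thesis by simp
qed

lemma influence_square_integrable: "integrable M (\<lambda>\<omega>. (norm (influence 0 \<omega>))\<^sup>2)"
proof -
  obtain K where K: "\<And>x. norm (matrix_inv J *v x) \<le> norm x * K"
    using bounded_linear.bounded[OF matrix_vector_mul_bounded_linear[of "matrix_inv J"]] by blast
  show ?thesis
  proof (rule integrable_of_abs_le)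
    show "integrable M (\<lambda>\<omega>. K\<^sup>2 * (2 * (norm e)\<^sup>2 + 4 * envelope 2 \<omega>))"
      by (intro integrable_mult_right Bochner_Integration.integrable_add integrable_const integrable_envelope)
    fix \<omega>
    have "(norm (influence 0 \<omega>))\<^sup>2 \<le> (norm (score_vec 0 \<omega>) * K)\<^sup>2"
      unfolding influence_def by (intro power_mono K) simp
    also have "\<dots> = K\<^sup>2 * (norm (score_vec 0 \<omega>))\<^sup>2" by (simp add: power_mult_distrib)
    also have "\<dots> \<le> K\<^sup>2 * (2 * (norm e)\<^sup>2 + 4 * envelope 2 \<omega>)"
      by (intro mult_left_mono norm_score_vec_square) simp
    finally show "\<bar>(norm (influence 0 \<omega>))\<^sup>2\<bar> \<le> K\<^sup>2 * (2 * (norm e)\<^sup>2 + 4 * envelope 2 \<omega>)" by simp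
  qed simp
qed

lemma inner_influence: "t \<bullet> influence i \<omega> = (matrix_inv J *v t) \<bullet> score_vec i \<omega>"
  unfolding influence_def
  using inner_matrix_vector_mult[of t "matrix_inv J" "score_vec i \<omega>"] positive_definite_inverse(2)[OF J] by simp

lemma influence_mean: "expectation (\<lambda>\<omega>. t \<bullet> influence 0 \<omega>) = 0"
proof -
  define s where "s = matrix_inv J *v t"
  have i: "integrable M (\<lambda>\<omega>. (1 - W 0 \<omega>) * (s \<bullet> \<xi> 0 \<omega>))"
  proof (rule integrable_of_abs_le)
    show "integrable M (\<lambda>\<omega>. 2 * norm s * envelope 1 \<omega>)" by (intro integrable_mult_right integrable_envelope)
    fix \<omega>
    have "(W 0 \<omega>)\<^sup>2 + 1 + 2 * W 0 \<omega> \<ge> 0" "(W 0 \<omega>)\<^sup>2 + 1 - 2 * W 0 \<omega> \<ge> 0"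
      using zero_le_power2[of "W 0 \<omega> - 1"] zero_le_power2[of "W 0 \<omega> + 1"]
      unfolding power2_sum power2_diff by simp_all
    then have "\<bar>1 - W 0 \<omega>\<bar> \<le> 2 * (1 + (W 0 \<omega>)\<^sup>2)"
      using zero_le_power2[of "W 0 \<omega>"] by (intro abs_leI; argo)
    then have "\<bar>1 - W 0 \<omega>\<bar> * \<bar>s \<bullet> \<xi> 0 \<omega>\<bar> \<le> 2 * (1 + (W 0 \<omega>)\<^sup>2) * (norm s * norm (\<xi> 0 \<omega>))"
      by (intro mult_mono Cauchy_Schwarz_ineq2) auto
    also have "\<dots> \<le> 2 * norm s * envelope 1 \<omega>"
      using mult_left_mono[OF envelope_ge[of \<omega> 1], of "2 * norm s"] by (simp add: mult_ac)
    finally show "\<bar>(1 - W 0 \<omega>) * (s \<bullet> \<xi> 0 \<omega>)\<bar> \<le> 2 * norm s * envelope 1 \<omega>"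
      unfolding abs_mult .
  qed simp
  have "expectation (\<lambda>\<omega>. t \<bullet> influence 0 \<omega>) = expectation (\<lambda>\<omega>. s \<bullet> e + (1 - W 0 \<omega>) * (s \<bullet> \<xi> 0 \<omega>))"
    unfolding inner_influence s_def[symmetric] score_vec_def by (simp add: inner_simps)
  also have "\<dots> = 0" using i by (simp add: score prob_space)
  finally show ?thesis .
qed

text \<open>The covariance of the score is \<open>J\<close> itself, so the sandwich of
  \<open>J\<close> between two copies of its inverse collapses to one inverse.\<close>

lemma influence_cov: "expectation (\<lambda>\<omega>. (t \<bullet> influence 0 \<omega>)\<^sup>2) = t \<bullet> (matrix_inv J *v t)"
proof -
  have "expectation (\<lambda>\<omega>. (t \<bullet> influence 0 \<omega>)\<^sup>2) = (matrix_inv J *v t) \<bullet> (J *v (matrix_inv J *v t))"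
    unfolding inner_influence score_vec_def by (rule cov)
  also have "J *v (matrix_inv J *v t) = t"
    by (simp add: matrix_vector_mul_assoc positive_definite_inverse(1)[OF J])
  finally show ?thesis by (simp add: inner_commute)
qed

definition maximizers where
  "maximizers n \<omega> = {u \<in> local_params e n. \<forall>v\<in>local_params e n.
     local_loglik e n (\<lambda>i. W i \<omega>) (\<lambda>i. \<xi> i \<omega>) v \<le> local_loglik e n (\<lambda>i. W i \<omega>) (\<lambda>i. \<xi> i \<omega>) u}"

lemma quadratic_form_sum: "(x \<bullet> u)\<^sup>2 = (\<Sum>j\<in>UNIV. \<Sum>k\<in>UNIV. u $ j * u $ k * (x $ j * x $ k))"
  for x u :: "real^'n"
  by (simp add: power2_eq_square inner_vec_def sum_product mult_ac)

text \<open>The weak law is stated for square integrable variables; squaring raises the degree in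
  \<xi> to four.\<close>

lemma hessian_entry_square_integrable:
  "integrable M (\<lambda>\<omega>. (W 0 \<omega> * (\<xi> 0 \<omega> $ j * \<xi> 0 \<omega> $ k))\<^sup>2)"
proof (rule integrable_of_abs_le[OF integrable_envelope[of 4]])
  show "(\<lambda>\<omega>. (W 0 \<omega> * (\<xi> 0 \<omega> $ j * \<xi> 0 \<omega> $ k))\<^sup>2) \<in> borel_measurable M"
    by (simp add: cart_eq_inner_axis)
  fix \<omega>
  have "(\<xi> 0 \<omega> $ j)\<^sup>2 \<le> (norm (\<xi> 0 \<omega>))\<^sup>2" for j
    using component_le_norm_cart[of "\<xi> 0 \<omega>" j] by (metis abs_le_square_iff abs_norm_cancel)
  then have "(\<xi> 0 \<omega> $ j)\<^sup>2 * (\<xi> 0 \<omega> $ k)\<^sup>2 \<le> (norm (\<xi> 0 \<omega>))\<^sup>2 * (norm (\<xi> 0 \<omega>))\<^sup>2"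
    by (intro mult_mono) auto
  also have "\<dots> = norm (\<xi> 0 \<omega>) ^ 4" by (simp add: power2_eq_square power4_eq_xxxx)
  finally have "(W 0 \<omega>)\<^sup>2 * ((\<xi> 0 \<omega> $ j)\<^sup>2 * (\<xi> 0 \<omega> $ k)\<^sup>2) \<le> (1 + (W 0 \<omega>)\<^sup>2) * norm (\<xi> 0 \<omega>) ^ 4"
    by (intro mult_mono) auto
  also have "\<dots> \<le> envelope 4 \<omega>" by (rule envelope_ge)
  finally show "\<bar>(W 0 \<omega> * (\<xi> 0 \<omega> $ j * \<xi> 0 \<omega> $ k))\<^sup>2\<bar> \<le> envelope 4 \<omega>"
    by (simp add: power_mult_distrib)
qed

text \<open>The rate \<open>d / 4\<close> is the largest whose doubling by the square still fits the
  rate \<open>d / 2\<close> in \<open>envelope\<close>; it is the value of \<open>d\<close> at which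
  the quadratic approximation is used.\<close>

lemma remainder_square_integrable:
  "integrable M (\<lambda>\<omega>. (W 0 \<omega> * norm (\<xi> 0 \<omega>) ^ 3 * exp (d / 4 * norm (\<xi> 0 \<omega>)))\<^sup>2)"
proof (rule integrable_of_abs_le[OF integrable_envelope[of 6]])
  fix \<omega>
  have "(W 0 \<omega> * norm (\<xi> 0 \<omega>) ^ 3 * exp (d / 4 * norm (\<xi> 0 \<omega>)))\<^sup>2 =
      (W 0 \<omega>)\<^sup>2 * (norm (\<xi> 0 \<omega>) ^ 6 * exp (d / 2 * norm (\<xi> 0 \<omega>)))"
    by (simp add: power_mult_distrib power_mult[symmetric] exp_of_nat_mult[symmetric])
  also have "\<dots> \<le> (1 + (W 0 \<omega>)\<^sup>2) * (norm (\<xi> 0 \<omega>) ^ 6 * exp (d / 2 * norm (\<xi> 0 \<omega>)))"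
    by (intro mult_right_mono) auto
  finally show "\<bar>(W 0 \<omega> * norm (\<xi> 0 \<omega>) ^ 3 * exp (d / 4 * norm (\<xi> 0 \<omega>)))\<^sup>2\<bar> \<le> envelope 6 \<omega>"
    by (simp add: envelope_def mult.assoc)
qed simp

text \<open>Written in entries, uniform control of the empirical form over a ball reduces to
  finitely many averages of scalar variables.\<close>

lemma hessian_form:
  "u \<bullet> (J *v u) = (e \<bullet> u)\<^sup>2 +
     (\<Sum>j\<in>UNIV. \<Sum>k\<in>UNIV. u $ j * u $ k * expectation (\<lambda>\<omega>. W 0 \<omega> * (\<xi> 0 \<omega> $ j * \<xi> 0 \<omega> $ k)))"
proof -
  have i: "integrable M (\<lambda>\<omega>. W 0 \<omega> * (\<xi> 0 \<omega> $ j * \<xi> 0 \<omega> $ k))" for j k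
    by (rule square_integrable_imp_integrable[OF _ hessian_entry_square_integrable])
      (simp add: cart_eq_inner_axis)
  have "expectation (\<lambda>\<omega>. W 0 \<omega> * (u \<bullet> \<xi> 0 \<omega>)\<^sup>2) =
      expectation (\<lambda>\<omega>. \<Sum>j\<in>UNIV. \<Sum>k\<in>UNIV. u $ j * u $ k * (W 0 \<omega> * (\<xi> 0 \<omega> $ j * \<xi> 0 \<omega> $ k)))"
    unfolding inner_commute[of u] quadratic_form_sum by (simp add: sum_distrib_left mult_ac)
  also have "\<dots> = (\<Sum>j\<in>UNIV. \<Sum>k\<in>UNIV. u $ j * u $ k * expectation (\<lambda>\<omega>. W 0 \<omega> * (\<xi> 0 \<omega> $ j * \<xi> 0 \<omega> $ k)))"
    using i by (simp add: Bochner_Integration.integral_sum)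
  finally show ?thesis using hess[of u] by (simp add: inner_commute)
qed

section \<open>Localization of the maximizers\<close>

text \<open>The deterministic part of the argument, for one sample point. From the estimator to the
  sphere of radius \<delta> the quadratic function \<open>q\<close> drops by at least
  \<open>l * \<delta>^2 / 2\<close>, which is four times \<rho>. Since \<open>F\<close> and
  \<open>q\<close> differ by at most \<rho> in the ball of radius \<open>K\<close>, the drop of
  \<open>F\<close> is still at least \<open>2 * \<rho>\<close>.\<close>

lemma maximizers_near_estimator:
  assumes \<omega>: "\<omega> \<in> space M" and \<delta>: "\<delta> > 0" and l: "l > 0" "\<And>x. x \<bullet> (J *v x) \<ge> l * (norm x)\<^sup>2"
    and w: "norm (estimator n \<omega>) \<le> K - \<delta>" and n: "n > 0"
    and eK: "norm e * K \<le> sqrt (real n) / 4" and dK: "K \<le> d / 4 * sqrt (real n)"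
    and \<rho>: "\<rho> = l * \<delta>\<^sup>2 / 8"
    and L: "(\<Sum>i<n. W i \<omega> * norm (\<xi> i \<omega>) ^ 3 * exp (d / 4 * norm (\<xi> i \<omega>))) / real n \<le> L"
    and small: "(2 * (norm e * K) ^ 3 + K ^ 3 * L) / sqrt (real n) \<le> \<rho> / 2"
    and \<tau>: "\<And>j k. \<bar>(\<Sum>i<n. W i \<omega> * (\<xi> i \<omega> $ j * \<xi> i \<omega> $ k)) / real n -
        expectation (\<lambda>\<omega>. W 0 \<omega> * (\<xi> 0 \<omega> $ j * \<xi> 0 \<omega> $ k))\<bar> \<le> \<tau>"
      "K\<^sup>2 * (real CARD('n))\<^sup>2 * \<tau> \<le> \<rho>"
  shows "maximizers n \<omega> \<noteq> {}" "compact (maximizers n \<omega>)" "maximizers n \<omega> \<subseteq> cball (estimator n \<omega>) \<delta>"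
proof -
  define F where "F = local_loglik e n (\<lambda>i. W i \<omega>) (\<lambda>i. \<xi> i \<omega>)"
  define w where "w = estimator n \<omega>"
  define U where "U = (1 / sqrt (real n)) *\<^sub>R (\<Sum>i<n. e + (1 - W i \<omega>) *\<^sub>R \<xi> i \<omega>)"
  have wU: "w = matrix_inv J *v U"
    unfolding w_def estimator_def influence_def U_def score_vec_def
    by (simp add: linear_sum[OF matrix_vector_mul_linear] linear_cmul[OF matrix_vector_mul_linear])
  have U: "U = J *v w"
    unfolding wU by (simp add: matrix_vector_mul_assoc positive_definite_inverse(1)[OF J])
  define q where "q u = U \<bullet> u - u \<bullet> (J *v u) / 2" for u
  have sym: "x \<bullet> (J *v y) = (J *v x) \<bullet> y" for x y
    using inner_matrix_vector_mult[of x J y] J(1) by simp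
  \<comment> \<open>Completing the square: \<open>U = J *v w\<close> makes \<open>w\<close> the
    vertex of \<open>q\<close>.\<close>
  have q_diff: "q b = q w - (b - w) \<bullet> (J *v (b - w)) / 2" for b
  proof -
    have "(J *v w) \<bullet> b = (J *v b) \<bullet> w"
      using sym[of w b] by (simp add: inner_commute)
    then show ?thesis
      unfolding q_def U by (simp add: matrix_vector_mult_diff_distrib inner_diff_left inner_diff_right sym diff_divide_distrib add_divide_distrib)
  qed
  have K: "K \<ge> 0" using w norm_ge_zero[of "estimator n \<omega>"] \<delta> by linarith
  have s: "sqrt (real n) > 0" using n by simp
  have eK2: "norm e * K \<le> sqrt (real n) / 2" using eK s by linarith
  have approx: "\<bar>F u - q u\<bar> \<le> \<rho>" if u: "norm u \<le> K" for u
  proof -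
    let ?Q = "(e \<bullet> u)\<^sup>2 + (\<Sum>i<n. W i \<omega> * (\<xi> i \<omega> \<bullet> u)\<^sup>2) / real n"
    have "\<bar>F u - (U \<bullet> u - ?Q / 2)\<bar> \<le> (2 * (norm e * K) ^ 3 +
        K ^ 3 * ((\<Sum>i<n. W i \<omega> * norm (\<xi> i \<omega>) ^ 3 * exp (d / 4 * norm (\<xi> i \<omega>))) / real n)) / sqrt (real n)"
      unfolding F_def U_def
      by (rule local_loglik_quadratic_approx) (use n W_nonneg[OF \<omega>] u eK2 dK in auto)
    also have "\<dots> \<le> (2 * (norm e * K) ^ 3 + K ^ 3 * L) / sqrt (real n)"
      using L K s by (intro divide_right_mono add_left_mono mult_left_mono) auto
    also have "\<dots> \<le> \<rho> / 2" by (rule small)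
    finally have 1: "\<bar>F u - (U \<bullet> u - ?Q / 2)\<bar> \<le> \<rho> / 2" .
    \<comment> \<open>The information error has \<open>CARD('n)^2\<close> entries, each multiplied
      by at most \<open>K^2\<close> in absolute value, hence is at most \<rho>. It enters
      \<open>F - q\<close> with the factor \<open>1 / 2\<close>; the cubic remainder takes the other
      half of \<rho>.\<close>
    have "?Q - u \<bullet> (J *v u) = (\<Sum>j\<in>UNIV. \<Sum>k\<in>UNIV. u $ j * u $ k * ((\<Sum>i<n. W i \<omega> * (\<xi> i \<omega> $ j * \<xi> i \<omega> $ k)) / real n -
        expectation (\<lambda>\<omega>. W 0 \<omega> * (\<xi> 0 \<omega> $ j * \<xi> 0 \<omega> $ k))))"
    proof -
      have "(\<Sum>i<n. W i \<omega> * (\<xi> i \<omega> \<bullet> u)\<^sup>2) / real n =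
          (\<Sum>i<n. \<Sum>j\<in>UNIV. \<Sum>k\<in>UNIV. u $ j * u $ k * (W i \<omega> * (\<xi> i \<omega> $ j * \<xi> i \<omega> $ k)) / real n)"
        unfolding quadratic_form_sum by (simp add: sum_distrib_left sum_divide_distrib mult_ac)
      also have "\<dots> = (\<Sum>j\<in>UNIV. \<Sum>k\<in>UNIV. \<Sum>i<n. u $ j * u $ k * (W i \<omega> * (\<xi> i \<omega> $ j * \<xi> i \<omega> $ k)) / real n)"
        by (subst sum.swap, intro sum.cong refl, rule sum.swap)
      finally show ?thesis
        unfolding hessian_form by (simp add: right_diff_distrib sum_subtractf sum_distrib_left sum_divide_distrib)
    qed
    also have "\<bar>\<dots>\<bar> \<le> (\<Sum>j\<in>(UNIV :: 'n set). \<Sum>k\<in>(UNIV :: 'n set). K\<^sup>2 * \<tau>)"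
    proof (rule order_trans[OF sum_abs], rule sum_mono, rule order_trans[OF sum_abs], rule sum_mono)
      fix j k
      have "\<bar>u $ j * u $ k\<bar> \<le> K * K"
        unfolding abs_mult using u K component_le_norm_cart[of u] by (intro mult_mono) (auto intro: order_trans)
      then show "\<bar>u $ j * u $ k * ((\<Sum>i<n. W i \<omega> * (\<xi> i \<omega> $ j * \<xi> i \<omega> $ k)) / real n -
          expectation (\<lambda>\<omega>. W 0 \<omega> * (\<xi> 0 \<omega> $ j * \<xi> 0 \<omega> $ k)))\<bar> \<le> K\<^sup>2 * \<tau>"
        unfolding abs_mult[of "u $ j * u $ k"] power2_eq_square using \<tau>(1)[of j k] K by (intro mult_mono) auto
    qed
    also have "\<dots> = K\<^sup>2 * (real CARD('n))\<^sup>2 * \<tau>" by (simp add: power2_eq_square)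
    also have "\<dots> \<le> \<rho>" by (rule \<tau>)
    finally have "\<bar>?Q - u \<bullet> (J *v u)\<bar> \<le> \<rho>" .
    moreover have "\<bar>f - (a - Q / 2)\<bar> \<le> r / 2 \<Longrightarrow> \<bar>Q - b\<bar> \<le> r \<Longrightarrow> \<bar>f - (a - b / 2)\<bar> \<le> r"
      for f a b Q r :: real by argo
    ultimately show ?thesis using 1 unfolding q_def by blast
  qed
  have conc: "concave_on (local_params e n) F"
    unfolding F_def by (rule concave_on_local_loglik) (rule W_nonneg[OF \<omega>])
  \<comment> \<open>The margin \<delta> in the hypothesis on the estimator keeps the whole ball in
    the region of norm at most \<open>K\<close>, where the approximation is available.\<close>
  have inK: "norm b \<le> K" if "b \<in> cball w \<delta>" for b
  proof -
    have "norm b \<le> norm w + dist w b" by (metis dist_norm norm_triangle_sub norm_minus_commute)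
    then show ?thesis using that \<open>norm (estimator n \<omega>) \<le> K - \<delta>\<close> by (simp add: w_def)
  qed
  have sub: "cball w \<delta> \<subseteq> local_params e n"
  proof
    fix b assume "b \<in> cball w \<delta>"
    then have "norm e * norm b \<le> norm e * K" using inK by (intro mult_left_mono) auto
    then have "\<bar>e \<bullet> b\<bar> \<le> sqrt (real n) / 4"
      using Cauchy_Schwarz_ineq2[of e b] eK by linarith
    then have "- (1 / 4) \<le> e \<bullet> b / sqrt (real n)"
      using s by (simp add: field_simps abs_le_iff)
    then show "b \<in> local_params e n" unfolding local_params_def by simp
  qed
  have cont: "continuous_on (cball w \<delta>) F"
    unfolding F_def by (rule continuous_on_subset[OF continuous_on_local_loglik[OF n] sub])
  have sphere: "F b < F w" if b: "dist w b = \<delta>" for b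
  proof -
    have "norm (b - w) = \<delta>" using b by (simp add: dist_norm norm_minus_commute)
    then have "l * \<delta>\<^sup>2 \<le> (b - w) \<bullet> (J *v (b - w))" using l(2)[of "b - w"] by simp
    then have "q b \<le> q w - 4 * \<rho>" unfolding q_diff[of b] \<rho> by simp
    moreover have "\<bar>F b - q b\<bar> \<le> \<rho>" "\<bar>F w - q w\<bar> \<le> \<rho>"
      using b \<delta> by (auto intro!: approx inK)
    moreover have "\<rho> > 0" using \<delta> l(1) by (simp add: \<rho>)
    ultimately show ?thesis by linarith
  qed
  note * = concave_maximizers_in_ball[OF conc \<delta> sub cont sphere]
  show "maximizers n \<omega> \<noteq> {}" "compact (maximizers n \<omega>)" "maximizers n \<omega> \<subseteq> cball (estimator n \<omega>) \<delta>"
    using * unfolding maximizers_def F_def[symmetric] w_def[symmetric] by auto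
qed

lemma estimator_measurable[measurable]: "estimator n \<in> borel_measurable M"
  unfolding estimator_def by measurable

definition localized where
  "localized n K \<delta> \<omega> \<longleftrightarrow> norm (estimator n \<omega>) \<le> K \<and> maximizers n \<omega> \<noteq> {} \<and>
     compact (maximizers n \<omega>) \<and> maximizers n \<omega> \<subseteq> cball (estimator n \<omega>) \<delta>"

text \<open>Measurability of the event described by \<open>localized\<close>, which speaks of a
  whole set of maximizers, is avoided by providing a measurable event inside it. It is the
  complement of three bad events: a large estimator, a large remainder average, and a deviating
  information entry, each with a third of \<epsilon>. The radius \<open>K\<close> does not depend on
  \<open>n\<close>.\<close>

lemma maximizers_near_estimator_eventually:
  assumes \<delta>: "\<delta> > 0" and \<epsilon>: "\<epsilon> > 0"
  obtains K where "K > 0" "\<forall>\<^sub>F n in sequentially.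
    \<exists>G\<in>events. prob (space M - G) \<le> \<epsilon> \<and> (\<forall>\<omega>\<in>G. localized n K \<delta> \<omega>)"
proof -
  obtain l where l: "l > 0" "\<And>x. x \<bullet> (J *v x) \<ge> l * (norm x)\<^sup>2"
    using positive_definite_lower_bound[OF J(2)] by blast
  obtain K0 where K0: "K0 > 0" "\<And>n. n > 0 \<Longrightarrow> prob {\<omega> \<in> space M. norm (estimator n \<omega>) > K0} \<le> \<epsilon> / 3"
    using prob_norm_normalized_sum_gt[OF influence_indep influence_ident influence_square_integrable
        influence_mean, of "\<epsilon> / 3"] \<epsilon> unfolding estimator_def by auto
  \<comment> \<open>\<open>K0\<close> bounds the estimator; the extra \<delta> makes room for the
    ball around it.\<close>
  define K where "K = K0 + \<delta>"
  have K: "K > 0" using K0 \<delta> by (simp add: K_def)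
  define \<rho> where "\<rho> = l * \<delta>\<^sup>2 / 8"
  have \<rho>: "\<rho> > 0" using l \<delta> by (simp add: \<rho>_def)
  define N where "N = (real CARD('n))\<^sup>2"
  have N: "N > 0" by (simp add: N_def)
  \<comment> \<open>The tolerance per entry: \<open>N\<close> entries with weights up to
    \<open>K^2\<close> then contribute exactly \<rho>.\<close>
  define \<tau> where "\<tau> = \<rho> / (K\<^sup>2 * N)"
  have \<tau>: "\<tau> > 0" "K\<^sup>2 * N * \<tau> \<le> \<rho>" using \<rho> K N by (auto simp: \<tau>_def)
  define h where "h i \<omega> = W i \<omega> * norm (\<xi> i \<omega>) ^ 3 * exp (d / 4 * norm (\<xi> i \<omega>))" for i \<omega>
  define H where "H j k i \<omega> = W i \<omega> * (\<xi> i \<omega> $ j * \<xi> i \<omega> $ k)" for j k i \<omega>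
  have [measurable]: "h i \<in> borel_measurable M" for i unfolding h_def by measurable
  have [measurable]: "H j k i \<in> borel_measurable M" for j k i
    unfolding H_def by (simp add: cart_eq_inner_axis)
  have fh: "(\<lambda>p::real \<times> (real^'n). fst p * norm (snd p) ^ 3 * exp (d / 4 * norm (snd p))) \<in> borel_measurable borel"
    by (intro borel_measurable_continuous_onI continuous_intros)
  have fH: "(\<lambda>p::real \<times> (real^'n). fst p * (snd p $ j * snd p $ k)) \<in> borel_measurable borel" for j k
    by (intro borel_measurable_continuous_onI continuous_intros)
  \<comment> \<open>The weak law with tolerance \<open>1\<close> keeps the remainder average below
    its mean plus one.\<close>
  define L where "L = expectation (h 0) + 1"
  define A where "A n = {\<omega> \<in> space M. norm (estimator n \<omega>) > K0}" for n
  define B where "B n = {\<omega> \<in> space M. \<bar>(\<Sum>i<n. h i \<omega>) / real n - expectation (h 0)\<bar> \<ge> 1}" for n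
  define D where "D j k n = {\<omega> \<in> space M. \<bar>(\<Sum>i<n. H j k i \<omega>) / real n - expectation (H j k 0)\<bar> \<ge> \<tau>}" for j k n
  define G where "G n = space M - (A n \<union> B n \<union> (\<Union>p\<in>UNIV. D (fst p) (snd p) n))" for n
  have ev: "A n \<in> events" "B n \<in> events" "D j k n \<in> events" for n j k
    unfolding A_def B_def D_def by measurable
  have Gev: "G n \<in> events" for n
    unfolding G_def using ev by (intro sets.Diff sets.Un sets.finite_UN) auto
  have "(\<lambda>n. prob (B n)) \<longlonglongrightarrow> 0"
    unfolding B_def
    by (rule weak_law_of_large_numbers)
      (use indep_fun[OF fh] ident_fun[OF fh] remainder_square_integrable in \<open>auto simp: h_def\<close>)
  then have evB: "\<forall>\<^sub>F n in sequentially. prob (B n) < \<epsilon> / 3"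
    by (rule order_tendstoD) (use \<epsilon> in simp)
  have "(\<lambda>n. prob (D j k n)) \<longlonglongrightarrow> 0" for j k
    unfolding D_def
    by (rule weak_law_of_large_numbers)
      (use indep_fun[OF fH] ident_fun[OF fH] hessian_entry_square_integrable \<tau> in \<open>auto simp: H_def\<close>)
  \<comment> \<open>Every one of the \<open>N\<close> index pairs gets an equal share of
    \<open>\<epsilon> / 3\<close>.\<close>
  then have "\<forall>\<^sub>F n in sequentially. prob (D j k n) < \<epsilon> / 3 / N" for j k
    by (rule order_tendstoD) (use \<epsilon> N in simp)
  then have evD: "\<forall>\<^sub>F n in sequentially. \<forall>p\<in>UNIV. prob (D (fst p) (snd p) n) < \<epsilon> / 3 / N"
    by (intro eventually_ball_finite) auto
  have sq: "filterlim (\<lambda>n. sqrt (real n)) at_top sequentially"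
    by (rule filterlim_compose[OF sqrt_at_top filterlim_real_sequentially])
  have evs: "\<forall>\<^sub>F n in sequentially. sqrt (real n) \<ge> c" for c
    using sq by (simp add: filterlim_at_top)
  show thesis
  proof (rule that[OF K0(1)])
    \<comment> \<open>The three lower bounds required of \<open>sqrt (real n)\<close> are the
      conditions named \<open>2\<close>, \<open>3\<close> and \<open>4\<close> below, solved for
      \<open>sqrt (real n)\<close>.\<close>
    show "\<forall>\<^sub>F n in sequentially. \<exists>G\<in>events. prob (space M - G) \<le> \<epsilon> \<and> (\<forall>\<omega>\<in>G. localized n K0 \<delta> \<omega>)"
      using evB evD evs[of "4 * norm e * K"] evs[of "4 * K / d"]
        evs[of "2 * (2 * (norm e * K) ^ 3 + K ^ 3 * L) / \<rho>"] eventually_gt_at_top[of 0]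
    proof eventually_elim
      case (elim n)
      show ?case
      proof (intro bexI[of _ "G n"] conjI ballI)
        show "G n \<in> events" by (rule Gev)
        have "space M - G n \<subseteq> A n \<union> B n \<union> (\<Union>p\<in>UNIV. D (fst p) (snd p) n)" unfolding G_def by blast
        then have "prob (space M - G n) \<le> prob (A n \<union> B n \<union> (\<Union>p\<in>UNIV. D (fst p) (snd p) n))"
          using ev by (intro finite_measure_mono sets.Un sets.finite_UN) auto
        also have "\<dots> \<le> prob (A n) + prob (B n) + (\<Sum>p\<in>UNIV. prob (D (fst p) (snd p) n))"
          using ev by (intro order_trans[OF measure_Un_le] add_mono measure_UNION_le order_refl sets.Un sets.finite_UN) auto
        also have "(\<Sum>p\<in>(UNIV :: ('n \<times> 'n) set). prob (D (fst p) (snd p) n)) \<le> (\<Sum>p\<in>(UNIV :: ('n \<times> 'n) set). \<epsilon> / 3 / N)"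
          using elim(2) by (intro sum_mono) (auto intro: less_imp_le)
        also have "\<dots> = \<epsilon> / 3" by (simp add: N_def power2_eq_square)
        also have "prob (A n) + prob (B n) + \<epsilon> / 3 \<le> \<epsilon>"
          using K0(2)[OF elim(6), folded A_def] elim(1) by simp
        finally show "prob (space M - G n) \<le> \<epsilon>" by simp
      next
        fix \<omega> assume "\<omega> \<in> G n"
        then have \<omega>: "\<omega> \<in> space M" and "\<omega> \<notin> A n" "\<omega> \<notin> B n" and nD: "\<omega> \<notin> D j k n" for j k
          by (auto simp: G_def)
        then have w: "norm (estimator n \<omega>) \<le> K0" and b: "(\<Sum>i<n. h i \<omega>) / real n \<le> L"
          by (auto simp: A_def B_def L_def)
        have dD: "\<bar>(\<Sum>i<n. H j k i \<omega>) / real n - expectation (H j k 0)\<bar> \<le> \<tau>" for j k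
          using nD[of j k] \<omega> by (simp add: D_def)
        have 1: "norm (estimator n \<omega>) \<le> K - \<delta>" using w by (simp add: K_def)
        have 2: "norm e * K \<le> sqrt (real n) / 4" using elim(3) by simp
        have 3: "K \<le> d / 4 * sqrt (real n)" using elim(4) d by (simp add: field_simps)
        have 4: "(2 * (norm e * K) ^ 3 + K ^ 3 * L) / sqrt (real n) \<le> \<rho> / 2"
          using elim(5) \<rho> elim(6) by (simp add: field_simps)
        note max = maximizers_near_estimator[OF \<omega> \<delta> l 1 elim(6) 2 3 \<rho>_def
          b[unfolded h_def] 4 dD[unfolded H_def] \<tau>(2)[unfolded N_def]]
        show "localized n K0 \<delta> \<omega>" unfolding localized_def using w max by blast
      qed
    qed
  qed
qed

end

section \<open>Moments of the standard exponential distribution\<close>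

text \<open>One \<eta> pays for the power and one for the factor with the absolute value, so the
  rates \<open>r + 2 * \<eta>\<close> and \<open>r - 2 * \<eta>\<close> must still lie in the
  interval of integrability.\<close>

lemma integrable_power_exp:
  fixes Z :: "'a \<Rightarrow> real"
  assumes Z[measurable]: "Z \<in> borel_measurable M"
    and int: "\<And>r. a < r \<Longrightarrow> r < b \<Longrightarrow> integrable M (\<lambda>x. exp (r * Z x))"
    and \<eta>: "\<eta> > 0" "a < r - 2 * \<eta>" "r + 2 * \<eta> < b"
  shows "integrable M (\<lambda>x. \<bar>Z x\<bar> ^ j * exp (r * Z x + \<eta> * \<bar>Z x\<bar>))"
proof -
  obtain C where C: "C > 0" "\<And>x. x \<ge> 0 \<Longrightarrow> x ^ j \<le> C * exp (\<eta> * x)"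
    using power_le_const_exp[OF \<eta>(1), of j] by auto
  show ?thesis
  proof (rule integrable_of_abs_le)
    show "integrable M (\<lambda>x. C * (exp ((r + 2 * \<eta>) * Z x) + exp ((r - 2 * \<eta>) * Z x)))"
      using \<eta> by (intro integrable_mult_right Bochner_Integration.integrable_add int) auto
    fix x
    have "\<bar>Z x\<bar> ^ j * exp (r * Z x + \<eta> * \<bar>Z x\<bar>) \<le> C * exp (\<eta> * \<bar>Z x\<bar>) * exp (r * Z x + \<eta> * \<bar>Z x\<bar>)"
      using C by (intro mult_right_mono) auto
    also have "\<dots> = C * exp (r * Z x + 2 * \<eta> * \<bar>Z x\<bar>)" by (simp add: exp_add[symmetric])
    also have "\<dots> \<le> C * (exp ((r + 2 * \<eta>) * Z x) + exp ((r - 2 * \<eta>) * Z x))"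
      using C(1) by (intro mult_left_mono) (cases "Z x \<ge> 0"; simp add: algebra_simps add_increasing add_increasing2)+
    finally show "\<bar>\<bar>Z x\<bar> ^ j * exp (r * Z x + \<eta> * \<bar>Z x\<bar>)\<bar> \<le> C * (exp ((r + 2 * \<eta>) * Z x) + exp ((r - 2 * \<eta>) * Z x))"
      by (simp add: abs_mult power_abs)
  qed simp
qed

text \<open>Differentiation under the integral by dominated convergence along sequences of
  increments; difference quotients of the exponential are dominated by
  \<open>\<bar>Z x\<bar> * exp (\<eta> * \<bar>Z x\<bar>)\<close>.\<close>

lemma integral_power_exp_has_derivative:
  fixes Z :: "'a \<Rightarrow> real"
  assumes Z[measurable]: "Z \<in> borel_measurable M"
    and int: "\<And>r. a < r \<Longrightarrow> r < b \<Longrightarrow> integrable M (\<lambda>x. exp (r * Z x))"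
    and s: "a < s" "s < b"
  shows "integrable M (\<lambda>x. Z x ^ j * exp (s * Z x))"
    and "((\<lambda>r. LINT x|M. Z x ^ j * exp (r * Z x)) has_real_derivative (LINT x|M. Z x ^ Suc j * exp (s * Z x))) (at s)"
proof -
  have i: "integrable M (\<lambda>x. Z x ^ j * exp (r * Z x))" if r: "a < r" "r < b" for r
  proof -
    define \<eta> where "\<eta> = min (r - a) (b - r) / 4"
    have "4 * \<eta> \<le> r - a" "4 * \<eta> \<le> b - r" "\<eta> > 0" using r by (simp_all add: \<eta>_def)
    then have \<eta>: "\<eta> > 0" "a < r - 2 * \<eta>" "r + 2 * \<eta> < b" by linarith+
    show ?thesis
      by (rule Bochner_Integration.integrable_bound[OF integrable_power_exp[OF Z int \<eta>, of j]])
        (use \<eta>(1) in \<open>auto simp: abs_mult power_abs intro!: mult_left_mono\<close>)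
  qed
  show "integrable M (\<lambda>x. Z x ^ j * exp (s * Z x))" by (rule i[OF s])
  define \<eta> where "\<eta> = min (s - a) (b - s) / 4"
  have "4 * \<eta> \<le> s - a" "4 * \<eta> \<le> b - s" "\<eta> > 0" using s by (simp_all add: \<eta>_def)
  then have \<eta>: "\<eta> > 0" "a < s - 2 * \<eta>" "s + 2 * \<eta> < b" by linarith+
  define F where "F r = (LINT x|M. Z x ^ j * exp (r * Z x))" for r
  define D where "D = (LINT x|M. Z x ^ Suc j * exp (s * Z x))"
  have "(\<lambda>k. (F (s + X k) - F s) / X k) \<longlonglongrightarrow> D" if X: "\<And>k. X k \<noteq> 0" "X \<longlonglongrightarrow> 0" for X :: "nat \<Rightarrow> real"
  proof -
    \<comment> \<open>Increments that are too large are replaced by \<eta>. Only finitely many terms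
      change, and the domination holds for every \<open>k\<close>.\<close>
    define X' where "X' k = (if \<bar>X k\<bar> < \<eta> then X k else \<eta>)" for k
    have X': "X' k \<noteq> 0" "\<bar>X' k\<bar> \<le> \<eta>" for k using X \<eta> by (auto simp: X'_def)
    have "\<forall>\<^sub>F k in sequentially. dist (X k) 0 < \<eta>" using X(2) \<eta>(1) by (rule tendstoD)
    then have evX: "\<forall>\<^sub>F k in sequentially. X' k = X k" by eventually_elim (simp add: X'_def)
    have X'0: "X' \<longlonglongrightarrow> 0" using tendsto_cong[OF evX, of 0] X(2) by simp
    define u where "u k x = Z x ^ j * exp (s * Z x) * ((exp (X' k * Z x) - 1) / X' k)" for k x
    have "(\<lambda>k. LINT x|M. u k x) \<longlonglongrightarrow> D"
      unfolding D_def
    proof (rule integral_dominated_convergence)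
      show "integrable M (\<lambda>x. \<bar>Z x\<bar> ^ Suc j * exp (s * Z x + \<eta> * \<bar>Z x\<bar>))"
        by (rule integrable_power_exp[OF Z int \<eta>])
      show "AE x in M. (\<lambda>k. u k x) \<longlonglongrightarrow> Z x ^ Suc j * exp (s * Z x)"
      proof (rule AE_I2)
        fix x
        have "((\<lambda>r. exp (r * Z x)) has_real_derivative Z x) (at 0)"
          by (auto intro!: derivative_eq_intros)
        then have "((\<lambda>h. (exp (h * Z x) - 1) / h) \<longlongrightarrow> Z x) (at 0)"
          by (simp add: DERIV_def)
        then have "((\<lambda>h. (exp (h * Z x) - 1) / h) \<circ> X') \<longlonglongrightarrow> Z x"
          unfolding tendsto_at_iff_sequentially using X'(1) X'0 by simp
        then have "(\<lambda>k. Z x ^ j * exp (s * Z x) * ((exp (X' k * Z x) - 1) / X' k)) \<longlonglongrightarrow> Z x ^ j * exp (s * Z x) * Z x"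
          unfolding comp_def by (intro tendsto_mult tendsto_const)
        then show "(\<lambda>k. u k x) \<longlonglongrightarrow> Z x ^ Suc j * exp (s * Z x)"
          unfolding u_def by (simp add: mult_ac)
      qed
      fix k
      show "AE x in M. norm (u k x) \<le> \<bar>Z x\<bar> ^ Suc j * exp (s * Z x + \<eta> * \<bar>Z x\<bar>)"
      proof (rule AE_I2)
        fix x
        have "\<bar>exp (X' k * Z x) - 1\<bar> \<le> \<bar>X' k * Z x\<bar> * exp \<bar>X' k * Z x\<bar>"
          by (rule abs_exp_minus_1_le)
        also have "\<dots> \<le> \<bar>X' k * Z x\<bar> * exp (\<eta> * \<bar>Z x\<bar>)"
          using X'(2)[of k] by (intro mult_left_mono) (auto simp: abs_mult mult_right_mono)
        finally have "\<bar>(exp (X' k * Z x) - 1) / X' k\<bar> \<le> \<bar>Z x\<bar> * exp (\<eta> * \<bar>Z x\<bar>)"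
          using X'(1)[of k] by (simp add: abs_mult abs_divide field_simps)
        then have "\<bar>Z x\<bar> ^ j * exp (s * Z x) * \<bar>(exp (X' k * Z x) - 1) / X' k\<bar> \<le>
            \<bar>Z x\<bar> ^ j * exp (s * Z x) * (\<bar>Z x\<bar> * exp (\<eta> * \<bar>Z x\<bar>))"
          by (intro mult_left_mono) auto
        then show "norm (u k x) \<le> \<bar>Z x\<bar> ^ Suc j * exp (s * Z x + \<eta> * \<bar>Z x\<bar>)"
          by (simp add: u_def abs_mult power_abs exp_add mult_ac)
      qed
    qed (simp_all add: u_def)
    moreover have "(LINT x|M. u k x) = (F (s + X' k) - F s) / X' k" for k
    proof -
      have in1: "a < s + X' k" "s + X' k < b" using X'(2)[of k] \<eta> by linarith+
      have "u k x = (Z x ^ j * exp ((s + X' k) * Z x) - Z x ^ j * exp (s * Z x)) / X' k" for x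
        by (simp add: u_def distrib_right exp_add algebra_simps)
      then show ?thesis
        unfolding F_def using i[OF in1] i[OF s] by simp
    qed
    ultimately have "(\<lambda>k. (F (s + X' k) - F s) / X' k) \<longlonglongrightarrow> D" by simp
    then show ?thesis
      by (rule Lim_transform_eventually) (use evX in \<open>auto elim!: eventually_mono\<close>)
  qed
  then have "((\<lambda>h. (F (s + h) - F s) / h) \<longlongrightarrow> D) (at 0)"
    unfolding tendsto_at_iff_sequentially comp_def by auto
  then show "((\<lambda>r. LINT x|M. Z x ^ j * exp (r * Z x)) has_real_derivative (LINT x|M. Z x ^ Suc j * exp (s * Z x))) (at s)"
    unfolding DERIV_def F_def D_def .
qed

section \<open>Powers and logarithms under the exponential law\<close>

abbreviation std_exponential :: "real measure" where
  "std_exponential \<equiv> density lborel (\<lambda>x. ennreal (exponential_density 1 x))"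

lemma prob_space_std_exponential: "prob_space std_exponential"
  by (rule prob_space_exponential_density) simp

lemma std_exponential_pos: "AE w in std_exponential. w > 0"
proof -
  have "AE w in lborel. w \<noteq> (0::real)" by (rule AE_lborel_singleton)
  then show ?thesis
    by (subst AE_density) (auto simp: exponential_density_def elim!: eventually_mono)
qed

text \<open>Euler's integral. Writing the power as \<open>exp (r * ln w)\<close> exhibits the Gamma
  function as the moment generating function of the logarithm, in the form required for
  differentiation in \<open>r\<close>.\<close>

lemma has_bochner_integral_std_exponential_powr:
  assumes "r > -1"
  shows "has_bochner_integral std_exponential (\<lambda>w. exp (r * ln w)) (Gamma (1 + r))"
proof (rule has_bochner_integral_nn_integral)
  have "(\<integral>\<^sup>+w. ennreal (exp (r * ln w)) \<partial>std_exponential) =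
      (\<integral>\<^sup>+w. ennreal (exponential_density 1 w) * ennreal (exp (r * ln w)) \<partial>lborel)"
    by (rule nn_integral_density) auto
  also have "\<dots> = (\<integral>\<^sup>+w. ennreal (indicator {0..} w * (w powr (1 + r - 1) / exp w)) \<partial>lborel)"
  proof (rule nn_integral_cong_AE)
    have "AE w in lborel. w \<noteq> (0::real)" by (rule AE_lborel_singleton)
    then show "AE w in lborel. ennreal (exponential_density 1 w) * ennreal (exp (r * ln w)) =
        ennreal (indicator {0..} w * (w powr (1 + r - 1) / exp w))"
    proof eventually_elim
      case (elim w)
      then show ?case
        by (auto simp: exponential_density_def powr_def exp_minus field_simps indicator_def ennreal_mult'[symmetric])
    qed
  qed
  also have "\<dots> = ennreal (Gamma (1 + r))"
    by (rule nn_integral_has_integral_lebesgue[OF _ Gamma_integral_real]) (use assms in auto)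
  finally show "(\<integral>\<^sup>+w. ennreal (exp (r * ln w)) \<partial>std_exponential) = ennreal (Gamma (1 + r))" .
qed (use assms in \<open>auto intro!: Gamma_real_nonneg\<close>)

text \<open>Each derivative in \<open>r\<close> brings down one factor \<open>ln w\<close>.
  Uniqueness of derivatives identifies the results with those of \<open>Gamma\<close> and of
  \<open>Gamma\<close> times \<open>Digamma\<close>.\<close>

lemma integral_std_exponential_power_ln:
  fixes r :: real
  assumes r: "r > -1"
  shows "integrable std_exponential (\<lambda>w. ln w ^ j * exp (r * ln w))"
    and "(LINT w|std_exponential. exp (r * ln w)) = Gamma (1 + r)"
    and "(LINT w|std_exponential. ln w * exp (r * ln w)) = Gamma (1 + r) * Digamma (1 + r)"
    and "(LINT w|std_exponential. (ln w)\<^sup>2 * exp (r * ln w)) =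
      Gamma (1 + r) * ((Digamma (1 + r))\<^sup>2 + Polygamma 1 (1 + r))"
proof -
  \<comment> \<open>The upper end \<open>r + 1\<close> only makes the interval of exponents bounded
    with \<open>r\<close> in its interior.\<close>
  have int: "integrable std_exponential (\<lambda>w. exp (q * ln w))" if "-1 < q" "q < r + 1" for q
    using has_bochner_integral_std_exponential_powr[OF that(1)] by (rule integrable.intros)
  have F0: "(LINT w|std_exponential. exp (q * ln w)) = Gamma (1 + q)" if "q > -1" for q
    using has_bochner_integral_std_exponential_powr[OF that] by (rule has_bochner_integral_integral_eq)
  have m: "ln \<in> borel_measurable std_exponential" by simp
  have der: "integrable std_exponential (\<lambda>w. ln w ^ j * exp (q * ln w))"
    "((\<lambda>q. LINT w|std_exponential. ln w ^ j * exp (q * ln w)) has_real_derivative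
      (LINT w|std_exponential. ln w ^ Suc j * exp (q * ln w))) (at q)" if "-1 < q" "q < r + 1" for q j
    using integral_power_exp_has_derivative[OF m, of "-1" "r + 1" q j] int that by blast+
  show "integrable std_exponential (\<lambda>w. ln w ^ j * exp (r * ln w))"
    by (rule der(1)) (use r in auto)
  show "(LINT w|std_exponential. exp (r * ln w)) = Gamma (1 + r)" by (rule F0[OF r])
  have nn: "1 + q \<notin> \<int>\<^sub>\<le>\<^sub>0" if "q > -1" for q :: real
    using that by (auto elim!: nonpos_Ints_cases)
  have F1: "(LINT w|std_exponential. ln w * exp (q * ln w)) = Gamma (1 + q) * Digamma (1 + q)"
    if q: "-1 < q" "q < r + 1" for q
  proof -
    have "((\<lambda>q. LINT w|std_exponential. exp (q * ln w)) has_real_derivative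
        (LINT w|std_exponential. ln w * exp (q * ln w))) (at q)"
      using der(2)[OF q, of 0] by simp
    then have "((\<lambda>q. Gamma (1 + q)) has_real_derivative (LINT w|std_exponential. ln w * exp (q * ln w))) (at q)"
      by (rule has_field_derivative_transform_within_open[of _ _ _ "{-1<..}"]) (use q F0 in auto)
    moreover have "((\<lambda>q. Gamma (1 + q)) has_real_derivative Gamma (1 + q) * Digamma (1 + q)) (at q)"
      using nn[OF q(1)] by (auto intro!: derivative_eq_intros)
    ultimately show ?thesis by (rule DERIV_unique)
  qed
  show "(LINT w|std_exponential. ln w * exp (r * ln w)) = Gamma (1 + r) * Digamma (1 + r)"
    by (rule F1) (use r in auto)
  have "((\<lambda>q. LINT w|std_exponential. ln w * exp (q * ln w)) has_real_derivative
      (LINT w|std_exponential. (ln w)\<^sup>2 * exp (r * ln w))) (at r)"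
    using der(2)[of r 1] r by (simp add: power2_eq_square)
  then have "((\<lambda>q. Gamma (1 + q) * Digamma (1 + q)) has_real_derivative
      (LINT w|std_exponential. (ln w)\<^sup>2 * exp (r * ln w))) (at r)"
    by (rule has_field_derivative_transform_within_open[of _ _ _ "{-1<..<r + 1}"]) (use r F1 in auto)
  moreover have "((\<lambda>q. Gamma (1 + q) * Digamma (1 + q)) has_real_derivative
      Gamma (1 + r) * ((Digamma (1 + r))\<^sup>2 + Polygamma 1 (1 + r))) (at r)"
    using nn[OF r] by (auto intro!: derivative_eq_intros simp: power2_eq_square algebra_simps)
  ultimately show "(LINT w|std_exponential. (ln w)\<^sup>2 * exp (r * ln w)) =
      Gamma (1 + r) * ((Digamma (1 + r))\<^sup>2 + Polygamma 1 (1 + r))"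
    by (rule DERIV_unique)
qed

text \<open>The defining series of the trigamma function at one is the Basel series.\<close>

lemma Polygamma_1_1: "Polygamma 1 (1::real) = pi\<^sup>2 / 6"
proof -
  have "(\<lambda>n. inverse ((1 + real n) ^ 2)) sums (pi\<^sup>2 / 6)"
    using inverse_squares_sums by (simp add: inverse_eq_divide add.commute)
  moreover have "(\<lambda>n. inverse ((1 + real n) ^ 2)) sums Polygamma 1 1"
    using Polygamma_LIMSEQ[of "1::real" 1] by (simp add: numeral_2_eq_2)
  ultimately show ?thesis by (rule sums_unique2[symmetric])
qed

text \<open>Almost everywhere \<open>w ^ k\<close> equals \<open>exp (k * ln w)\<close>, so these
  are the integrals above at \<open>r = 0, 1, 2\<close>. The recurrences express
  \<open>Gamma\<close>, \<open>Digamma\<close> and \<open>Polygamma 1\<close> at two and three by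
  their values at one.\<close>

lemma
  shows integrable_std_exponential_moment: "integrable std_exponential (\<lambda>w. w ^ k * ln w ^ j)"
    and integral_std_exponential:
      "(LINT w|std_exponential. w) = 1"
      "(LINT w|std_exponential. w\<^sup>2) = 2"
      "(LINT w|std_exponential. ln w) = - euler_mascheroni"
      "(LINT w|std_exponential. w * ln w) = 1 - euler_mascheroni"
      "(LINT w|std_exponential. w\<^sup>2 * ln w) = 3 - 2 * euler_mascheroni"
      "(LINT w|std_exponential. (ln w)\<^sup>2) = pi\<^sup>2 / 6 + euler_mascheroni\<^sup>2"
      "(LINT w|std_exponential. w * (ln w)\<^sup>2) = pi\<^sup>2 / 6 + (1 - euler_mascheroni)\<^sup>2 - 1"
      "(LINT w|std_exponential. w\<^sup>2 * (ln w)\<^sup>2) = 2 * (pi\<^sup>2 / 6 + (1 - euler_mascheroni)\<^sup>2 - euler_mascheroni)"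
proof -
  have AE: "AE w in std_exponential. ln w ^ j * exp (real k * ln w) = w ^ k * ln w ^ j" for j k
    using std_exponential_pos by eventually_elim (simp add: exp_of_nat_mult)
  have eq: "(LINT w|std_exponential. w ^ k * ln w ^ j) = (LINT w|std_exponential. ln w ^ j * exp (real k * ln w))" for j k
    by (rule integral_cong_AE) (use AE[of j k] in \<open>auto elim!: eventually_mono\<close>)
  have int: "integrable std_exponential (\<lambda>w. ln w ^ j * exp (real k * ln w))" for j k
    by (rule integral_std_exponential_power_ln(1)) simp
  show "integrable std_exponential (\<lambda>w. w ^ k * ln w ^ j)"
    by (rule integrable_cong_AE_imp[OF int[of j k]]) (use AE[of j k] in \<open>auto elim!: eventually_mono\<close>)
  have G: "Gamma (2::real) = 1" "Gamma (3::real) = 2"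
    using Gamma_fact[of 1, where 'a = real] Gamma_fact[of 2, where 'a = real] by (simp_all add: numeral_eq_Suc)
  have D: "Digamma (2::real) = 1 - euler_mascheroni" "Digamma (3::real) = 3 / 2 - euler_mascheroni"
    using Digamma_plus1[of "1::real"] Digamma_plus1[of "2::real"] by simp_all
  have P: "Polygamma 1 (2::real) = pi\<^sup>2 / 6 - 1" "Polygamma 1 (3::real) = pi\<^sup>2 / 6 - 5 / 4"
    using Polygamma_plus1[of "1::real" 1] Polygamma_plus1[of "2::real" 1] Polygamma_1_1 by simp_all
  note F = integral_std_exponential_power_ln(2,3,4)
  show "(LINT w|std_exponential. w) = 1" using eq[of 1 0] F(1)[of 1] G by simp
  show "(LINT w|std_exponential. w\<^sup>2) = 2" using eq[of 2 0] F(1)[of 2] G by simp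
  show "(LINT w|std_exponential. ln w) = - euler_mascheroni" using F(2)[of 0] by simp
  show "(LINT w|std_exponential. w * ln w) = 1 - euler_mascheroni"
    using eq[of 1 1] F(2)[of 1] G D by simp
  show "(LINT w|std_exponential. w\<^sup>2 * ln w) = 3 - 2 * euler_mascheroni"
    using eq[of 2 1] F(2)[of 2] G D by simp
  show "(LINT w|std_exponential. (ln w)\<^sup>2) = pi\<^sup>2 / 6 + euler_mascheroni\<^sup>2"
    using F(3)[of 0] Polygamma_1_1 by simp
  show "(LINT w|std_exponential. w * (ln w)\<^sup>2) = pi\<^sup>2 / 6 + (1 - euler_mascheroni)\<^sup>2 - 1"
    using eq[of 1 2] F(3)[of 1] G D P by simp
  show "(LINT w|std_exponential. w\<^sup>2 * (ln w)\<^sup>2) = 2 * (pi\<^sup>2 / 6 + (1 - euler_mascheroni)\<^sup>2 - euler_mascheroni)"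
    using eq[of 2 2] F(3)[of 2] G D P by (simp add: power2_eq_square algebra_simps)
qed

section \<open>The joint law of the Frechet regression model\<close>

lemma emeasure_std_exponential_ge:
  assumes "c \<ge> 0"
  shows "emeasure std_exponential {c..} = ennreal (exp (- c))"
proof -
  interpret E: prob_space std_exponential by (rule prob_space_std_exponential)
  have "distributed std_exponential lborel (\<lambda>w. w) (exponential_density 1)"
    unfolding distributed_def by (simp add: distr_id2 sets_eq_imp_space_eq)
  from E.exponential_distributedD_gt[OF this assms] have
    gt: "measure std_exponential {w. c < w} = exp (- c)" by simp
  have "AE w in lborel. w \<noteq> c" by (rule AE_lborel_singleton)
  then have "AE w in std_exponential. w \<noteq> c" by (subst AE_density) (auto elim!: eventually_mono)
  then have "measure std_exponential {c..} = measure std_exponential {w. c < w}"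
    by (intro E.finite_measure_eq_AE) (auto elim!: eventually_mono)
  then show ?thesis by (simp add: gt E.emeasure_eq_measure)
qed

text \<open>Half-lines suffice in the first coordinate, where the model provides a conditional
  distribution function; in the second one all Borel sets are kept, as tests for the conditional
  expectation.\<close>

lemma sets_pair_borel_generator:
  "sets (borel \<Otimes>\<^sub>M (borel :: 'b::topological_space measure)) =
    sigma_sets UNIV {a \<times> b | a b. a \<in> range (\<lambda>y::real. {..y}) \<and> b \<in> sets borel}"
proof -
  have "sets (borel \<Otimes>\<^sub>M (borel :: 'b measure)) =
      sets (sigma (space (borel :: real measure) \<times> space (borel :: 'b measure))
        {a \<times> b | a b. a \<in> range (\<lambda>y::real. {..y}) \<and> b \<in> sets borel})"
  proof (rule sets_pair_eq)
    show "sets (borel :: real measure) = sigma_sets (space borel) (range (\<lambda>y. {..y}))"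
      by (subst borel_eq_atMost) simp
    show "countable (range (\<lambda>n. {..real n}))" "range (\<lambda>n. {..real n}) \<subseteq> range (\<lambda>y. {..y})"
      "\<Union> (range (\<lambda>n. {..real n})) = space borel"
      using real_arch_simple by auto
    show "sets (borel :: 'b measure) = sigma_sets (space borel) (sets borel)"
      using sets.sigma_sets_eq[of "borel :: 'b measure"] by simp
    show "countable {UNIV :: 'b set}" "{UNIV} \<subseteq> sets (borel :: 'b measure)" "\<Union> {UNIV} = space (borel :: 'b measure)"
      by auto
  qed (use sets.space_closed in auto)
  then show ?thesis by (simp add: space_borel)
qed

text \<open>The defining property of the conditional expectation, tested on the event that
  \<open>X\<close> lies in \<open>B\<close>. Only one \<open>y\<close> is involved at a time, so
  exceptional null sets for different \<open>y\<close> never have to be combined.\<close>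

lemma (in prob_space) frechet_regression_joint_cdf:
  fixes X :: "'a \<Rightarrow> real^'p"
  assumes X[measurable]: "X \<in> borel_measurable M" and Y[measurable]: "Y \<in> borel_measurable M"
    and model: "frechet_regression M Y X (\<alpha>, \<beta>)" and y: "y > 0" and B: "B \<in> sets borel"
  shows "emeasure M {\<omega> \<in> space M. Y \<omega> \<le> y \<and> X \<omega> \<in> B} =
    (\<integral>\<^sup>+\<omega>. indicator B (X \<omega>) * ennreal (exp (- ((y / exp (\<beta> \<bullet> X \<omega>)) powr (- \<alpha>)))) \<partial>M)"
proof -
  define F where "F = vimage_algebra (space M) X borel"
  have sub: "subalgebra M F"
    unfolding subalgebra_def F_def using measurable_space[OF X]
    by (auto simp: in_vimage_algebra sets_vimage_algebra2 intro!: measurable_sets[OF X])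
  interpret F: finite_measure_subalgebra M F
    by standard (rule sub)
  define A where "A = X -` B \<inter> space M"
  have A: "A \<in> sets F" "A \<in> events"
    unfolding A_def F_def using B by (auto intro: in_vimage_algebra measurable_sets[OF X])
  define g where "g \<omega> = exp (- ((y / exp (\<beta> \<bullet> X \<omega>)) powr (- \<alpha>)))" for \<omega>
  have [measurable]: "g \<in> borel_measurable M" unfolding g_def by measurable
  have Ey[measurable]: "{\<omega> \<in> space M. Y \<omega> \<le> y} \<in> events" by measurable
  have AE: "AE \<omega> in M. real_cond_exp M F (indicator {\<omega> \<in> space M. Y \<omega> \<le> y}) \<omega> = g \<omega>"
    using model y unfolding frechet_regression_def F_def g_def by simp
  have int: "integrable M (indicator {\<omega> \<in> space M. Y \<omega> \<le> y} :: 'a \<Rightarrow> real)"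
    by (simp add: less_top[symmetric])
  have "prob {\<omega> \<in> space M. Y \<omega> \<le> y \<and> X \<omega> \<in> B} =
      (LINT \<omega>:A|M. indicator {\<omega> \<in> space M. Y \<omega> \<le> y} \<omega>)"
  proof -
    have "{\<omega> \<in> space M. Y \<omega> \<le> y \<and> X \<omega> \<in> B} = A \<inter> {\<omega> \<in> space M. Y \<omega> \<le> y}" by (auto simp: A_def)
    then show ?thesis
      using A(2) by (simp add: set_lebesgue_integral_def indicator_inter_arith[symmetric])
  qed
  also have "\<dots> = (LINT \<omega>:A|M. real_cond_exp M F (indicator {\<omega> \<in> space M. Y \<omega> \<le> y}) \<omega>)"
    by (rule F.real_cond_exp_intA[OF int A(1)])
  also have "\<dots> = (LINT \<omega>:A|M. g \<omega>)"
    unfolding set_lebesgue_integral_def using AE A(2)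
    by (intro integral_cong_AE) (auto elim!: eventually_mono)
  finally have p: "prob {\<omega> \<in> space M. Y \<omega> \<le> y \<and> X \<omega> \<in> B} = (LINT \<omega>|M. indicator A \<omega> * g \<omega>)"
    by (simp add: set_lebesgue_integral_def)
  have "integrable M (\<lambda>\<omega>. indicator A \<omega> * g \<omega>)"
    using A(2) by (intro integrable_const_bound[of _ 1]) (auto simp: g_def indicator_def)
  then have "(\<integral>\<^sup>+\<omega>. ennreal (indicator A \<omega> * g \<omega>) \<partial>M) = ennreal (LINT \<omega>|M. indicator A \<omega> * g \<omega>)"
    by (rule nn_integral_eq_integral) (auto simp: g_def)
  then have "emeasure M {\<omega> \<in> space M. Y \<omega> \<le> y \<and> X \<omega> \<in> B} = (\<integral>\<^sup>+\<omega>. ennreal (indicator A \<omega> * g \<omega>) \<partial>M)"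
    unfolding emeasure_eq_measure p by simp
  also have "\<dots> = (\<integral>\<^sup>+\<omega>. indicator B (X \<omega>) * ennreal (g \<omega>) \<partial>M)"
    by (intro nn_integral_cong) (auto simp: A_def indicator_def)
  finally show ?thesis unfolding g_def .
qed

text \<open>The map \<open>f\<close> solves
  \<open>w = exp (\<alpha> * (\<beta> \<bullet> x - ln y))\<close> for \<open>y\<close>. That it
  sends the product law to the law of \<open>(Y, X)\<close> can be checked on the sets
  \<open>{..y} \<times> B\<close>; the inverse map \<open>h\<close> then carries this identity over
  to the claim.\<close>

theorem (in prob_space) frechet_regression_joint_law:
  fixes X :: "'a \<Rightarrow> real^'p"
  assumes X[measurable]: "X \<in> borel_measurable M" and Y[measurable]: "Y \<in> borel_measurable M"
    and pos: "\<And>\<omega>. \<omega> \<in> space M \<Longrightarrow> Y \<omega> > 0"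
    and model: "frechet_regression M Y X (\<alpha>, \<beta>)" and \<alpha>: "\<alpha> > 0"
  shows "distr M (borel \<Otimes>\<^sub>M borel) (\<lambda>\<omega>. (exp (\<alpha> * (\<beta> \<bullet> X \<omega> - ln (Y \<omega>))), X \<omega>)) =
    std_exponential \<Otimes>\<^sub>M distr M borel X"
proof -
  let ?E = std_exponential and ?P = "distr M borel X"
  interpret E: prob_space ?E by (rule prob_space_std_exponential)
  interpret P: prob_space ?P by (rule prob_space_distr) simp
  interpret EP: pair_sigma_finite ?E ?P ..
  define f where "f = (\<lambda>(w, x). (exp (\<beta> \<bullet> x - ln w / \<alpha>), x))"
  define N1 where "N1 = distr M (borel \<Otimes>\<^sub>M borel) (\<lambda>\<omega>. (Y \<omega>, X \<omega>))"
  define N2 where "N2 = distr (?E \<Otimes>\<^sub>M ?P) (borel \<Otimes>\<^sub>M borel) f"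
  have fm[measurable]: "f \<in> measurable (borel \<Otimes>\<^sub>M borel) (borel \<Otimes>\<^sub>M borel)"
    unfolding f_def by measurable
  have sEP: "sets (?E \<Otimes>\<^sub>M ?P) = sets (borel \<Otimes>\<^sub>M borel)"
    by (intro sets_pair_measure_cong) simp_all
  have fm'[measurable]: "f \<in> measurable (?E \<Otimes>\<^sub>M ?P) (borel \<Otimes>\<^sub>M borel)"
    using fm measurable_cong_sets[OF sEP refl] by blast
  have "N1 = N2"
  proof (rule measure_eqI_generator_eq)
    let ?G = "{a \<times> b | a b. a \<in> range (\<lambda>y::real. {..y}) \<and> b \<in> sets (borel :: (real^'p) measure)}"
    show "Int_stable ?G"
    proof (rule Int_stableI, clarsimp)
      fix y z :: real and b c :: "(real^'p) set" assume "b \<in> sets borel" "c \<in> sets borel"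
      then show "\<exists>a d. {..y} \<times> b \<inter> {..z} \<times> c = a \<times> d \<and> a \<in> range (\<lambda>y. {..y}) \<and> d \<in> sets borel"
        by (intro exI[of _ "{..min y z}"] exI[of _ "b \<inter> c"]) auto
    qed
    show "?G \<subseteq> Pow UNIV" by simp
    show "sets N1 = sigma_sets UNIV ?G" "sets N2 = sigma_sets UNIV ?G"
      unfolding N1_def N2_def sets_distr by (rule sets_pair_borel_generator)+
    have "{..real n} \<times> UNIV \<in> ?G" for n
      by (intro CollectI exI[of _ "{..real n}"] exI[of _ UNIV]) auto
    then show "range (\<lambda>n. {..real n} \<times> UNIV) \<subseteq> ?G" by blast
    show "(\<Union>n. {..real n} \<times> UNIV) = UNIV" using real_arch_simple by auto
    interpret N1: prob_space N1 unfolding N1_def by (rule prob_space_distr) simp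
    show "emeasure N1 ({..real n} \<times> UNIV) \<noteq> \<infinity>" for n by simp
    fix S assume "S \<in> ?G"
    then obtain y B where S: "S = {..y} \<times> B" and B[measurable]: "B \<in> sets borel" by auto
    have SS: "S \<in> sets (borel \<Otimes>\<^sub>M borel)" unfolding S by measurable
    have 1: "emeasure N1 S = emeasure M {\<omega> \<in> space M. Y \<omega> \<le> y \<and> X \<omega> \<in> B}"
      unfolding N1_def by (subst emeasure_distr[OF _ SS]) (auto simp: S intro!: arg_cong[where f = "emeasure M"])
    have sets2: "f -` S \<inter> space (?E \<Otimes>\<^sub>M ?P) \<in> sets (?E \<Otimes>\<^sub>M ?P)"
      by (rule measurable_sets[OF fm' SS])
    have 2: "emeasure N2 S = (\<integral>\<^sup>+x. emeasure ?E ((\<lambda>w. (w, x)) -` (f -` S \<inter> space (?E \<Otimes>\<^sub>M ?P))) \<partial>?P)"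
      unfolding N2_def by (subst emeasure_distr[OF fm' SS]) (rule EP.emeasure_pair_measure_alt2[OF sets2])
    have pre: "(\<lambda>w. (w, x)) -` (f -` S \<inter> space (?E \<Otimes>\<^sub>M ?P)) = (if x \<in> B then {w. exp (\<beta> \<bullet> x - ln w / \<alpha>) \<le> y} else {})" for x
      by (auto simp: f_def S space_pair_measure)
    show "emeasure N1 S = emeasure N2 S"
    proof (cases "y > 0")
      case False
      have n1: "{\<omega> \<in> space M. Y \<omega> \<le> y \<and> X \<omega> \<in> B} = {}"
        using pos False by force
      have n2: "{w. exp (\<beta> \<bullet> x - ln w / \<alpha>) \<le> y} = {}" for x
        using False by (auto simp: not_le intro: le_less_trans[OF _ exp_gt_zero])
      show ?thesis unfolding 1 2 pre n1 n2 by simp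
    next
      case True
      define c where "c x = (y / exp (\<beta> \<bullet> x)) powr (- \<alpha>)" for x
      have c: "c x = exp (\<alpha> * (\<beta> \<bullet> x - ln y))" for x
        using True by (simp add: c_def powr_def ln_div algebra_simps)
      \<comment> \<open>The response decreases in \<open>w\<close>, so an upper bound
        \<open>y\<close> on it is a lower bound \<open>c x\<close> on \<open>w\<close>, and the
        exponential tail is the distribution function of the model.\<close>
      have E: "emeasure ?E {w. exp (\<beta> \<bullet> x - ln w / \<alpha>) \<le> y} = ennreal (exp (- c x))" for x
      proof -
        have "emeasure ?E {w. exp (\<beta> \<bullet> x - ln w / \<alpha>) \<le> y} = emeasure ?E {c x..}"
        proof (rule emeasure_eq_AE)
          show "AE w in ?E. w \<in> {w. exp (\<beta> \<bullet> x - ln w / \<alpha>) \<le> y} \<longleftrightarrow> w \<in> {c x..}"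
            using std_exponential_pos
          proof eventually_elim
            case (elim w)
            have "exp (\<beta> \<bullet> x - ln w / \<alpha>) \<le> y \<longleftrightarrow> \<beta> \<bullet> x - ln w / \<alpha> \<le> ln y"
              using True by (metis exp_le_cancel_iff exp_ln)
            also have "\<dots> \<longleftrightarrow> \<alpha> * (\<beta> \<bullet> x - ln y) \<le> ln w"
              using \<alpha> by (auto simp: field_simps)
            also have "\<dots> \<longleftrightarrow> c x \<le> w"
              unfolding c using elim by (metis exp_le_cancel_iff exp_ln)
            finally show ?case by simp
          qed
        qed measurable
        also have "\<dots> = ennreal (exp (- c x))"
          by (rule emeasure_std_exponential_ge) (simp add: c)
        finally show ?thesis .
      qed
      have "emeasure N2 S = (\<integral>\<^sup>+x. indicator B x * ennreal (exp (- c x)) \<partial>?P)"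
        unfolding 2 pre by (intro nn_integral_cong) (auto simp: E)
      also have "\<dots> = (\<integral>\<^sup>+\<omega>. indicator B (X \<omega>) * ennreal (exp (- c (X \<omega>))) \<partial>M)"
        by (rule nn_integral_distr) (simp_all add: c_def)
      also have "\<dots> = emeasure N1 S"
        unfolding 1 c_def by (rule frechet_regression_joint_cdf[OF X Y model True B, symmetric])
      finally show ?thesis by simp
    qed
  qed
  define h where "h = (\<lambda>(y, x). (exp (\<alpha> * (\<beta> \<bullet> x - ln y)), x))"
  have hm[measurable]: "h \<in> measurable (borel \<Otimes>\<^sub>M borel) (borel \<Otimes>\<^sub>M borel)"
    unfolding h_def by measurable
  have "distr M (borel \<Otimes>\<^sub>M borel) (\<lambda>\<omega>. (exp (\<alpha> * (\<beta> \<bullet> X \<omega> - ln (Y \<omega>))), X \<omega>)) = distr N1 (borel \<Otimes>\<^sub>M borel) h"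
    unfolding N1_def by (subst distr_distr) (auto simp: comp_def h_def)
  also have "\<dots> = distr (?E \<Otimes>\<^sub>M ?P) (borel \<Otimes>\<^sub>M borel) (h \<circ> f)"
    unfolding \<open>N1 = N2\<close> N2_def by (rule distr_distr[OF hm fm'])
  also have "\<dots> = distr (?E \<Otimes>\<^sub>M ?P) (?E \<Otimes>\<^sub>M ?P) (\<lambda>p. p)"
  proof (rule distr_cong_AE)
    \<comment> \<open>\<open>h\<close> inverts \<open>f\<close> only for positive \<open>w\<close>,
      where \<open>exp\<close> and \<open>ln\<close> cancel; the exponential law is concentrated
      there.\<close>
    have "AE p in ?E \<Otimes>\<^sub>M ?P. fst p > 0"
    proof -
      have "AE w in ?E. AE x in ?P. fst (w, x) > 0"
        using std_exponential_pos by eventually_elim simp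
      moreover have "{p \<in> space (?E \<Otimes>\<^sub>M ?P). fst p > 0} \<in> sets (?E \<Otimes>\<^sub>M ?P)" by measurable
      ultimately show ?thesis by (rule EP.AE_pair_measure[rotated])
    qed
    then show "AE p in ?E \<Otimes>\<^sub>M ?P. (h \<circ> f) p = p"
      by eventually_elim (use \<alpha> in \<open>auto simp: h_def f_def split: prod.splits\<close>)
    show "h \<circ> f \<in> measurable (?E \<Otimes>\<^sub>M ?P) (borel \<Otimes>\<^sub>M borel)"
      by (rule measurable_comp[OF fm' hm])
  qed (simp_all add: sEP)
  also have "\<dots> = ?E \<Otimes>\<^sub>M ?P" by (rule distr_id)
  finally show ?thesis .
qed

section \<open>Fisher information\<close>

lemma sum_UNIV_option: "(\<Sum>i\<in>UNIV. f i) = f None + (\<Sum>j\<in>UNIV. f (Some j))"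
  for f :: "'n::finite option \<Rightarrow> 'a::comm_monoid_add"
  by (simp add: UNIV_option_conv sum.reindex)

lemma stack_nth [simp]: "stack p $ None = fst p" "stack p $ Some j = snd p $ j"
  by (auto simp: stack_def split: prod.splits)

lemma inner_stack: "stack p \<bullet> stack q = fst p * fst q + snd p \<bullet> snd q"
  by (simp add: inner_vec_def sum_UNIV_option)

lemma linear_stack: "linear stack"
proof (rule linearI)
  show "stack (p + q) = stack p + stack q" for p q :: "real \<times> (real^'p)"
  proof -
    have "stack (p + q) $ i = (stack p + stack q) $ i" for i by (cases i) simp_all
    then show ?thesis by (simp add: vec_eq_iff)
  qed
  show "stack (c *\<^sub>R p) = c *\<^sub>R stack p" for c and p :: "real \<times> (real^'p)"
  proof -
    have "stack (c *\<^sub>R p) $ i = (c *\<^sub>R stack p) $ i" for i by (cases i) simp_all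
    then show ?thesis by (simp add: vec_eq_iff)
  qed
qed

lemma norm_stack: "norm (stack p) = norm p"
proof -
  have "(norm (stack p))\<^sup>2 = (norm p)\<^sup>2"
    unfolding power2_norm_eq_inner inner_stack by (simp add: inner_prod_def)
  then show ?thesis by simp
qed

definition unstack :: "real ^ 'p option \<Rightarrow> real \<times> (real ^ 'p)" where
  "unstack u = (u $ None, \<chi> j. u $ Some j)"

lemma stack_unstack [simp]: "stack (unstack u) = u"
proof -
  have "stack (unstack u) $ i = u $ i" for i by (cases i) (simp_all add: unstack_def)
  then show ?thesis by (simp add: vec_eq_iff)
qed

lemma unstack_stack [simp]: "unstack (stack p) = p"
  by (simp add: unstack_def prod_eq_iff vec_eq_iff)

lemma inner_unstack: "t \<bullet> stack p = fst (unstack t) * fst p + snd (unstack t) \<bullet> snd p"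
  using inner_stack[of "unstack t" p] by simp

lemma continuous_on_stack [continuous_intros]:
  "continuous_on S f \<Longrightarrow> continuous_on S (\<lambda>x. stack (f x))"
  by (rule continuous_on_compose2[OF linear_continuous_on[OF linear_conv_bounded_linear[THEN iffD1, OF linear_stack]]]) auto

text \<open>The norm is at most the dimension times the largest absolute coordinate, whose
  exponential is at most the sum over its two signs. All coordinates appear on the right because the
  largest one depends on \<open>x\<close>.\<close>

lemma exp_norm_le:
  fixes x :: "real^'p"
  assumes "c \<ge> 0"
  shows "exp (c * norm x) \<le> (\<Sum>j\<in>UNIV. exp (axis j (c * CARD('p)) \<bullet> x) + exp (axis j (- (c * CARD('p))) \<bullet> x))"
proof -
  obtain k :: 'p where k: "\<And>j. \<bar>x $ j\<bar> \<le> \<bar>x $ k\<bar>"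
  proof -
    have "Max (range (\<lambda>j. \<bar>x $ j\<bar>)) \<in> range (\<lambda>j. \<bar>x $ j\<bar>)" by (rule Max_in) auto
    then obtain k where "Max (range (\<lambda>j. \<bar>x $ j\<bar>)) = \<bar>x $ k\<bar>" by blast
    then show thesis by (intro that[of k]) (metis Max_ge finite_class.finite_UNIV finite_imageI rangeI)
  qed
  have "norm x \<le> (\<Sum>j\<in>UNIV. \<bar>x $ j\<bar>)" by (rule norm_le_l1_cart)
  also have "\<dots> \<le> (\<Sum>j\<in>(UNIV :: 'p set). \<bar>x $ k\<bar>)" by (intro sum_mono k)
  also have "\<dots> = CARD('p) * \<bar>x $ k\<bar>" by simp
  finally have "c * norm x \<le> c * (CARD('p) * \<bar>x $ k\<bar>)" using assms by (intro mult_left_mono)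
  then have "exp (c * norm x) \<le> exp (c * (CARD('p) * \<bar>x $ k\<bar>))" by simp
  also have "\<dots> \<le> exp (axis k (c * CARD('p)) \<bullet> x) + exp (axis k (- (c * CARD('p))) \<bullet> x)"
    by (cases "x $ k \<ge> 0") (simp_all add: inner_axis' mult_ac add_increasing add_increasing2)
  also have "\<dots> \<le> (\<Sum>j\<in>UNIV. exp (axis j (c * CARD('p)) \<bullet> x) + exp (axis j (- (c * CARD('p))) \<bullet> x))"
    by (rule member_le_sum) auto
  finally show ?thesis .
qed

text \<open>Passes from exponentials of linear forms near zero to exponentials of the norm; the
  radius shrinks by the factor \<open>CARD('p)\<close> from \<open>exp_norm_le\<close>.\<close>

lemma integrable_exp_norm:
  fixes X :: "'a \<Rightarrow> real^'p"
  assumes X[measurable]: "X \<in> borel_measurable M"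
    and mgf: "\<forall>\<^sub>F t in nhds 0. integrable M (\<lambda>\<omega>. exp (t \<bullet> X \<omega>))"
  obtains r where "r > 0" "\<And>c. 0 \<le> c \<Longrightarrow> c < r \<Longrightarrow> integrable M (\<lambda>\<omega>. exp (c * norm (X \<omega>)))"
proof -
  obtain d where d: "d > 0" "\<And>t. dist t 0 < d \<Longrightarrow> integrable M (\<lambda>\<omega>. exp (t \<bullet> X \<omega>))"
    using mgf unfolding eventually_nhds_metric by auto
  show thesis
  proof (rule that[of "d / CARD('p)"])
    show "d / real CARD('p) > 0" using d by simp
    fix c assume c: "0 \<le> c" "c < d / real CARD('p)"
    then have cd: "c * CARD('p) < d" by (simp add: field_simps)
    show "integrable M (\<lambda>\<omega>. exp (c * norm (X \<omega>)))"
    proof (rule integrable_of_abs_le)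
      show "integrable M (\<lambda>\<omega>. \<Sum>j\<in>UNIV. exp (axis j (c * CARD('p)) \<bullet> X \<omega>) + exp (axis j (- (c * CARD('p))) \<bullet> X \<omega>))"
        using c cd by (intro Bochner_Integration.integrable_sum Bochner_Integration.integrable_add d)
          (simp_all add: norm_eq_sqrt_inner inner_axis_axis)
    qed (use exp_norm_le[OF c(1)] in auto)
  qed
qed

section \<open>Moments and information of a single observation\<close>

locale frechet_pair = prob_space M for M :: "'a measure" +
  fixes X :: "'a \<Rightarrow> real^'p" and Y :: "'a \<Rightarrow> real" and \<alpha> :: real and \<beta> :: "real^'p"
  assumes X[measurable]: "X \<in> borel_measurable M" and Y[measurable]: "Y \<in> borel_measurable M"
    and pos: "\<And>\<omega>. \<omega> \<in> space M \<Longrightarrow> Y \<omega> > 0"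
    and model: "frechet_regression M Y X (\<alpha>, \<beta>)" and \<alpha>: "\<alpha> > 0"
    and mgf: "\<forall>\<^sub>F t in nhds 0. integrable M (\<lambda>\<omega>. exp (t \<bullet> X \<omega>))"
begin

text \<open>On the sample space this is \<open>(Y \<omega> / exp (\<beta> \<bullet> X \<omega>))
  powr (- \<alpha>)\<close>; the exponential form gives positivity and the logarithm at
  once.\<close>

definition W where "W \<omega> = exp (\<alpha> * (\<beta> \<bullet> X \<omega> - ln (Y \<omega>)))"

lemma W_pos: "W \<omega> > 0" by (simp add: W_def)

lemma W_measurable[measurable]: "W \<in> borel_measurable M"
  unfolding W_def by measurable

lemma joint_law: "distr M (borel \<Otimes>\<^sub>M borel) (\<lambda>\<omega>. (W \<omega>, X \<omega>)) = std_exponential \<Otimes>\<^sub>M distr M borel X"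
  using frechet_regression_joint_law[OF X Y pos model \<alpha>] by (simp add: W_def)

lemma distr_W: "distr M borel W = std_exponential"
proof -
  interpret P: prob_space "distr M borel X" by (rule prob_space_distr) simp
  have "distr M borel W = distr (distr M (borel \<Otimes>\<^sub>M borel) (\<lambda>\<omega>. (W \<omega>, X \<omega>))) borel fst"
    by (subst distr_distr) (auto simp: comp_def)
  also have "\<dots> = distr (std_exponential \<Otimes>\<^sub>M distr M borel X) std_exponential fst"
    unfolding joint_law by (rule distr_cong) auto
  also have "\<dots> = std_exponential"
    by (rule P.distr_pair_fst)
  finally show ?thesis .
qed

text \<open>The joint law of \<open>W\<close> and \<open>X\<close> is a product, and its image under
  the pair of \<open>g\<close> and \<open>h\<close> is again one.\<close>

lemma indep_W_X:
  fixes g :: "real \<Rightarrow> real" and h :: "real^'p \<Rightarrow> real"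
  assumes g[measurable]: "g \<in> borel_measurable borel" and h[measurable]: "h \<in> borel_measurable borel"
  shows "indep_var borel (\<lambda>\<omega>. g (W \<omega>)) borel (\<lambda>\<omega>. h (X \<omega>))"
proof -
  have "distr M borel (\<lambda>\<omega>. g (W \<omega>)) = distr std_exponential borel g"
    unfolding distr_W[symmetric] by (subst distr_distr) (simp_all add: comp_def)
  moreover have "distr M borel (\<lambda>\<omega>. h (X \<omega>)) = distr (distr M borel X) borel h"
    by (subst distr_distr) (simp_all add: comp_def)
  moreover have "distr std_exponential borel g \<Otimes>\<^sub>M distr (distr M borel X) borel h =
      distr (std_exponential \<Otimes>\<^sub>M distr M borel X) (borel \<Otimes>\<^sub>M borel) (\<lambda>(w, x). (g w, h x))"
  proof (rule pair_measure_distr)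
    have "prob_space (distr (distr M borel X) borel h)"
      by (intro prob_space.prob_space_distr prob_space_distr) simp_all
    then show "sigma_finite_measure (distr (distr M borel X) borel h)"
      by (rule prob_space_imp_sigma_finite)
  qed simp_all
  moreover have "distr (std_exponential \<Otimes>\<^sub>M distr M borel X) (borel \<Otimes>\<^sub>M borel) (\<lambda>(w, x). (g w, h x)) =
      distr M (borel \<Otimes>\<^sub>M borel) (\<lambda>\<omega>. (g (W \<omega>), h (X \<omega>)))"
    unfolding joint_law[symmetric] by (subst distr_distr) (simp_all add: comp_def)
  ultimately show ?thesis
    unfolding indep_var_distribution_eq by simp
qed

lemma integrable_W_iff: "g \<in> borel_measurable borel \<Longrightarrow> integrable M (\<lambda>\<omega>. g (W \<omega>)) \<longleftrightarrow> integrable std_exponential g"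
  for g :: "real \<Rightarrow> real"
  using integrable_distr_eq[OF W_measurable, of g] by (simp add: distr_W)

lemma expectation_W: "g \<in> borel_measurable borel \<Longrightarrow> expectation (\<lambda>\<omega>. g (W \<omega>)) = (LINT w|std_exponential. g w)"
  for g :: "real \<Rightarrow> real"
  using integral_distr[OF W_measurable, of g] by (simp add: distr_W)

lemma expectation_mult:
  fixes g :: "real \<Rightarrow> real" and h :: "real^'p \<Rightarrow> real"
  assumes "g \<in> borel_measurable borel" "h \<in> borel_measurable borel"
    and "integrable M (\<lambda>\<omega>. g (W \<omega>))" "integrable M (\<lambda>\<omega>. h (X \<omega>))"
  shows "integrable M (\<lambda>\<omega>. g (W \<omega>) * h (X \<omega>))"
    and "expectation (\<lambda>\<omega>. g (W \<omega>) * h (X \<omega>)) = expectation (\<lambda>\<omega>. g (W \<omega>)) * expectation (\<lambda>\<omega>. h (X \<omega>))"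
proof -
  from indep_var_integrable[OF indep_W_X[OF assms(1,2)] assms(3,4)]
    indep_var_lebesgue_integral[OF indep_W_X[OF assms(1,2)] assms(3,4)]
  show "integrable M (\<lambda>\<omega>. g (W \<omega>) * h (X \<omega>))"
    "expectation (\<lambda>\<omega>. g (W \<omega>) * h (X \<omega>)) = expectation (\<lambda>\<omega>. g (W \<omega>)) * expectation (\<lambda>\<omega>. h (X \<omega>))" .
qed

lemma integrable_W_moment: "integrable M (\<lambda>\<omega>. W \<omega> ^ k * ln (W \<omega>) ^ j)"
  using integrable_W_iff[of "\<lambda>w. w ^ k * ln w ^ j"] integrable_std_exponential_moment[of k j] by simp

lemma W_moments:
  "integrable M W" "expectation W = 1"
  "integrable M (\<lambda>\<omega>. (W \<omega>)\<^sup>2)" "expectation (\<lambda>\<omega>. (W \<omega>)\<^sup>2) = 2"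
  "integrable M (\<lambda>\<omega>. ln (W \<omega>))" "expectation (\<lambda>\<omega>. ln (W \<omega>)) = - euler_mascheroni"
  "integrable M (\<lambda>\<omega>. W \<omega> * ln (W \<omega>))" "expectation (\<lambda>\<omega>. W \<omega> * ln (W \<omega>)) = 1 - euler_mascheroni"
  "integrable M (\<lambda>\<omega>. (W \<omega>)\<^sup>2 * ln (W \<omega>))" "expectation (\<lambda>\<omega>. (W \<omega>)\<^sup>2 * ln (W \<omega>)) = 3 - 2 * euler_mascheroni"
  "integrable M (\<lambda>\<omega>. (ln (W \<omega>))\<^sup>2)" "expectation (\<lambda>\<omega>. (ln (W \<omega>))\<^sup>2) = pi\<^sup>2 / 6 + euler_mascheroni\<^sup>2"
  "integrable M (\<lambda>\<omega>. W \<omega> * (ln (W \<omega>))\<^sup>2)"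
  "expectation (\<lambda>\<omega>. W \<omega> * (ln (W \<omega>))\<^sup>2) = pi\<^sup>2 / 6 + (1 - euler_mascheroni)\<^sup>2 - 1"
  "integrable M (\<lambda>\<omega>. (W \<omega>)\<^sup>2 * (ln (W \<omega>))\<^sup>2)"
  "expectation (\<lambda>\<omega>. (W \<omega>)\<^sup>2 * (ln (W \<omega>))\<^sup>2) = 2 * (pi\<^sup>2 / 6 + (1 - euler_mascheroni)\<^sup>2 - euler_mascheroni)"
  using integrable_W_moment[of 1 0] integrable_W_moment[of 2 0] integrable_W_moment[of 0 1]
    integrable_W_moment[of 1 1] integrable_W_moment[of 2 1] integrable_W_moment[of 0 2]
    integrable_W_moment[of 1 2] integrable_W_moment[of 2 2]
    expectation_W[of "\<lambda>w. w"] expectation_W[of "\<lambda>w. w\<^sup>2"] expectation_W[of ln]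
    expectation_W[of "\<lambda>w. w * ln w"] expectation_W[of "\<lambda>w. w\<^sup>2 * ln w"] expectation_W[of "\<lambda>w. (ln w)\<^sup>2"]
    expectation_W[of "\<lambda>w. w * (ln w)\<^sup>2"] expectation_W[of "\<lambda>w. w\<^sup>2 * (ln w)\<^sup>2"]
  by (simp_all add: integral_std_exponential)

lemma integrable_X_poly: "integrable M (\<lambda>\<omega>. norm (X \<omega>) ^ k)"
proof -
  obtain r where r: "r > 0" "\<And>c. 0 \<le> c \<Longrightarrow> c < r \<Longrightarrow> integrable M (\<lambda>\<omega>. exp (c * norm (X \<omega>)))"
    using integrable_exp_norm[OF X mgf] by blast
  obtain C where C: "C > 0" "\<And>x. x \<ge> 0 \<Longrightarrow> x ^ k \<le> C * exp (r / 2 * x)"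
    using power_le_const_exp[of "r / 2" k] r by auto
  have "integrable M (\<lambda>\<omega>. C * exp (r / 2 * norm (X \<omega>)))"
    by (intro integrable_mult_right r) (use r in auto)
  then show ?thesis by (rule integrable_of_abs_le) (use C in auto)
qed

lemma integrable_X: "integrable M X"
proof -
  have "integrable M (\<lambda>\<omega>. norm (X \<omega>))" using integrable_X_poly[of 1] by simp
  then show ?thesis by (rule Bochner_Integration.integrable_bound) auto
qed

lemma integrable_inner_X: "integrable M (\<lambda>\<omega>. v \<bullet> X \<omega>)" "integrable M (\<lambda>\<omega>. (v \<bullet> X \<omega>)\<^sup>2)"
  using integrable_inner_right[OF integrable_X] integrable_inner_square[OF X integrable_X_poly] by auto

definition \<xi> where "\<xi> \<omega> = stack (ln (W \<omega>) / \<alpha>, \<alpha> *\<^sub>R X \<omega>)"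

definition e :: "real^'p option" where "e = stack (1 / \<alpha>, 0)"

text \<open>The critical values of \<open>W\<close> are those near zero: the moment of order
  \<open>-c\<close> is finite only for \<open>c < 1\<close>. This forces
  \<open>d / \<alpha> < 1\<close>, while the covariate part asks for
  \<open>d * \<alpha> < r\<close>; independence separates the two.\<close>

lemma integrable_exponential_moment:
  obtains d where "d > 0" "integrable M (\<lambda>\<omega>. (1 + (W \<omega>)\<^sup>2) * exp (d * norm (\<xi> \<omega>)))"
proof -
  obtain r where r: "r > 0" "\<And>c. 0 \<le> c \<Longrightarrow> c < r \<Longrightarrow> integrable M (\<lambda>\<omega>. exp (c * norm (X \<omega>)))"
    using integrable_exp_norm[OF X mgf] by blast
  \<comment> \<open>Half of each of the two admissible bounds, so that both inequalities are
    strict.\<close>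
  define d where "d = min (\<alpha> / 2) (r / (2 * \<alpha>))"
  have d: "d > 0" "d / \<alpha> < 1" "d * \<alpha> < r"
  proof -
    show "d > 0" using \<alpha> r by (simp add: d_def)
    have "d \<le> \<alpha> / 2" "d \<le> r / (2 * \<alpha>)" by (simp_all add: d_def)
    then have "d / \<alpha> \<le> 1 / 2" "d * \<alpha> \<le> r / 2" using \<alpha> by (simp_all add: field_simps)
    then show "d / \<alpha> < 1" "d * \<alpha> < r" using r by linarith+
  qed
  define c where "c = d / \<alpha>"
  have c: "0 < c" "c < 1" using d \<alpha> by (simp_all add: c_def)
  have ie: "integrable M (\<lambda>\<omega>. exp (q * ln (W \<omega>)))" if "q > -1" for q
    using integrable_W_iff[of "\<lambda>w. exp (q * ln w)"] integral_std_exponential_power_ln(1)[OF that, of 0] by simp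
  \<comment> \<open>The expansion of \<open>(1 + W^2)\<close> times the sum of \<open>W\<close> to
    the powers \<open>c\<close> and \<open>-c\<close>; all exponents exceed -1.\<close>
  let ?h = "\<lambda>\<omega>. exp (c * ln (W \<omega>)) + exp ((- c) * ln (W \<omega>)) + (exp ((2 + c) * ln (W \<omega>)) + exp ((2 - c) * ln (W \<omega>)))"
  have "integrable M (\<lambda>\<omega>. (1 + (W \<omega>)\<^sup>2) * exp (c * \<bar>ln (W \<omega>)\<bar>))"
  proof (rule integrable_of_abs_le)
    show "integrable M ?h" using c by (intro Bochner_Integration.integrable_add ie) auto
    fix \<omega>
    have W2: "(W \<omega>)\<^sup>2 = exp (2 * ln (W \<omega>))" using W_pos[of \<omega>] by (simp add: exp_double)
    have "exp (c * \<bar>ln (W \<omega>)\<bar>) \<le> exp (c * ln (W \<omega>)) + exp ((- c) * ln (W \<omega>))"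
      by (cases "ln (W \<omega>) \<ge> 0") (simp_all add: add_increasing add_increasing2)
    then have "(1 + (W \<omega>)\<^sup>2) * exp (c * \<bar>ln (W \<omega>)\<bar>) \<le> (1 + (W \<omega>)\<^sup>2) * (exp (c * ln (W \<omega>)) + exp ((- c) * ln (W \<omega>)))"
      by (intro mult_left_mono) auto
    also have "\<dots> = ?h \<omega>"
      unfolding W2 by (simp add: algebra_simps exp_add[symmetric] exp_diff exp_minus divide_inverse)
    finally show "\<bar>(1 + (W \<omega>)\<^sup>2) * exp (c * \<bar>ln (W \<omega>)\<bar>)\<bar> \<le> ?h \<omega>"
      by (simp add: abs_mult)
  qed simp
  moreover have "integrable M (\<lambda>\<omega>. exp ((d * \<alpha>) * norm (X \<omega>)))" using d \<alpha> by (intro r) auto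
  ultimately have prod: "integrable M (\<lambda>\<omega>. (1 + (W \<omega>)\<^sup>2) * exp (c * \<bar>ln (W \<omega>)\<bar>) * exp ((d * \<alpha>) * norm (X \<omega>)))"
    using expectation_mult(1)[of "\<lambda>w. (1 + w\<^sup>2) * exp (c * \<bar>ln w\<bar>)" "\<lambda>x. exp ((d * \<alpha>) * norm x)"] by simp
  have [measurable]: "\<xi> \<in> borel_measurable M"
    unfolding \<xi>_def
    by (rule measurable_compose[OF _ borel_measurable_continuous_onI[OF continuous_on_stack[OF continuous_on_id]]]) measurable
  have "integrable M (\<lambda>\<omega>. (1 + (W \<omega>)\<^sup>2) * exp (d * norm (\<xi> \<omega>)))"
  proof (rule integrable_of_abs_le[OF prod])
    fix \<omega>
    have "norm (\<xi> \<omega>) \<le> \<bar>ln (W \<omega>)\<bar> / \<alpha> + \<alpha> * norm (X \<omega>)"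
      unfolding \<xi>_def norm_stack using norm_Pair_le[of "ln (W \<omega>) / \<alpha>" "\<alpha> *\<^sub>R X \<omega>"] \<alpha> by simp
    then have "d * norm (\<xi> \<omega>) \<le> d * (\<bar>ln (W \<omega>)\<bar> / \<alpha> + \<alpha> * norm (X \<omega>))"
      using d by (intro mult_left_mono) auto
    also have "\<dots> = c * \<bar>ln (W \<omega>)\<bar> + (d * \<alpha>) * norm (X \<omega>)"
      by (simp add: c_def algebra_simps)
    finally have "exp (d * norm (\<xi> \<omega>)) \<le> exp (c * \<bar>ln (W \<omega>)\<bar>) * exp ((d * \<alpha>) * norm (X \<omega>))"
      by (simp add: exp_add[symmetric])
    then show "\<bar>(1 + (W \<omega>)\<^sup>2) * exp (d * norm (\<xi> \<omega>))\<bar> \<le>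
        (1 + (W \<omega>)\<^sup>2) * exp (c * \<bar>ln (W \<omega>)\<bar>) * exp ((d * \<alpha>) * norm (X \<omega>))"
      unfolding abs_mult mult.assoc by (simp add: mult_left_mono)
  qed simp
  then show thesis using d(1) by (rule that[rotated])
qed

text \<open>The form is arranged in the quantities \<open>fst (unstack t) / \<alpha>\<close> and
  \<alpha> times the projection of \<open>X\<close>, because these are the coefficient of
  \<open>ln W\<close> and the covariate part in \<open>t \<bullet> \<xi> \<omega>\<close>.\<close>

lemma fisher_form:
  "t \<bullet> (frechet_fisher M X \<alpha> *v t) =
     (fst (unstack t) / \<alpha>)\<^sup>2 * (pi\<^sup>2 / 6 + (1 - euler_mascheroni)\<^sup>2) +
     2 * (fst (unstack t) / \<alpha>) * (1 - euler_mascheroni) * (\<alpha> * expectation (\<lambda>\<omega>. snd (unstack t) \<bullet> X \<omega>)) +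
     \<alpha>\<^sup>2 * expectation (\<lambda>\<omega>. (snd (unstack t) \<bullet> X \<omega>)\<^sup>2)"
proof -
  define h where "h = fst (unstack t)"
  define v where "v = snd (unstack t)"
  have t: "t $ None = h" "t $ Some j = v $ j" for j by (simp_all add: h_def v_def unstack_def)
  define m where "m = (LINT \<omega>|M. X \<omega>)"
  have vm: "expectation (\<lambda>\<omega>. v \<bullet> X \<omega>) = (\<Sum>j\<in>UNIV. v $ j * m $ j)"
    using integral_inner_right[OF integrable_X, of v] by (simp add: m_def inner_vec_def)
  have ixx: "integrable M (\<lambda>\<omega>. X \<omega> $ j * X \<omega> $ k)" for j k
  proof (rule Bochner_Integration.integrable_bound[OF integrable_X_poly[of 2]])
    show "AE \<omega> in M. norm (X \<omega> $ j * X \<omega> $ k) \<le> norm (norm (X \<omega>) ^ 2)"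
      by (rule AE_I2) (auto simp: abs_mult power2_eq_square intro!: mult_mono component_le_norm_cart)
  qed (simp add: cart_eq_inner_axis)
  have "expectation (\<lambda>\<omega>. (v \<bullet> X \<omega>)\<^sup>2) = expectation (\<lambda>\<omega>. \<Sum>j\<in>UNIV. \<Sum>k\<in>UNIV. v $ j * v $ k * (X \<omega> $ j * X \<omega> $ k))"
    by (simp add: power2_eq_square inner_vec_def sum_product mult_ac)
  also have "\<dots> = (\<Sum>j\<in>UNIV. \<Sum>k\<in>UNIV. v $ j * v $ k * expectation (\<lambda>\<omega>. X \<omega> $ j * X \<omega> $ k))"
    using ixx by (simp add: Bochner_Integration.integral_sum)
  finally have vv: "expectation (\<lambda>\<omega>. (v \<bullet> X \<omega>)\<^sup>2) = (\<Sum>j\<in>UNIV. \<Sum>k\<in>UNIV. v $ j * v $ k * expectation (\<lambda>\<omega>. X \<omega> $ j * X \<omega> $ k))" .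
  define p where "p = pi\<^sup>2 / 6 + (1 - euler_mascheroni)\<^sup>2"
  define g :: real where "g = 1 - euler_mascheroni"
  have "t \<bullet> (frechet_fisher M X \<alpha> *v t) =
      h * (1 / \<alpha>\<^sup>2 * p * h + (\<Sum>k\<in>UNIV. g * m $ k * v $ k)) +
      (\<Sum>j\<in>UNIV. v $ j * (g * m $ j * h + (\<Sum>k\<in>UNIV. \<alpha>\<^sup>2 * expectation (\<lambda>\<omega>. X \<omega> $ j * X \<omega> $ k) * v $ k)))"
    by (simp add: inner_vec_def matrix_vector_mult_def sum_UNIV_option t frechet_fisher_def p_def g_def m_def)
  also have "\<dots> = (h / \<alpha>)\<^sup>2 * p + 2 * h * g * (\<Sum>j\<in>UNIV. v $ j * m $ j) +
      \<alpha>\<^sup>2 * (\<Sum>j\<in>UNIV. \<Sum>k\<in>UNIV. v $ j * v $ k * expectation (\<lambda>\<omega>. X \<omega> $ j * X \<omega> $ k))"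
    by (simp add: power2_eq_square sum_distrib_left distrib_left sum.distrib mult_ac)
  finally show ?thesis
    unfolding h_def[symmetric] v_def[symmetric] vm vv p_def g_def using \<alpha> by simp
qed

text \<open>With \<open>t \<bullet> \<xi> \<omega> = a * ln (W \<omega>) + \<alpha> * b
  \<omega>\<close> and \<open>b\<close> independent of \<open>W\<close>, every expectation expands
  into products of moments. The information identity is thereby verified by direct calculation of
  both sides.\<close>

lemma score_cov_hess:
  shows "expectation (\<lambda>\<omega>. (1 - W \<omega>) * (t \<bullet> \<xi> \<omega>)) = - (t \<bullet> e)"
    and "expectation (\<lambda>\<omega>. (t \<bullet> (e + (1 - W \<omega>) *\<^sub>R \<xi> \<omega>))\<^sup>2) = t \<bullet> (frechet_fisher M X \<alpha> *v t)"
    and "(t \<bullet> e)\<^sup>2 + expectation (\<lambda>\<omega>. W \<omega> * (t \<bullet> \<xi> \<omega>)\<^sup>2) = t \<bullet> (frechet_fisher M X \<alpha> *v t)"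
proof -
  define a where "a = fst (unstack t) / \<alpha>"
  define v where "v = snd (unstack t)"
  define b where "b \<omega> = v \<bullet> X \<omega>" for \<omega>
  have te: "t \<bullet> e = a" by (simp add: e_def inner_unstack a_def)
  have t\<xi>: "t \<bullet> \<xi> \<omega> = a * ln (W \<omega>) + \<alpha> * b \<omega>" for \<omega>
    by (simp add: \<xi>_def inner_unstack a_def b_def v_def)
  have bi: "integrable M b" "integrable M (\<lambda>\<omega>. (b \<omega>)\<^sup>2)"
    unfolding b_def by (rule integrable_inner_X)+
  have mult: "integrable M (\<lambda>\<omega>. g (W \<omega>) * b \<omega>)" "expectation (\<lambda>\<omega>. g (W \<omega>) * b \<omega>) = expectation (\<lambda>\<omega>. g (W \<omega>)) * expectation b"
    "integrable M (\<lambda>\<omega>. g (W \<omega>) * (b \<omega>)\<^sup>2)" "expectation (\<lambda>\<omega>. g (W \<omega>) * (b \<omega>)\<^sup>2) = expectation (\<lambda>\<omega>. g (W \<omega>)) * expectation (\<lambda>\<omega>. (b \<omega>)\<^sup>2)"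
    if "g \<in> borel_measurable borel" "integrable M (\<lambda>\<omega>. g (W \<omega>))" for g :: "real \<Rightarrow> real"
    using expectation_mult[of g "\<lambda>x. v \<bullet> x"] expectation_mult[of g "\<lambda>x. (v \<bullet> x)\<^sup>2"] that bi
    unfolding b_def by simp_all
  note W = W_moments
  note m0 = mult[of "\<lambda>w. w", simplified, OF W(1)]
  note m2 = mult[of "\<lambda>w. w\<^sup>2", simplified, OF W(3)]
  note ml = mult[of ln, simplified, OF W(5)]
  note m1l = mult[of "\<lambda>w. w * ln w", simplified, OF W(7)]
  note m2l = mult[of "\<lambda>w. w\<^sup>2 * ln w", simplified, OF W(9)]
  note ints = W(1,3,5,7,9,11,13,15) bi m0(1,3) m2(1,3) ml(1) m1l(1) m2l(1)
  note exps = W(2,4,6,8,10,12,14,16) m0(2,4) m2(2,4) ml(2) m1l(2) m2l(2)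
  have "expectation (\<lambda>\<omega>. (1 - W \<omega>) * (t \<bullet> \<xi> \<omega>)) =
      expectation (\<lambda>\<omega>. a * ln (W \<omega>) - a * (W \<omega> * ln (W \<omega>)) + \<alpha> * b \<omega> - \<alpha> * (W \<omega> * b \<omega>))"
    unfolding t\<xi> by (simp add: algebra_simps)
  also have "\<dots> = - a" using ints by (simp add: exps) (simp add: algebra_simps)
  finally show "expectation (\<lambda>\<omega>. (1 - W \<omega>) * (t \<bullet> \<xi> \<omega>)) = - (t \<bullet> e)" unfolding te .
  have F: "t \<bullet> (frechet_fisher M X \<alpha> *v t) = a\<^sup>2 * (pi\<^sup>2 / 6 + (1 - euler_mascheroni)\<^sup>2) +
     2 * a * (1 - euler_mascheroni) * (\<alpha> * expectation b) + \<alpha>\<^sup>2 * expectation (\<lambda>\<omega>. (b \<omega>)\<^sup>2)"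
    unfolding fisher_form a_def b_def v_def ..
  have "expectation (\<lambda>\<omega>. W \<omega> * (t \<bullet> \<xi> \<omega>)\<^sup>2) =
      expectation (\<lambda>\<omega>. a\<^sup>2 * (W \<omega> * (ln (W \<omega>))\<^sup>2) + 2 * a * \<alpha> * (W \<omega> * ln (W \<omega>) * b \<omega>) + \<alpha>\<^sup>2 * (W \<omega> * (b \<omega>)\<^sup>2))"
    unfolding t\<xi> by (simp add: power2_eq_square algebra_simps)
  also have "\<dots> = a\<^sup>2 * (pi\<^sup>2 / 6 + (1 - euler_mascheroni)\<^sup>2 - 1) + 2 * a * \<alpha> * ((1 - euler_mascheroni) * expectation b) +
      \<alpha>\<^sup>2 * expectation (\<lambda>\<omega>. (b \<omega>)\<^sup>2)"
    using ints by (simp add: exps)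
  finally show "(t \<bullet> e)\<^sup>2 + expectation (\<lambda>\<omega>. W \<omega> * (t \<bullet> \<xi> \<omega>)\<^sup>2) = t \<bullet> (frechet_fisher M X \<alpha> *v t)"
    unfolding te F by (simp add: algebra_simps)
  have "expectation (\<lambda>\<omega>. (t \<bullet> (e + (1 - W \<omega>) *\<^sub>R \<xi> \<omega>))\<^sup>2) =
      expectation (\<lambda>\<omega>. a\<^sup>2 * (1 + 2 * ln (W \<omega>) - 2 * (W \<omega> * ln (W \<omega>)) + (ln (W \<omega>))\<^sup>2 - 2 * (W \<omega> * (ln (W \<omega>))\<^sup>2) + (W \<omega>)\<^sup>2 * (ln (W \<omega>))\<^sup>2)
        + 2 * a * \<alpha> * (b \<omega> - W \<omega> * b \<omega> + ln (W \<omega>) * b \<omega> - 2 * (W \<omega> * ln (W \<omega>) * b \<omega>) + (W \<omega>)\<^sup>2 * ln (W \<omega>) * b \<omega>)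
        + \<alpha>\<^sup>2 * ((b \<omega>)\<^sup>2 - 2 * (W \<omega> * (b \<omega>)\<^sup>2) + (W \<omega>)\<^sup>2 * (b \<omega>)\<^sup>2))"
    by (rule Bochner_Integration.integral_cong)
      (simp_all add: inner_add_right te t\<xi> power2_eq_square algebra_simps)
  also have "\<dots> = t \<bullet> (frechet_fisher M X \<alpha> *v t)"
    unfolding F using ints by (simp add: exps prob_space) (simp add: power2_eq_square algebra_simps)
  finally show "expectation (\<lambda>\<omega>. (t \<bullet> (e + (1 - W \<omega>) *\<^sub>R \<xi> \<omega>))\<^sup>2) = t \<bullet> (frechet_fisher M X \<alpha> *v t)" .
qed

lemma fisher_symmetric: "transpose (frechet_fisher M X \<alpha>) = frechet_fisher M X \<alpha>"
  by (auto simp: vec_eq_iff transpose_def frechet_fisher_def mult.commute split: option.split)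

text \<open>The curvature expression writes the form as a sum of two nonnegative terms. If it
  vanishes, the term from \<open>e\<close> annihilates the shape component, and what remains is the
  second moment of a projection of \<open>X\<close>, which nondegeneracy makes positive.\<close>

lemma fisher_positive_definite:
  assumes nondeg: "\<And>a. a \<noteq> 0 \<Longrightarrow> \<P>(\<omega> in M. a \<bullet> X \<omega> = 0) < 1" and t: "t \<noteq> 0"
  shows "t \<bullet> (frechet_fisher M X \<alpha> *v t) > 0"
proof (rule ccontr)
  assume "\<not> ?thesis"
  moreover have E0: "expectation (\<lambda>\<omega>. W \<omega> * (t \<bullet> \<xi> \<omega>)\<^sup>2) \<ge> 0"
    using W_pos by (intro integral_nonneg_AE AE_I2) (simp add: less_imp_le)
  ultimately have "(t \<bullet> e)\<^sup>2 = 0" and E: "expectation (\<lambda>\<omega>. W \<omega> * (t \<bullet> \<xi> \<omega>)\<^sup>2) = 0"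
    using score_cov_hess(3)[of t] zero_le_power2[of "t \<bullet> e"] by linarith+
  then have te: "t \<bullet> e = 0" by simp
  have h: "fst (unstack t) = 0" using te \<alpha> by (simp add: e_def inner_unstack)
  define v where "v = snd (unstack t)"
  have "v \<noteq> 0"
  proof
    assume "v = 0"
    then have "unstack t = 0" using h by (simp add: v_def prod_eq_iff)
    then have "stack (unstack t) = 0" using linear_0[OF linear_stack] by simp
    then show False using t by simp
  qed
  have "t \<bullet> (frechet_fisher M X \<alpha> *v t) = \<alpha>\<^sup>2 * expectation (\<lambda>\<omega>. (v \<bullet> X \<omega>)\<^sup>2)"
    using fisher_form[of t] h by (simp add: v_def)
  moreover have "t \<bullet> (frechet_fisher M X \<alpha> *v t) = 0"
    using score_cov_hess(3)[of t] te E by simp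
  ultimately have "expectation (\<lambda>\<omega>. (v \<bullet> X \<omega>)\<^sup>2) = 0" using \<alpha> by simp
  then have "AE \<omega> in M. (v \<bullet> X \<omega>)\<^sup>2 = 0"
    using integral_nonneg_eq_0_iff_AE[OF integrable_inner_X(2), of v] by simp
  then have "AE \<omega> in M. v \<bullet> X \<omega> = 0" by simp
  then have "\<P>(\<omega> in M. v \<bullet> X \<omega> = 0) = 1" by (intro prob_Collect_eq_1[THEN iffD2]) auto
  then show False using nondeg[OF \<open>v \<noteq> 0\<close>] by simp
qed

end

section \<open>The conditional maximum likelihood estimator\<close>

text \<open>In the coordinates \<open>(a, a (b - \<beta>) / \<alpha>)\<close> of the parameter \<open>(a, b)\<close>, the log-likelihood is concave.
  They have the same first-order behaviour at \<open>(\<alpha>, \<beta>)\<close> as \<open>(a, b)\<close>; \<open>u\<close> is the deviation from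
  \<open>(\<alpha>, 0)\<close> scaled by \<open>sqrt n\<close>.\<close>

definition reparam :: "real \<Rightarrow> real^'p \<Rightarrow> nat \<Rightarrow> real ^ 'p option \<Rightarrow> real \<times> (real^'p)" where
  "reparam \<alpha> \<beta> n u = (let a = \<alpha> + u $ None / sqrt (real n) in
     (a, \<beta> + (\<alpha> / (sqrt (real n) * a)) *\<^sub>R snd (unstack u)))"

lemma inner_stack_left: "stack p \<bullet> u = fst p * u $ None + snd p \<bullet> snd (unstack u)"
  using inner_unstack[of u p] by (simp add: inner_commute unstack_def)

text \<open>The argument of \<open>gumbel_g\<close> at the new parameter is \<open>ln (W i)\<close>
  plus the local linear form, and the logarithm of the shape splits off \<open>ln \<alpha>\<close>.
  The sum that is added to \<open>local_loglik\<close> is the log-likelihood at the true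
  parameter.\<close>

lemma frechet_criterion_reparam:
  fixes x :: "nat \<Rightarrow> real^'p" and y :: "nat \<Rightarrow> real" and \<beta> :: "real^'p"
  assumes n: "n > 0" and \<alpha>: "\<alpha> > 0" and u: "u \<in> local_params (stack (1 / \<alpha>, 0)) n"
  defines "W i \<equiv> exp (\<alpha> * (\<beta> \<bullet> x i - ln (y i)))"
  shows "fst (reparam \<alpha> \<beta> n u) > 0"
    and "frechet_criterion n y x (reparam \<alpha> \<beta> n u) =
      (local_loglik (stack (1 / \<alpha>, 0)) n W (\<lambda>i. stack (ln (W i) / \<alpha>, \<alpha> *\<^sub>R x i)) u +
        (\<Sum>i<n. ln \<alpha> + ln (W i) - W i)) / real n"
proof -
  define s where "s = sqrt (real n)"
  have s: "s > 0" using n by (simp add: s_def)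
  define h where "h = u $ None"
  define v where "v = snd (unstack u)"
  define a where "a = \<alpha> + h / s"
  have eu: "stack (1 / \<alpha>, 0) \<bullet> u = h / \<alpha>" by (simp add: inner_stack_left h_def)
  have a_eq: "a = \<alpha> * (1 + stack (1 / \<alpha>, 0) \<bullet> u / s)"
    using \<alpha> by (simp add: a_def eu field_simps)
  have p: "1 + stack (1 / \<alpha>, 0) \<bullet> u / s > 0" using u by (simp add: local_params_def s_def)
  have a: "a > 0" unfolding a_eq using p \<alpha> by simp
  have r: "reparam \<alpha> \<beta> n u = (a, \<beta> + (\<alpha> / (s * a)) *\<^sub>R v)"
    by (simp add: reparam_def a_def h_def s_def v_def Let_def)
  show "fst (reparam \<alpha> \<beta> n u) > 0" using a by (simp add: r)
  have obj: "frechet_obj (a, \<beta> + (\<alpha> / (s * a)) *\<^sub>R v) (y i) (x i) =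
      ln (1 + stack (1 / \<alpha>, 0) \<bullet> u / s) +
      (stack (ln (W i) / \<alpha>, \<alpha> *\<^sub>R x i) \<bullet> u / s - W i * (exp (stack (ln (W i) / \<alpha>, \<alpha> *\<^sub>R x i) \<bullet> u / s) - 1)) +
      (ln \<alpha> + ln (W i) - W i)" for i
  proof -
    have lnW: "ln (W i) = \<alpha> * (\<beta> \<bullet> x i - ln (y i))" by (simp add: W_def)
    have \<xi>: "stack (ln (W i) / \<alpha>, \<alpha> *\<^sub>R x i) \<bullet> u / s = (h / \<alpha> * ln (W i) + \<alpha> * (v \<bullet> x i)) / s"
      by (simp add: inner_stack_left h_def v_def) (simp add: inner_commute)
    have "a * ((\<beta> + (\<alpha> / (s * a)) *\<^sub>R v) \<bullet> x i - ln (y i)) = a * (\<beta> \<bullet> x i - ln (y i)) + \<alpha> * (v \<bullet> x i) / s"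
      using a s by (simp add: inner_add_left field_simps)
    also have "a * (\<beta> \<bullet> x i - ln (y i)) = ln (W i) + h / \<alpha> * ln (W i) / s"
      unfolding lnW a_def using \<alpha> s by (simp add: field_simps)
    finally have *: "a * ((\<beta> + (\<alpha> / (s * a)) *\<^sub>R v) \<bullet> x i - ln (y i)) =
        ln (W i) + stack (ln (W i) / \<alpha>, \<alpha> *\<^sub>R x i) \<bullet> u / s"
      unfolding \<xi> by (simp add: add_divide_distrib)
    have "exp (ln (W i)) = W i" by (simp add: W_def)
    moreover have "ln a = ln \<alpha> + ln (1 + stack (1 / \<alpha>, 0) \<bullet> u / s)"
      unfolding a_eq using \<alpha> p by (rule ln_mult_pos)
    ultimately show ?thesis
      unfolding frechet_obj_def prod.case * gumbel_g_def exp_add by (simp add: right_diff_distrib)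
  qed
  show "frechet_criterion n y x (reparam \<alpha> \<beta> n u) =
      (local_loglik (stack (1 / \<alpha>, 0)) n W (\<lambda>i. stack (ln (W i) / \<alpha>, \<alpha> *\<^sub>R x i)) u +
        (\<Sum>i<n. ln \<alpha> + ln (W i) - W i)) / real n"
    unfolding frechet_criterion_def r obj local_loglik_def s_def[symmetric] by (simp add: sum.distrib)
qed

lemma reparam_surj:
  assumes n: "n > 0" and \<alpha>: "\<alpha> > 0" and \<eta>: "\<eta> \<in> param_space"
  obtains u where "u \<in> local_params (stack (1 / \<alpha>, 0)) n" "reparam \<alpha> \<beta> n u = \<eta>"
proof -
  obtain a b where ab: "\<eta> = (a, b)" "a > 0" using \<eta> by (auto simp: param_space_def)
  define s where "s = sqrt (real n)"
  have s: "s > 0" using n by (simp add: s_def)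
  \<comment> \<open>The inverse substitution, from solving
    \<open>b - \<beta> = (\<alpha> / (s * a)) *\<^sub>R v\<close> for \<open>v\<close>.\<close>
  define u where "u = stack (s * (a - \<alpha>), (s * a / \<alpha>) *\<^sub>R (b - \<beta>))"
  show thesis
  proof (rule that[of u])
    have "1 + stack (1 / \<alpha>, 0) \<bullet> u / s = a / \<alpha>"
      using s \<alpha> by (simp add: inner_stack_left u_def field_simps)
    then show "u \<in> local_params (stack (1 / \<alpha>, 0)) n"
      using ab \<alpha> by (simp add: local_params_def s_def)
    show "reparam \<alpha> \<beta> n u = \<eta>"
      unfolding reparam_def s_def[symmetric] u_def using s \<alpha> ab by (simp add: Let_def)
  qed
qed

lemma continuous_on_reparam:
  assumes "n > 0" "\<alpha> > 0"
  shows "continuous_on (local_params (stack (1 / \<alpha>, 0)) n) (reparam \<alpha> \<beta> n)"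
proof -
  have nz: "\<alpha> + u $ None / sqrt (real n) \<noteq> 0" if "u \<in> local_params (stack (1 / \<alpha>, 0)) n" for u
    using frechet_criterion_reparam(1)[OF assms that] by (simp add: reparam_def Let_def)
  show ?thesis
    unfolding reparam_def Let_def unstack_def snd_conv
    by (intro continuous_intros) (use nz assms in auto)
qed

text \<open>The substitution maps the local parameters onto \<open>param_space\<close>, and the
  criterion is an increasing affine function of \<open>F\<close> with coefficients independent of
  \<open>u\<close>; so the sets of maximizers correspond.\<close>

lemma frechet_maximizers_reparam:
  fixes x :: "nat \<Rightarrow> real^'p" and y :: "nat \<Rightarrow> real" and \<beta> :: "real^'p"
  assumes n: "n > 0" and \<alpha>: "\<alpha> > 0"
  defines "W i \<equiv> exp (\<alpha> * (\<beta> \<bullet> x i - ln (y i)))"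
  defines "D \<equiv> local_params (stack (1 / \<alpha>, 0)) n"
    and "F \<equiv> local_loglik (stack (1 / \<alpha>, 0)) n W (\<lambda>i. stack (ln (W i) / \<alpha>, \<alpha> *\<^sub>R x i))"
  shows "frechet_maximizers n y x = reparam \<alpha> \<beta> n ` {u \<in> D. \<forall>v\<in>D. F v \<le> F u}"
proof -
  define C where "C = (\<Sum>i<n. ln \<alpha> + ln (W i) - W i)"
  have crit: "frechet_criterion n y x (reparam \<alpha> \<beta> n u) = (F u + C) / real n" if "u \<in> D" for u
    unfolding F_def C_def W_def[abs_def]
    by (rule frechet_criterion_reparam(2)[OF n \<alpha> that[unfolded D_def]])
  have le: "frechet_criterion n y x (reparam \<alpha> \<beta> n v) \<le> frechet_criterion n y x (reparam \<alpha> \<beta> n u) \<longleftrightarrow> F v \<le> F u"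
    if "u \<in> D" "v \<in> D" for u v
    unfolding crit[OF that(1)] crit[OF that(2)] using n by (simp add: divide_le_cancel)
  have inP: "reparam \<alpha> \<beta> n u \<in> param_space" if "u \<in> D" for u
    using frechet_criterion_reparam(1)[OF n \<alpha> that[unfolded D_def]]
    by (auto simp: param_space_def mem_Times_iff)
  show ?thesis
  proof (intro equalityI subsetI)
    fix \<eta> assume \<eta>: "\<eta> \<in> frechet_maximizers n y x"
    then obtain u where u: "u \<in> D" "reparam \<alpha> \<beta> n u = \<eta>"
      using reparam_surj[OF n \<alpha>] unfolding D_def frechet_maximizers_def by blast
    have "F v \<le> F u" if "v \<in> D" for v
      using \<eta> inP[OF that] le[OF u(1) that] unfolding frechet_maximizers_def u(2) by blast
    then show "\<eta> \<in> reparam \<alpha> \<beta> n ` {u \<in> D. \<forall>v\<in>D. F v \<le> F u}" using u by blast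
  next
    fix \<eta> assume "\<eta> \<in> reparam \<alpha> \<beta> n ` {u \<in> D. \<forall>v\<in>D. F v \<le> F u}"
    then obtain u where u: "u \<in> D" "\<And>v. v \<in> D \<Longrightarrow> F v \<le> F u" "\<eta> = reparam \<alpha> \<beta> n u" by blast
    have "frechet_criterion n y x \<eta>' \<le> frechet_criterion n y x \<eta>" if "\<eta>' \<in> param_space" for \<eta>'
    proof -
      obtain v where v: "v \<in> D" "reparam \<alpha> \<beta> n v = \<eta>'"
        using reparam_surj[OF n \<alpha> \<open>\<eta>' \<in> param_space\<close>] unfolding D_def by blast
      show ?thesis using le[OF u(1) v(1)] u(2)[OF v(1)] unfolding v(2) u(3) by blast
    qed
    then show "\<eta> \<in> frechet_maximizers n y x"
      using inP[OF u(1)] u(3) by (simp add: frechet_maximizers_def)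
  qed
qed

text \<open>In the second branch \<open>arg_min_on\<close> is a choice that is meaningful only if a
  minimum exists; continuity of the norm on a nonempty compact set provides one.\<close>

lemma frechet_cmle_mem:
  assumes "compact (frechet_maximizers n y x)" "frechet_maximizers n y x \<noteq> {}"
  shows "frechet_cmle n y x \<in> frechet_maximizers n y x"
proof (cases "\<exists>!\<eta>. \<eta> \<in> frechet_maximizers n y x")
  case True
  from theI'[OF this] show ?thesis using True unfolding frechet_cmle_def by simp
next
  case False
  let ?S = "frechet_maximizers n y x"
  obtain \<eta> where "\<eta> \<in> ?S" "\<And>\<eta>'. \<eta>' \<in> ?S \<Longrightarrow> norm \<eta> \<le> norm \<eta>'"
    using continuous_attains_inf[OF assms continuous_on_norm_id] by blast
  then have "is_arg_min norm (\<lambda>\<eta>. \<eta> \<in> ?S) \<eta>"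
    by (auto simp: is_arg_min_def not_less)
  then have "is_arg_min norm (\<lambda>\<eta>. \<eta> \<in> ?S) (arg_min_on norm ?S)"
    unfolding arg_min_on_def arg_min_def by (rule someI)
  then show ?thesis using False unfolding frechet_cmle_def by (simp add: is_arg_min_def)
qed

text \<open>The shape component is reproduced exactly, and the other one is off by the factor
  \<open>\<alpha> / a - 1\<close>. The hypothesis on \<open>K\<close> keeps \<open>a\<close> above
  \<open>\<alpha> / 2\<close>, which makes this factor of order \<open>K / sqrt n\<close>.\<close>

lemma reparam_error:
  assumes n: "n > 0" and \<alpha>: "\<alpha> > 0" and u: "norm u \<le> K" and K: "2 * K / \<alpha> \<le> sqrt (real n)"
  shows "norm (sqrt (real n) *\<^sub>R stack (reparam \<alpha> \<beta> n u - (\<alpha>, \<beta>)) - u) \<le> 2 * K\<^sup>2 / \<alpha> / sqrt (real n)"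
proof -
  define s where "s = sqrt (real n)"
  have s: "s > 0" using n by (simp add: s_def)
  have K0: "K \<ge> 0" using u norm_ge_zero order_trans by blast
  define h where "h = u $ None"
  define v where "v = snd (unstack u)"
  define a where "a = \<alpha> + h / s"
  have hK: "\<bar>h\<bar> \<le> K" using component_le_norm_cart[of u None] u by (simp add: h_def)
  have "norm (unstack u) \<le> K" using norm_stack[of "unstack u"] u by simp
  then have vK: "norm v \<le> K" using norm_snd_le[where x = "fst (unstack u)" and y = "snd (unstack u)"] by (simp add: v_def)
  have "2 * K \<le> \<alpha> * s" using K \<alpha> by (simp add: s_def field_simps)
  then have "\<bar>h\<bar> / s \<le> \<alpha> / 2" using hK s by (simp add: field_simps)
  then have "\<bar>h / s\<bar> \<le> \<alpha> / 2" using s by simp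
  then have a: "a \<ge> \<alpha> / 2" "a > 0" using \<alpha> unfolding a_def by linarith+
  have "s *\<^sub>R stack (reparam \<alpha> \<beta> n u - (\<alpha>, \<beta>)) - u = stack (s *\<^sub>R (reparam \<alpha> \<beta> n u - (\<alpha>, \<beta>)) - unstack u)"
    by (simp only: linear_cmul[OF linear_stack] linear_diff[OF linear_stack] stack_unstack)
  also have "s *\<^sub>R (reparam \<alpha> \<beta> n u - (\<alpha>, \<beta>)) - unstack u = (0, (\<alpha> / a - 1) *\<^sub>R v)"
  proof -
    have "reparam \<alpha> \<beta> n u = (a, \<beta> + (\<alpha> / (s * a)) *\<^sub>R v)"
      by (simp add: reparam_def a_def h_def s_def v_def Let_def)
    moreover have "unstack u = (h, v)" by (simp add: h_def v_def unstack_def)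
    ultimately show ?thesis using s by (simp add: a_def scaleR_diff_left)
  qed
  finally have "norm (s *\<^sub>R stack (reparam \<alpha> \<beta> n u - (\<alpha>, \<beta>)) - u) = \<bar>\<alpha> / a - 1\<bar> * norm v"
    by (simp add: norm_stack norm_Pair)
  also have "\<alpha> / a - 1 = - (h / s) / a" using a by (simp add: a_def field_simps)
  also have "\<bar>- (h / s) / a\<bar> * norm v \<le> (K / s / (\<alpha> / 2)) * K"
  proof (rule mult_mono)
    have "\<bar>- (h / s) / a\<bar> = \<bar>h\<bar> / s / a" using s a by (simp add: abs_divide)
    also have "\<dots> \<le> K / s / (\<alpha> / 2)"
      using hK s a \<alpha> K0 by (intro frac_le divide_right_mono divide_nonneg_pos) linarith+
    finally show "\<bar>- (h / s) / a\<bar> \<le> K / s / (\<alpha> / 2)" .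
  qed (use vK s \<alpha> K0 in auto)
  also have "\<dots> = 2 * K\<^sup>2 / \<alpha> / s" by (simp add: power2_eq_square mult_ac)
  finally show ?thesis by (simp add: s_def)
qed

theorem theorem5p1:
  fixes M :: "'a measure"
    and Y :: "nat \<Rightarrow> 'a \<Rightarrow> real"
    and X :: "nat \<Rightarrow> 'a \<Rightarrow> real ^ 'p"
    and \<alpha> :: real and \<beta> :: "real ^ 'p"
    and \<eta>hat :: "nat \<Rightarrow> 'a \<Rightarrow> real \<times> (real ^ 'p)"
  assumes "prob_space M"
    and indep: "prob_space.indep_vars M (\<lambda>_. borel) (\<lambda>i \<omega>. (Y i \<omega>, X i \<omega>)) UNIV"
    and ident: "\<And>i. distr M borel (\<lambda>\<omega>. (Y i \<omega>, X i \<omega>)) = distr M borel (\<lambda>\<omega>. (Y 0 \<omega>, X 0 \<omega>))"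
    and pos: "\<And>i \<omega>. \<omega> \<in> space M \<Longrightarrow> Y i \<omega> > 0"
    and true_param: "(\<alpha>, \<beta>) \<in> param_space"
    and model: "\<And>i. frechet_regression M (Y i) (X i) (\<alpha>, \<beta>)"
    and nondegenerate: "\<And>a. a \<noteq> 0 \<Longrightarrow> \<P>(\<omega> in M. a \<bullet> X 0 \<omega> = 0) < 1"
    and mgf: "\<forall>\<^sub>F t in nhds 0. integrable M (\<lambda>\<omega>. exp (t \<bullet> X 0 \<omega>))"
    and measurable: "\<And>n. \<eta>hat n \<in> borel_measurable M"
    and cmle: "\<And>n. n \<ge> CARD('p) + 1 \<Longrightarrow>
      AE \<omega> in M. \<eta>hat n \<omega> = frechet_cmle n (\<lambda>i. Y i \<omega>) (\<lambda>i. X i \<omega>)"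
  shows "converges_in_distribution M
    (\<lambda>n \<omega>. sqrt (real n) *\<^sub>R stack (\<eta>hat n \<omega> - (\<alpha>, \<beta>)))
    (multivariate_normal 0 (matrix_inv (frechet_fisher M (X 0) \<alpha>)))"
proof -
  interpret prob_space M by fact
  have \<alpha>: "\<alpha> > 0" using true_param by (simp add: param_space_def)
  have rv: "(\<lambda>\<omega>. (Y i \<omega>, X i \<omega>)) \<in> borel_measurable M" for i
    using indep by (simp add: indep_vars_def)
  have rvY: "Y i \<in> borel_measurable M" for i
    using measurable_compose[OF rv borel_measurable_continuous_onI[of fst]] by (simp add: continuous_intros)
  have rvX: "X i \<in> borel_measurable M" for i
    using measurable_compose[OF rv borel_measurable_continuous_onI[of snd]] by (simp add: continuous_intros)
  interpret P: frechet_pair M "X 0" "Y 0" \<alpha> \<beta>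
    by unfold_locales (fact rvX rvY pos model \<alpha> mgf)+
  define W where "W i \<omega> = exp (\<alpha> * (\<beta> \<bullet> X i \<omega> - ln (Y i \<omega>)))" for i \<omega>
  define \<xi> where "\<xi> i \<omega> = stack (ln (W i \<omega>) / \<alpha>, \<alpha> *\<^sub>R X i \<omega>)" for i \<omega>
  define e :: "real^'p option" where "e = stack (1 / \<alpha>, 0)"
  define J where "J = frechet_fisher M (X 0) \<alpha>"
  have W0: "W 0 = P.W" by (simp add: W_def P.W_def fun_eq_iff)
  have \<xi>0: "\<xi> 0 = P.\<xi>" by (simp add: \<xi>_def P.\<xi>_def fun_eq_iff W0)
  have e0: "e = P.e" by (simp add: e_def P.e_def)
  \<comment> \<open>One Borel function yields both \<open>W\<close> and \<xi> from an observation,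
    so independence and identical distribution carry over from the pairs.\<close>
  define f where "f p = (exp (\<alpha> * (\<beta> \<bullet> snd p - ln (fst p))),
      stack (\<alpha> * (\<beta> \<bullet> snd p - ln (fst p)) / \<alpha>, \<alpha> *\<^sub>R snd p))" for p :: "real \<times> (real^'p)"
  have f_eq: "f (Y i \<omega>, X i \<omega>) = (W i \<omega>, \<xi> i \<omega>)" for i \<omega>
    by (simp add: f_def W_def \<xi>_def)
  have f[measurable]: "f \<in> borel_measurable borel"
  proof -
    have st: "stack \<in> borel_measurable (borel :: (real \<times> (real^'p)) measure)"
      by (intro borel_measurable_continuous_onI continuous_on_stack continuous_on_id)
    have [measurable]: "fst \<in> borel_measurable (borel :: (real \<times> (real^'p)) measure)"
      "snd \<in> borel_measurable (borel :: (real \<times> (real^'p)) measure)"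
      by (intro borel_measurable_continuous_onI continuous_intros)+
    have "(\<lambda>p :: real \<times> (real^'p). stack (\<alpha> * (\<beta> \<bullet> snd p - ln (fst p)) / \<alpha>, \<alpha> *\<^sub>R snd p)) \<in> borel_measurable borel"
      by (rule measurable_compose[OF _ st]) measurable
    then show ?thesis unfolding f_def by (intro borel_measurable_Pair) measurable
  qed
  obtain d where d: "d > 0" "integrable M (\<lambda>\<omega>. (1 + (P.W \<omega>)\<^sup>2) * exp (d * norm (P.\<xi> \<omega>)))"
    by (rule P.integrable_exponential_moment)
  interpret L: exponential_local_model M W \<xi> e J d
  proof
    have "indep_vars (\<lambda>_. borel) (\<lambda>i \<omega>. f (Y i \<omega>, X i \<omega>)) UNIV"
      by (rule indep_vars_compose2[OF indep]) simp
    then show "indep_vars (\<lambda>_. borel) (\<lambda>i \<omega>. (W i \<omega>, \<xi> i \<omega>)) UNIV" unfolding f_eq .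
    have "distr M borel (\<lambda>\<omega>. f (Y i \<omega>, X i \<omega>)) = distr (distr M borel (\<lambda>\<omega>. (Y i \<omega>, X i \<omega>))) borel f" for i
      by (subst distr_distr[OF f rv]) (simp add: comp_def)
    then show "distr M borel (\<lambda>\<omega>. (W i \<omega>, \<xi> i \<omega>)) = distr M borel (\<lambda>\<omega>. (W 0 \<omega>, \<xi> 0 \<omega>))" for i
      using ident[of i] unfolding f_eq by simp
    show "W i \<omega> \<ge> 0" for i \<omega> by (simp add: W_def)
    show "integrable M (\<lambda>\<omega>. (1 + (W 0 \<omega>)\<^sup>2) * exp (d * norm (\<xi> 0 \<omega>)))"
      unfolding W0 \<xi>0 by (rule d)
    show "expectation (\<lambda>\<omega>. (1 - W 0 \<omega>) * (t \<bullet> \<xi> 0 \<omega>)) = - (t \<bullet> e)"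
      "expectation (\<lambda>\<omega>. (t \<bullet> (e + (1 - W 0 \<omega>) *\<^sub>R \<xi> 0 \<omega>))\<^sup>2) = t \<bullet> (J *v t)"
      "(t \<bullet> e)\<^sup>2 + expectation (\<lambda>\<omega>. W 0 \<omega> * (t \<bullet> \<xi> 0 \<omega>)\<^sup>2) = t \<bullet> (J *v t)" for t
      unfolding W0 \<xi>0 e0 J_def by (rule P.score_cov_hess)+
    show "transpose J = J" unfolding J_def by (rule P.fisher_symmetric)
    show "t \<bullet> (J *v t) > 0" if "t \<noteq> 0" for t
      unfolding J_def by (rule P.fisher_positive_definite[OF nondegenerate that])
  qed (rule d)
  define T where "T n \<omega> = sqrt (real n) *\<^sub>R stack (\<eta>hat n \<omega> - (\<alpha>, \<beta>))" for n \<omega>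
  have T[measurable]: "T n \<in> borel_measurable M" for n
  proof -
    have "(\<lambda>p. sqrt (real n) *\<^sub>R stack (p - (\<alpha>, \<beta>))) \<in> borel_measurable borel"
      by (intro borel_measurable_continuous_onI continuous_intros)
    from measurable_compose[OF measurable this] show ?thesis unfolding T_def .
  qed
  have maxi: "frechet_maximizers n (\<lambda>i. Y i \<omega>) (\<lambda>i. X i \<omega>) = reparam \<alpha> \<beta> n ` L.maximizers n \<omega>" if "n > 0" for n \<omega>
    unfolding L.maximizers_def unfolding W_def \<xi>_def e_def by (rule frechet_maximizers_reparam[OF that \<alpha>])
  have "converges_in_distribution M T (multivariate_normal 0 (matrix_inv J))"
  proof (rule multivariate_clt_slutsky[OF L.influence_indep L.influence_ident L.influence_square_integrable
        L.influence_mean L.influence_cov L.J T])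
    fix \<delta> :: real assume \<delta>: "\<delta> > 0"
    show "(\<lambda>n. prob {\<omega> \<in> space M. norm (T n \<omega> - (1 / sqrt (real n)) *\<^sub>R (\<Sum>i<n. L.influence i \<omega>)) > \<delta>}) \<longlonglongrightarrow> 0"
      unfolding L.estimator_def[symmetric]
    proof (rule tendstoI)
      fix \<epsilon> :: real assume \<epsilon>: "\<epsilon> > 0"
      obtain K where K: "K > 0" and ev: "\<forall>\<^sub>F n in sequentially. \<exists>G\<in>events. prob (space M - G) \<le> \<epsilon> / 2 \<and>
          (\<forall>\<omega>\<in>G. L.localized n K (\<delta> / 2) \<omega>)"
        using L.maximizers_near_estimator_eventually[of "\<delta> / 2" "\<epsilon> / 2"] \<delta> \<epsilon> by auto
      \<comment> \<open>A bound on the norm of every maximizer on the good event: the bound on the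
        estimator plus the localization radius.\<close>
      define K' where "K' = K + \<delta> / 2"
      have sq: "filterlim (\<lambda>n. sqrt (real n)) at_top sequentially"
        by (rule filterlim_compose[OF sqrt_at_top filterlim_real_sequentially])
      have evs: "\<forall>\<^sub>F n in sequentially. sqrt (real n) \<ge> c" for c
        using sq by (simp add: filterlim_at_top)
      \<comment> \<open>Half of \<delta> is spent on the distance from the maximizer to the
        estimator and half on \<open>reparam_error\<close>. The first threshold for
        \<open>sqrt (real n)\<close> is the hypothesis of that lemma, the second makes its bound at
        most \<open>\<delta> / 2\<close>.\<close>
      show "\<forall>\<^sub>F n in sequentially. dist (prob {\<omega> \<in> space M. norm (T n \<omega> - L.estimator n \<omega>) > \<delta>}) 0 < \<epsilon>"
        using ev evs[of "2 * K' / \<alpha>"] evs[of "2 * (2 * K'\<^sup>2 / \<alpha>) / \<delta>"] eventually_ge_at_top[of "CARD('p) + 1"]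
      proof eventually_elim
        case (elim n)
        have n: "n > 0" using elim(4) by simp
        obtain G where G: "G \<in> events" "prob (space M - G) \<le> \<epsilon> / 2"
          and good: "\<And>\<omega>. \<omega> \<in> G \<Longrightarrow> norm (L.estimator n \<omega>) \<le> K \<and> L.maximizers n \<omega> \<noteq> {} \<and>
            compact (L.maximizers n \<omega>) \<and> L.maximizers n \<omega> \<subseteq> cball (L.estimator n \<omega>) (\<delta> / 2)"
          using elim(1) unfolding L.localized_def by blast
        have close: "norm (T n \<omega> - L.estimator n \<omega>) \<le> \<delta>"
          if \<omega>: "\<omega> \<in> G" and \<eta>: "\<eta>hat n \<omega> = frechet_cmle n (\<lambda>i. Y i \<omega>) (\<lambda>i. X i \<omega>)" for \<omega>
        proof -
          have "L.maximizers n \<omega> \<subseteq> local_params (stack (1 / \<alpha>, 0)) n"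
            unfolding L.maximizers_def unfolding e_def by blast
          then have "compact (reparam \<alpha> \<beta> n ` L.maximizers n \<omega>)"
            using good[OF \<omega>] by (intro compact_continuous_image continuous_on_subset[OF continuous_on_reparam[OF n \<alpha>]]) auto
          then have "\<eta>hat n \<omega> \<in> reparam \<alpha> \<beta> n ` L.maximizers n \<omega>"
            unfolding \<eta> maxi[OF n, symmetric] using good[OF \<omega>] maxi[OF n, of \<omega>] by (intro frechet_cmle_mem) auto
          then obtain u where u: "u \<in> L.maximizers n \<omega>" "\<eta>hat n \<omega> = reparam \<alpha> \<beta> n u" by blast
          have uw: "norm (u - L.estimator n \<omega>) \<le> \<delta> / 2"
            using u(1) good[OF \<omega>] by (auto simp: dist_norm norm_minus_commute)
          have "norm u \<le> norm (L.estimator n \<omega>) + norm (u - L.estimator n \<omega>)" by (rule norm_triangle_sub)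
          then have "norm u \<le> K'" using uw good[OF \<omega>] by (simp add: K'_def)
          then have "norm (T n \<omega> - u) \<le> 2 * K'\<^sup>2 / \<alpha> / sqrt (real n)"
            unfolding T_def u(2) by (rule reparam_error[OF n \<alpha> _ elim(2)])
          also have "\<dots> \<le> \<delta> / 2" using elim(3) \<delta> n \<alpha> by (simp add: field_simps)
          finally have "norm (T n \<omega> - u) \<le> \<delta> / 2" .
          moreover have "norm (T n \<omega> - L.estimator n \<omega>) \<le> norm (T n \<omega> - u) + norm (u - L.estimator n \<omega>)"
            using norm_triangle_ineq[of "T n \<omega> - u" "u - L.estimator n \<omega>"] by simp
          ultimately show ?thesis using uw by linarith
        qed
        \<comment> \<open>The estimator agrees with \<open>frechet_cmle\<close> only almost surely,
          so the inclusion of the bad event in the complement of \<open>G\<close> holds only up to a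
          null set.\<close>
        have "prob {\<omega> \<in> space M. norm (T n \<omega> - L.estimator n \<omega>) > \<delta>} \<le> prob (space M - G)"
        proof (rule finite_measure_mono_AE)
          show "AE \<omega> in M. \<omega> \<in> {\<omega> \<in> space M. norm (T n \<omega> - L.estimator n \<omega>) > \<delta>} \<longrightarrow> \<omega> \<in> space M - G"
            using cmle[OF elim(4)]
          proof eventually_elim
            case (elim \<omega>)
            show ?case using close[OF _ elim] by fastforce
          qed
          show "space M - G \<in> events" using G by simp
        qed
        then show ?case using G(2) \<epsilon> by simp
      qed
    qed
  qed
  then show ?thesis unfolding J_def T_def .
qed

end
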